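(* Let $\mathfrak{g}$ be a complex simple Lie algebra, and let $V$ be a minuscule $\mathfrak{g}$-representation with minuscule weight $\lambda$ and minuscule heap $P_\lambda$. Suppose that $\mathfrak{g}$ is simply laced. Let $\rho$ denote the half-sum of the positive roots of $\mathfrak{g}$, and let $\Omega$ denote the common length of the roots. Let $f\colon J(P_\lambda)\to\mathbb{R}$ be defined by $I\mapsto |I|$. Then, with respect to the Fon-Der-Flaass action $\Psi$ on $J(P_\lambda)$, $f$ is $c$-mesic with $$c = 2\,\frac{(\lambda,\rho)}{\Omega^2}.$$
   Context: **Lie-theoretic setting.** $\mathfrak{g}$ is a complex simple Lie algebra with a fixed Cartan subalgebra $\mathfrak{h}$, root system $R$, and real span $\mathfrak{h}_{\mathbb{R}}^*$ of $R$ in $\mathfrak{h}^*$; $(\cdot,\cdot)$ is the inner product on $\mathfrak{h}_{\mathbb{R}}^*$ induced by the Killing form. The length of a root $\alpha$ is $\sqrt{(\alpha,\alpha)}$. For $\alpha\in R$, $\alpha^\vee := 2\alpha/(\alpha,\alpha)$. Fix simple roots $\alpha_1,\dots,\alpha_t$ (which determine the positive roots). The weight lattice is $\Lambda=\{\mu\in\mathfrak{h}_{\mathbb{R}}^* : (\mu,\alpha_i^\vee)\in\mathbb{Z}\ \forall i\}$, and $\mu\in\Lambda$ is dominant if $(\mu,\alpha_i^\vee)\ge 0$ for all $i$. $W$ is the Weyl group, generated by the simple reflections $s_i(\mu)=\mu-(\mu,\alpha_i^\vee)\alpha_i$, with longest element $w_0$. **Minuscule representations.** For dominant $\lambda$,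 $V^\lambda$ is the irreducible representation of highest weight $\lambda$ and $\Lambda_\lambda$ is its set of weights. An irreducible finite-dimensional representation $V\cong V^\lambda$ is minuscule, with minuscule weight $\lambda$, if $W$ acts transitively on $\Lambda_\lambda$. In that case $\Lambda_\lambda$ is partially ordered by the order opposite to the root order: covering relations are $\mu\lessdot\mu-\alpha_i$ (with $\mu,\mu-\alpha_i\in\Lambda_\lambda$), so $\lambda$ is the unique minimal element and $w_0\lambda$ the unique maximal element. It is a known fact that $\Lambda_\lambda$ is a distributive lattice; the minuscule poset for $V$ is its poset of join-irreducible elements. **Minuscule heap.** An element $w\in W$ is $\lambda$-minuscule if it has a reduced word $w=s_{i_\ell}\cdots s_{i_1}$ such that $\lambda\lessdot s_{i_1}\lambda\lessdot\cdots\lessdot (s_{i_\ell}\cdots s_{i_1})\lambda=w\lambda$ is a saturated chain in $\Lambda_\lambda$. There is a unique $\lambda$-minuscule $w$ with $w\lambda=w_0\lambda$. Take any reduced word $w=s_{i_\ell}\cdots s_{i_1}$ of it. The minuscule heap $P_\lambda$ is the labeled set $\{1,\dots,\ell\}$, where element $j$ is labeled by $i_j$ (equivalently, by the simple root $\alpha_{i_j}$), with the partial order that is the transitive closure of the relations $j<j'$ for all $1\le j<j'\le\ell$ such that $s_{i_j}$ and $s_{i_{j'}}$ do not commute. Up to isomorphism of labeled posets this does not depend on the reduced word, and as a poset $P_\lambda$ is isomorphic to the minuscule poset for $V$. **Order ideals and the Fon-Der-Flaass action.** For a finite poset $P$, $J(P)$ is the set of order ideals (down-closed subsets) of $P$.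 The Fon-Der-Flaass action $\Psi\colon J(P)\to J(P)$ is the bijection sending $I$ to the order ideal generated by the minimal elements of $P\setminus I$. **Homomesy.** Let $\mathcal{S}$ be a finite set and $\tau\colon\mathcal{S}\to\mathcal{S}$ a bijection of order $m$ (the least positive integer with $\tau^m=\mathrm{id}$). A function $f\colon\mathcal{S}\to\mathbb{R}$ is $c$-mesic with respect to $\tau$ if $\frac1m\sum_{k=0}^{m-1}f(\tau^k(x))=c$ for all $x\in\mathcal{S}$. *)

theory Defs
  imports
    Complex_Main
    "HOL-Algebra.Bij"
    "HOL-Algebra.Generated_Groups"
    "HOL-Library.Function_Algebras"
begin

section \<open>Complex Lie algebras and their representations\<close>

class complex_vector = ab_group_add +
  fixes scaleC :: "complex \<Rightarrow> 'a \<Rightarrow> 'a"  (infixr \<open>*\<^sub>C\<close> 75)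
  assumes scaleC_add_right: "a *\<^sub>C (x + y) = a *\<^sub>C x + a *\<^sub>C y"
    and scaleC_add_left: "(a + b) *\<^sub>C x = a *\<^sub>C x + b *\<^sub>C x"
    and scaleC_scaleC: "a *\<^sub>C b *\<^sub>C x = (a * b) *\<^sub>C x"
    and scaleC_one: "1 *\<^sub>C x = x"

interpretation complex_vector:
  vector_space "scaleC :: complex \<Rightarrow> 'a \<Rightarrow> 'a :: complex_vector"
  by unfold_locales (simp_all add: scaleC_add_right scaleC_add_left scaleC_scaleC scaleC_one)

class complex_lie_algebra = complex_vector +
  fixes bracket :: "'a \<Rightarrow> 'a \<Rightarrow> 'a"
  assumes bracket_add_left: "bracket (x + y) z = bracket x z + bracket y z"
    and bracket_add_right: "bracket x (y + z) = bracket x y + bracket x z"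
    and bracket_scaleC_left: "bracket (a *\<^sub>C x) y = a *\<^sub>C bracket x y"
    and bracket_scaleC_right: "bracket x (a *\<^sub>C y) = a *\<^sub>C bracket x y"
    and bracket_self: "bracket x x = 0"
    and jacobi: "bracket x (bracket y z) + bracket y (bracket z x) + bracket z (bracket x y) = 0"

definition finite_dimensional :: "'a :: complex_vector itself \<Rightarrow> bool" where
  "finite_dimensional _ \<longleftrightarrow> (\<exists>B :: 'a set. finite B \<and> complex_vector.span B = UNIV)"

definition lie_ideal :: "'g :: complex_lie_algebra set \<Rightarrow> bool" where
  "lie_ideal I \<longleftrightarrow> complex_vector.subspace I \<and> (\<forall>x. \<forall>y\<in>I. bracket x y \<in> I)"

definition simple_lie_algebra :: "'g :: complex_lie_algebra itself \<Rightarrow> bool" where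
  "simple_lie_algebra _ \<longleftrightarrow>
     finite_dimensional TYPE('g) \<and>
     (\<exists>x y :: 'g. bracket x y \<noteq> 0) \<and>
     (\<forall>I :: 'g set. lie_ideal I \<longrightarrow> I = {0} \<or> I = UNIV)"

definition lie_representation ::
    "('g :: complex_lie_algebra \<Rightarrow> 'v :: complex_vector \<Rightarrow> 'v) \<Rightarrow> bool" where
  "lie_representation \<pi> \<longleftrightarrow>
     (\<forall>x. Vector_Spaces.linear (*\<^sub>C) (*\<^sub>C) (\<pi> x)) \<and>
     (\<forall>v. Vector_Spaces.linear (*\<^sub>C) (*\<^sub>C) (\<lambda>x. \<pi> x v)) \<and>
     (\<forall>x y v. \<pi> (bracket x y) v = \<pi> x (\<pi> y v) - \<pi> y (\<pi> x v))"

definition irreducible_representation ::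
    "('g :: complex_lie_algebra \<Rightarrow> 'v :: complex_vector \<Rightarrow> 'v) \<Rightarrow> bool" where
  "irreducible_representation \<pi> \<longleftrightarrow>
     lie_representation \<pi> \<and>
     (\<exists>v :: 'v. v \<noteq> 0) \<and>
     (\<forall>U. complex_vector.subspace U \<and> (\<forall>x. \<forall>u\<in>U. \<pi> x u \<in> U) \<longrightarrow> U = {0} \<or> U = UNIV)"


section \<open>Cartan subalgebra, Killing form and roots\<close>

text \<open>This is the usual notion of a Cartan subalgebra of a complex semisimple Lie algebra: abelian,
  equal to its own centralizer, with every element acting diagonalizably in the adjoint
  representation.\<close>

definition cartan_subalgebra :: "'g :: complex_lie_algebra set \<Rightarrow> bool" where
  "cartan_subalgebra \<hh> \<longleftrightarrow>
     complex_vector.subspace \<hh> \<and>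
     (\<forall>x\<in>\<hh>. \<forall>y\<in>\<hh>. bracket x y = 0) \<and>
     (\<forall>y. (\<forall>x\<in>\<hh>. bracket x y = 0) \<longrightarrow> y \<in> \<hh>) \<and>
     (\<forall>x\<in>\<hh>. complex_vector.span {y. \<exists>c. bracket x y = c *\<^sub>C y} = UNIV)"

text \<open>The trace with respect to a fixed basis; on a finite-dimensional space its value on a
  linear map does not depend on the basis.\<close>

definition trace :: "('a :: complex_vector \<Rightarrow> 'a) \<Rightarrow> complex" where
  "trace f = (let B = complex_vector.extend_basis {} in
                \<Sum>b\<in>B. complex_vector.representation B (f b) b)"

definition killing_form :: "'g :: complex_lie_algebra \<Rightarrow> 'g \<Rightarrow> complex" where
  "killing_form x y = trace (\<lambda>z. bracket x (bracket y z))"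

text \<open>Elements of the dual space of \<open>\<hh>\<close> are represented as functions on the whole Lie algebra that
  vanish outside \<open>\<hh>\<close>, so that equality of functions is equality of functionals on \<open>\<hh>\<close>.\<close>

definition cartan_dual :: "'g :: complex_lie_algebra set \<Rightarrow> ('g \<Rightarrow> complex) set" where
  "cartan_dual \<hh> = {\<mu>.
     (\<forall>x\<in>\<hh>. \<forall>y\<in>\<hh>. \<mu> (x + y) = \<mu> x + \<mu> y) \<and>
     (\<forall>c. \<forall>x\<in>\<hh>. \<mu> (c *\<^sub>C x) = c * \<mu> x) \<and>
     (\<forall>x. x \<notin> \<hh> \<longrightarrow> \<mu> x = 0)}"

definition weight_space ::
    "'g :: complex_lie_algebra set \<Rightarrow> ('g \<Rightarrow> 'v :: complex_vector \<Rightarrow> 'v) \<Rightarrow> ('g \<Rightarrow> complex) \<Rightarrow> 'v set" where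
  "weight_space \<hh> \<pi> \<mu> = {v. \<forall>x\<in>\<hh>. \<pi> x v = \<mu> x *\<^sub>C v}"

definition weights ::
    "'g :: complex_lie_algebra set \<Rightarrow> ('g \<Rightarrow> 'v :: complex_vector \<Rightarrow> 'v) \<Rightarrow> ('g \<Rightarrow> complex) set" where
  "weights \<hh> \<pi> = {\<mu> \<in> cartan_dual \<hh>. \<exists>v\<in>weight_space \<hh> \<pi> \<mu>. v \<noteq> 0}"

definition roots :: "'g :: complex_lie_algebra set \<Rightarrow> ('g \<Rightarrow> complex) set" where
  "roots \<hh> = weights \<hh> bracket - {0}"

definition rscale :: "real \<Rightarrow> ('g \<Rightarrow> complex) \<Rightarrow> ('g \<Rightarrow> complex)" where
  "rscale r \<mu> = (\<lambda>x. of_real r * \<mu> x)"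

interpretation functional:
  vector_space "rscale :: real \<Rightarrow> ('g \<Rightarrow> complex) \<Rightarrow> ('g \<Rightarrow> complex)"
  by unfold_locales (auto simp: rscale_def algebra_simps)

definition real_dual :: "'g :: complex_lie_algebra set \<Rightarrow> ('g \<Rightarrow> complex) set" where
  "real_dual \<hh> = functional.span (roots \<hh>)"

text \<open>The Killing form restricted to \<open>\<hh>\<close> is non-degenerate, so every functional \<open>\<mu>\<close> is of the form
  \<open>\<kappa>(t\<^sub>\<mu>, -)\<close> for a unique \<open>t\<^sub>\<mu> \<in> \<hh>\<close>, and the induced form is \<open>(\<mu>, \<nu>) = \<kappa>(t\<^sub>\<mu>, t\<^sub>\<nu>)\<close>. It takes real
  values on the real span of the roots, the only place where it is used.\<close>

definition killing_dual :: "'g :: complex_lie_algebra set \<Rightarrow> ('g \<Rightarrow> complex) \<Rightarrow> 'g" where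
  "killing_dual \<hh> \<mu> = (THE x. x \<in> \<hh> \<and> (\<forall>y\<in>\<hh>. killing_form x y = \<mu> y))"

definition ip ::
    "'g :: complex_lie_algebra set \<Rightarrow> ('g \<Rightarrow> complex) \<Rightarrow> ('g \<Rightarrow> complex) \<Rightarrow> real" where
  "ip \<hh> \<mu> \<nu> = Re (killing_form (killing_dual \<hh> \<mu>) (killing_dual \<hh> \<nu>))"

definition root_length :: "'g :: complex_lie_algebra set \<Rightarrow> ('g \<Rightarrow> complex) \<Rightarrow> real" where
  "root_length \<hh> \<beta> = sqrt (ip \<hh> \<beta> \<beta>)"

definition simply_laced :: "'g :: complex_lie_algebra set \<Rightarrow> bool" where
  "simply_laced \<hh> \<longleftrightarrow> (\<forall>\<beta>\<in>roots \<hh>. \<forall>\<gamma>\<in>roots \<hh>. root_length \<hh> \<beta> = root_length \<hh> \<gamma>)"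

definition coroot :: "'g :: complex_lie_algebra set \<Rightarrow> ('g \<Rightarrow> complex) \<Rightarrow> ('g \<Rightarrow> complex)" where
  "coroot \<hh> \<beta> = rscale (2 / ip \<hh> \<beta> \<beta>) \<beta>"

definition simple_roots ::
    "'g :: complex_lie_algebra set \<Rightarrow> nat \<Rightarrow> (nat \<Rightarrow> 'g \<Rightarrow> complex) \<Rightarrow> bool" where
  "simple_roots \<hh> t \<alpha> \<longleftrightarrow>
     \<alpha> ` {1..t} \<subseteq> roots \<hh> \<and> inj_on \<alpha> {1..t} \<and>
     functional.independent (\<alpha> ` {1..t}) \<and> functional.span (\<alpha> ` {1..t}) = real_dual \<hh> \<and>
     (\<forall>\<beta>\<in>roots \<hh>. \<exists>c :: nat \<Rightarrow> int.
        \<beta> = (\<Sum>i=1..t. rscale (of_int (c i)) (\<alpha> i)) \<and>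
        ((\<forall>i\<in>{1..t}. c i \<ge> 0) \<or> (\<forall>i\<in>{1..t}. c i \<le> 0)))"

definition positive_roots ::
    "'g :: complex_lie_algebra set \<Rightarrow> nat \<Rightarrow> (nat \<Rightarrow> 'g \<Rightarrow> complex) \<Rightarrow> ('g \<Rightarrow> complex) set" where
  "positive_roots \<hh> t \<alpha> =
     {\<beta> \<in> roots \<hh>. \<exists>c :: nat \<Rightarrow> nat. \<beta> = (\<Sum>i=1..t. rscale (of_nat (c i)) (\<alpha> i))}"

definition half_sum_positive_roots ::
    "'g :: complex_lie_algebra set \<Rightarrow> nat \<Rightarrow> (nat \<Rightarrow> 'g \<Rightarrow> complex) \<Rightarrow> ('g \<Rightarrow> complex)" where
  "half_sum_positive_roots \<hh> t \<alpha> = rscale (1/2) (\<Sum>\<beta>\<in>positive_roots \<hh> t \<alpha>. \<beta>)"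

definition weight_lattice ::
    "'g :: complex_lie_algebra set \<Rightarrow> nat \<Rightarrow> (nat \<Rightarrow> 'g \<Rightarrow> complex) \<Rightarrow> ('g \<Rightarrow> complex) set" where
  "weight_lattice \<hh> t \<alpha> =
     {\<mu> \<in> real_dual \<hh>. \<forall>i\<in>{1..t}. ip \<hh> \<mu> (coroot \<hh> (\<alpha> i)) \<in> \<int>}"

definition dominant_weight ::
    "'g :: complex_lie_algebra set \<Rightarrow> nat \<Rightarrow> (nat \<Rightarrow> 'g \<Rightarrow> complex) \<Rightarrow> ('g \<Rightarrow> complex) \<Rightarrow> bool" where
  "dominant_weight \<hh> t \<alpha> \<mu> \<longleftrightarrow>
     \<mu> \<in> weight_lattice \<hh> t \<alpha> \<and> (\<forall>i\<in>{1..t}. ip \<hh> \<mu> (coroot \<hh> (\<alpha> i)) \<ge> 0)"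


section \<open>The Weyl group\<close>

text \<open>Weyl group elements are permutations of \<^term>\<open>real_dual \<hh>\<close>, extensional as in
  \<^const>\<open>BijGroup\<close>, whose multiplication is composition.\<close>

definition simple_reflection ::
    "'g :: complex_lie_algebra set \<Rightarrow> (nat \<Rightarrow> 'g \<Rightarrow> complex) \<Rightarrow> nat \<Rightarrow> ('g \<Rightarrow> complex) \<Rightarrow> ('g \<Rightarrow> complex)" where
  "simple_reflection \<hh> \<alpha> i =
     (\<lambda>\<mu>\<in>real_dual \<hh>. \<mu> - rscale (ip \<hh> \<mu> (coroot \<hh> (\<alpha> i))) (\<alpha> i))"

definition weyl_group ::
    "'g :: complex_lie_algebra set \<Rightarrow> nat \<Rightarrow> (nat \<Rightarrow> 'g \<Rightarrow> complex) \<Rightarrow> (('g \<Rightarrow> complex) \<Rightarrow> ('g \<Rightarrow> complex)) set" where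
  "weyl_group \<hh> t \<alpha> = generate (BijGroup (real_dual \<hh>)) (simple_reflection \<hh> \<alpha> ` {1..t})"

text \<open>A list \<open>[i\<^sub>1, \<dots>, i\<^sub>\<ell>]\<close> stands for the word \<open>s\<^bsub>i\<^sub>\<ell>\<^esub> \<cdots> s\<^bsub>i\<^sub>1\<^esub>\<close>: the head of the list acts first.\<close>

fun word_element ::
    "'g :: complex_lie_algebra set \<Rightarrow> (nat \<Rightarrow> 'g \<Rightarrow> complex) \<Rightarrow> nat list \<Rightarrow> ('g \<Rightarrow> complex) \<Rightarrow> ('g \<Rightarrow> complex)" where
  "word_element \<hh> \<alpha> [] = \<one>\<^bsub>BijGroup (real_dual \<hh>)\<^esub>"
| "word_element \<hh> \<alpha> (i # is) =
     word_element \<hh> \<alpha> is \<otimes>\<^bsub>BijGroup (real_dual \<hh>)\<^esub> simple_reflection \<hh> \<alpha> i"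

definition is_word_for ::
    "'g :: complex_lie_algebra set \<Rightarrow> nat \<Rightarrow> (nat \<Rightarrow> 'g \<Rightarrow> complex) \<Rightarrow> nat list
       \<Rightarrow> (('g \<Rightarrow> complex) \<Rightarrow> ('g \<Rightarrow> complex)) \<Rightarrow> bool" where
  "is_word_for \<hh> t \<alpha> is w \<longleftrightarrow> set is \<subseteq> {1..t} \<and> word_element \<hh> \<alpha> is = w"

definition weyl_length ::
    "'g :: complex_lie_algebra set \<Rightarrow> nat \<Rightarrow> (nat \<Rightarrow> 'g \<Rightarrow> complex) \<Rightarrow> (('g \<Rightarrow> complex) \<Rightarrow> ('g \<Rightarrow> complex)) \<Rightarrow> nat" where
  "weyl_length \<hh> t \<alpha> w = (LEAST n. \<exists>is. is_word_for \<hh> t \<alpha> is w \<and> length is = n)"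

definition reduced_word ::
    "'g :: complex_lie_algebra set \<Rightarrow> nat \<Rightarrow> (nat \<Rightarrow> 'g \<Rightarrow> complex) \<Rightarrow> nat list
       \<Rightarrow> (('g \<Rightarrow> complex) \<Rightarrow> ('g \<Rightarrow> complex)) \<Rightarrow> bool" where
  "reduced_word \<hh> t \<alpha> is w \<longleftrightarrow>
     is_word_for \<hh> t \<alpha> is w \<and> length is = weyl_length \<hh> t \<alpha> w"

definition longest_element ::
    "'g :: complex_lie_algebra set \<Rightarrow> nat \<Rightarrow> (nat \<Rightarrow> 'g \<Rightarrow> complex) \<Rightarrow> (('g \<Rightarrow> complex) \<Rightarrow> ('g \<Rightarrow> complex)) \<Rightarrow> bool" where
  "longest_element \<hh> t \<alpha> w\<^sub>0 \<longleftrightarrow>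
     w\<^sub>0 \<in> weyl_group \<hh> t \<alpha> \<and>
     (\<forall>w\<in>weyl_group \<hh> t \<alpha>. weyl_length \<hh> t \<alpha> w \<le> weyl_length \<hh> t \<alpha> w\<^sub>0)"


section \<open>Minuscule representations and minuscule heaps\<close>

definition has_highest_weight ::
    "'g :: complex_lie_algebra set \<Rightarrow> nat \<Rightarrow> (nat \<Rightarrow> 'g \<Rightarrow> complex)
       \<Rightarrow> ('g \<Rightarrow> 'v :: complex_vector \<Rightarrow> 'v) \<Rightarrow> ('g \<Rightarrow> complex) \<Rightarrow> bool" where
  "has_highest_weight \<hh> t \<alpha> \<pi> \<mu> \<longleftrightarrow>
     \<mu> \<in> cartan_dual \<hh> \<and>
     (\<exists>v\<in>weight_space \<hh> \<pi> \<mu>. v \<noteq> 0 \<and>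
        (\<forall>\<beta>\<in>positive_roots \<hh> t \<alpha>. \<forall>x\<in>weight_space \<hh> bracket \<beta>. \<pi> x v = 0))"

definition minuscule_representation ::
    "'g :: complex_lie_algebra set \<Rightarrow> nat \<Rightarrow> (nat \<Rightarrow> 'g \<Rightarrow> complex)
       \<Rightarrow> ('g \<Rightarrow> 'v :: complex_vector \<Rightarrow> 'v) \<Rightarrow> ('g \<Rightarrow> complex) \<Rightarrow> bool" where
  "minuscule_representation \<hh> t \<alpha> \<pi> \<mu> \<longleftrightarrow>
     irreducible_representation \<pi> \<and> finite_dimensional TYPE('v) \<and>
     dominant_weight \<hh> t \<alpha> \<mu> \<and> has_highest_weight \<hh> t \<alpha> \<pi> \<mu> \<and>
     (\<forall>\<nu>\<in>weights \<hh> \<pi>. \<forall>\<nu>'\<in>weights \<hh> \<pi>. \<exists>w\<in>weyl_group \<hh> t \<alpha>. w \<nu> = \<nu>')"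

text \<open>Covering relation of the set of weights under the order opposite to the root order.\<close>

definition weight_covers ::
    "'g :: complex_lie_algebra set \<Rightarrow> nat \<Rightarrow> (nat \<Rightarrow> 'g \<Rightarrow> complex)
       \<Rightarrow> ('g \<Rightarrow> 'v :: complex_vector \<Rightarrow> 'v) \<Rightarrow> ('g \<Rightarrow> complex) \<Rightarrow> ('g \<Rightarrow> complex) \<Rightarrow> bool" where
  "weight_covers \<hh> t \<alpha> \<pi> \<mu> \<nu> \<longleftrightarrow>
     \<mu> \<in> weights \<hh> \<pi> \<and> \<nu> \<in> weights \<hh> \<pi> \<and> (\<exists>i\<in>{1..t}. \<nu> = \<mu> - \<alpha> i)"

definition minuscule_element ::
    "'g :: complex_lie_algebra set \<Rightarrow> nat \<Rightarrow> (nat \<Rightarrow> 'g \<Rightarrow> complex)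
       \<Rightarrow> ('g \<Rightarrow> 'v :: complex_vector \<Rightarrow> 'v) \<Rightarrow> ('g \<Rightarrow> complex)
       \<Rightarrow> (('g \<Rightarrow> complex) \<Rightarrow> ('g \<Rightarrow> complex)) \<Rightarrow> bool" where
  "minuscule_element \<hh> t \<alpha> \<pi> \<mu> w \<longleftrightarrow>
     w \<in> weyl_group \<hh> t \<alpha> \<and>
     (\<exists>is. reduced_word \<hh> t \<alpha> is w \<and>
        (\<forall>k<length is. weight_covers \<hh> t \<alpha> \<pi> (word_element \<hh> \<alpha> (take k is) \<mu>)
                                             (word_element \<hh> \<alpha> (take (Suc k) is) \<mu>)))"

text \<open>The heap of the word \<open>[i\<^sub>1, \<dots>, i\<^sub>\<ell>]\<close>: the elements are \<open>1, \<dots>, \<ell>\<close>, and \<open>j\<close> is labeled by \<open>i\<^sub>j\<close>.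
  Equal labels give commuting (equal) reflections, hence no generating relation.\<close>

definition heap_carrier :: "nat list \<Rightarrow> nat set" where
  "heap_carrier is = {1..length is}"

definition heap_label :: "nat list \<Rightarrow> nat \<Rightarrow> nat" where
  "heap_label is j = is ! (j - 1)"

definition heap_generating_rel ::
    "'g :: complex_lie_algebra set \<Rightarrow> (nat \<Rightarrow> 'g \<Rightarrow> complex) \<Rightarrow> nat list \<Rightarrow> (nat \<times> nat) set" where
  "heap_generating_rel \<hh> \<alpha> is = {(j, j'). j \<in> heap_carrier is \<and> j' \<in> heap_carrier is \<and> j < j' \<and>
     (let G = BijGroup (real_dual \<hh>);
          s = simple_reflection \<hh> \<alpha> (heap_label is j);
          s' = simple_reflection \<hh> \<alpha> (heap_label is j')
      in s \<otimes>\<^bsub>G\<^esub> s' \<noteq> s' \<otimes>\<^bsub>G\<^esub> s)}"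

definition heap_order ::
    "'g :: complex_lie_algebra set \<Rightarrow> (nat \<Rightarrow> 'g \<Rightarrow> complex) \<Rightarrow> nat list \<Rightarrow> (nat \<times> nat) set" where
  "heap_order \<hh> \<alpha> is = Id_on (heap_carrier is) \<union> (heap_generating_rel \<hh> \<alpha> is)\<^sup>+"


section \<open>Order ideals, the Fon-Der-Flaass action and homomesy\<close>

text \<open>A poset is given by its carrier \<open>P\<close> and its reflexive order relation \<open>r\<close>, with \<open>(x, y) \<in> r\<close>
  for \<open>x \<le> y\<close>.\<close>

definition order_ideals :: "'p set \<Rightarrow> ('p \<times> 'p) set \<Rightarrow> 'p set set" where
  "order_ideals P r = {I. I \<subseteq> P \<and> (\<forall>y\<in>I. \<forall>x\<in>P. (x, y) \<in> r \<longrightarrow> x \<in> I)}"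

definition generated_ideal :: "'p set \<Rightarrow> ('p \<times> 'p) set \<Rightarrow> 'p set \<Rightarrow> 'p set" where
  "generated_ideal P r A = {x\<in>P. \<exists>y\<in>A. (x, y) \<in> r}"

definition minimal_elements :: "('p \<times> 'p) set \<Rightarrow> 'p set \<Rightarrow> 'p set" where
  "minimal_elements r A = {x\<in>A. \<forall>y\<in>A. (y, x) \<in> r \<longrightarrow> y = x}"

definition fon_der_flaass :: "'p set \<Rightarrow> ('p \<times> 'p) set \<Rightarrow> 'p set \<Rightarrow> 'p set" where
  "fon_der_flaass P r I = generated_ideal P r (minimal_elements r (P - I))"

definition bijection_order :: "'s set \<Rightarrow> ('s \<Rightarrow> 's) \<Rightarrow> nat" where
  "bijection_order S \<tau> = (LEAST m. m > 0 \<and> (\<forall>x\<in>S. (\<tau> ^^ m) x = x))"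

definition mesic :: "'s set \<Rightarrow> ('s \<Rightarrow> 's) \<Rightarrow> ('s \<Rightarrow> real) \<Rightarrow> real \<Rightarrow> bool" where
  "mesic S \<tau> f c \<longleftrightarrow>
     finite S \<and> bij_betw \<tau> S S \<and>
     (\<forall>x\<in>S. 1 / real (bijection_order S \<tau>) * (\<Sum>k<bijection_order S \<tau>. f ((\<tau> ^^ k) x)) = c)"

end

theory Submission
  imports Defs
begin

text \<open>An order ideal \<open>I\<close> of the heap corresponds to the weight
  \<open>\<mu>\<^sub>I = \<lambda> - \<Sum>x\<in>I. \<alpha>\<^bsub>label x\<^esub>\<close>, and
  \<open>|I| = 2 (\<lambda> - \<mu>\<^sub>I, \<rho>) / \<Omega>\<^sup>2\<close> because \<open>(\<rho>, \<alpha>\<^sub>i\<^sup>\<or>) = 1\<close>. Between consecutive elements of equal label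
  \<open>j\<close> the heap has exactly two elements with label adjacent to \<open>j\<close>, and at its two ends dominance of
  \<open>\<lambda>\<close> and antidominance of \<open>w\<^sub>0\<lambda>\<close> bound their number; hence \<open>(\<mu>\<^sub>I, \<alpha>\<^sub>j\<^sup>\<or>)\<close> is the number of minimal
  elements of \<open>P - I\<close> with label \<open>j\<close> minus the number of maximal elements of \<open>I\<close> with label \<open>j\<close>. The
  minimal elements of \<open>P - I\<close> are the maximal elements of \<open>\<Psi> I\<close>, so \<open>(\<mu>\<^sub>I, \<alpha>\<^sub>j\<^sup>\<or>)\<close> is a coboundary
  for \<open>\<Psi>\<close>. As \<open>\<rho>\<close> is a combination of the simple roots, \<open>(\<mu>\<^sub>I, \<rho>)\<close> averages to zero on every
  orbit.\<close>

text \<open>Roots are approached from the bare definitions of a simple Lie algebra and of a Cartan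
  subalgebra, so nondegeneracy of the Killing form and positivity on the roots have to be won first.
  The lever is that every weight takes on the bracket of two opposite root vectors a real multiple
  of the value of the root, so the Killing values needed become sums of real squares. The obstacle
  in the combinatorial half is that an ideal need not be a prefix of the reduced word, while the
  word gives information on prefixes only. An ideal is therefore compared, label by label, with the
  prefix just before its last element of label j, or just before the first such element outside it.
  The number two also comes from prefixes: the letter j drops the pairing from 1 to -1, each
  adjacent letter raises it by 1, and it must be 1 again before the next j. Simple lacing enters as
  the common norm: one constant relates all coroot pairings to the inner product, so a single
  functional, \<open>height\<close>, counts heap elements of all labels alike. The constant c is its
  value at \<lambda>.\<close>

section \<open>Linear algebra\<close>

lemma linearC_simps:
  fixes f :: "'a :: complex_vector \<Rightarrow> 'b :: complex_vector"
  assumes "Vector_Spaces.linear (*\<^sub>C) (*\<^sub>C) f"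
  shows "f (x + y) = f x + f y" "f (c *\<^sub>C x) = c *\<^sub>C f x" "f 0 = 0" "f (- x) = - f x"
    "f (x - y) = f x - f y" "f (sum g A) = (\<Sum>a\<in>A. f (g a))"
proof -
  interpret Vector_Spaces.linear "(*\<^sub>C)" "(*\<^sub>C)" f by fact
  show "f (x + y) = f x + f y" "f (c *\<^sub>C x) = c *\<^sub>C f x" "f 0 = 0" "f (- x) = - f x"
    "f (x - y) = f x - f y" "f (sum g A) = (\<Sum>a\<in>A. f (g a))"
    by (simp_all add: add scale zero neg diff sum)
qed

lemma linearC_I:
  fixes f :: "'a :: complex_vector \<Rightarrow> 'b :: complex_vector"
  assumes "\<And>x y. f (x + y) = f x + f y" "\<And>c x. f (c *\<^sub>C x) = c *\<^sub>C f x"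
  shows "Vector_Spaces.linear (*\<^sub>C) (*\<^sub>C) f"
  using assms
  by (intro Vector_Spaces.linear.intro module_hom.intro module_hom_axioms.intro)
    (unfold_locales, auto)

lemma finite_independent:
  fixes B :: "'a :: complex_vector set"
  assumes "finite_dimensional TYPE('a)" "complex_vector.independent B"
  shows "finite B"
  using assms complex_vector.independent_span_bound unfolding finite_dimensional_def by blast

subsection \<open>Trace\<close>

text \<open>\<open>trace\<close> is defined through one arbitrary basis; this frees the choice, so
  that a basis of weight vectors can be used later. Expand \<open>f c\<close> in \<open>B\<close>
  and each element of \<open>B\<close> back in \<open>C\<close>: the double sum can be collected on
  either side.\<close>

lemma trace_eq:
  fixes f :: "'a :: complex_vector \<Rightarrow> 'a"
  assumes fd: "finite_dimensional TYPE('a)" and f: "Vector_Spaces.linear (*\<^sub>C) (*\<^sub>C) f"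
    and B: "complex_vector.independent B" "complex_vector.span B = UNIV"
  shows "trace f = (\<Sum>b\<in>B. complex_vector.representation B (f b) b)"
proof -
  define C :: "'a set" where "C = complex_vector.extend_basis {}"
  have C: "complex_vector.independent C" "complex_vector.span C = UNIV"
    by (simp_all add: C_def complex_vector.independent_extend_basis complex_vector.independent_empty)
  note fin = finite_independent[OF fd B(1)] finite_independent[OF fd C(1)]
  let ?RB = "complex_vector.representation B" and ?RC = "complex_vector.representation C"
  have expB: "v = (\<Sum>b\<in>B. ?RB v b *\<^sub>C b)" for v
    using complex_vector.sum_representation_eq[OF B(1) _ fin(1) order_refl, of v] B(2) by simp
  have expC: "v = (\<Sum>b\<in>C. ?RC v b *\<^sub>C b)" for v
    using complex_vector.sum_representation_eq[OF C(1) _ fin(2) order_refl, of v] C(2) by simp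
  have rB: "?RB (\<Sum>i\<in>I. g i *\<^sub>C h i) b = (\<Sum>i\<in>I. g i * ?RB (h i) b)" for I :: "'a set" and g h b
    by (simp add: complex_vector.representation_sum[OF B(1)] complex_vector.representation_scale[OF B(1)] B(2))
  have rC: "?RC (\<Sum>i\<in>I. g i *\<^sub>C h i) b = (\<Sum>i\<in>I. g i * ?RC (h i) b)" for I :: "'a set" and g h b
    by (simp add: complex_vector.representation_sum[OF C(1)] complex_vector.representation_scale[OF C(1)] C(2))
  have "trace f = (\<Sum>c\<in>C. ?RC (f c) c)" by (simp add: trace_def C_def Let_def)
  also have "\<dots> = (\<Sum>c\<in>C. \<Sum>b\<in>B. ?RB (f c) b * ?RC b c)"
    by (intro sum.cong refl) (subst expB, simp only: rC)
  also have "\<dots> = (\<Sum>b\<in>B. \<Sum>c\<in>C. ?RC b c * ?RB (f c) b)"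
    by (subst sum.swap) (simp add: mult.commute)
  also have "\<dots> = (\<Sum>b\<in>B. ?RB (f (\<Sum>c\<in>C. ?RC b c *\<^sub>C c)) b)"
    by (simp only: linearC_simps[OF f] rB)
  also have "\<dots> = (\<Sum>b\<in>B. ?RB (f b) b)"
    using expC by simp
  finally show ?thesis .
qed

lemma ex_basis:
  obtains B :: "'a :: complex_vector set"
  where "complex_vector.independent B" "complex_vector.span B = UNIV"
  using complex_vector.independent_extend_basis complex_vector.independent_empty
    complex_vector.span_extend_basis by blast

lemma trace_add:
  fixes f g :: "'a :: complex_vector \<Rightarrow> 'a"
  assumes fd: "finite_dimensional TYPE('a)" and f: "Vector_Spaces.linear (*\<^sub>C) (*\<^sub>C) f"
    and g: "Vector_Spaces.linear (*\<^sub>C) (*\<^sub>C) g"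
  shows "trace (\<lambda>v. f v + g v) = trace f + trace g"
proof -
  obtain B :: "'a set" where B: "complex_vector.independent B" "complex_vector.span B = UNIV"
    by (rule ex_basis)
  have "Vector_Spaces.linear (*\<^sub>C) (*\<^sub>C) (\<lambda>v. f v + g v)"
    by (rule linearC_I) (simp_all add: linearC_simps[OF f] linearC_simps[OF g] scaleC_add_right)
  then show ?thesis
    using B by (simp add: trace_eq[OF fd _ B] f g complex_vector.representation_add sum.distrib)
qed

lemma trace_scale:
  fixes f :: "'a :: complex_vector \<Rightarrow> 'a"
  assumes fd: "finite_dimensional TYPE('a)" and f: "Vector_Spaces.linear (*\<^sub>C) (*\<^sub>C) f"
  shows "trace (\<lambda>v. c *\<^sub>C f v) = c * trace f"
proof -
  obtain B :: "'a set" where B: "complex_vector.independent B" "complex_vector.span B = UNIV"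
    by (rule ex_basis)
  have "Vector_Spaces.linear (*\<^sub>C) (*\<^sub>C) (\<lambda>v. c *\<^sub>C f v)"
    by (rule linearC_I) (simp_all add: linearC_simps[OF f] scaleC_add_right scaleC_scaleC mult.commute)
  then show ?thesis
    using B by (simp add: trace_eq[OF fd _ B] f complex_vector.representation_scale sum_distrib_left)
qed

text \<open>Both traces are the same double sum of products of matrix entries, taken in opposite
  orders.\<close>

lemma trace_commute:
  fixes f g :: "'a :: complex_vector \<Rightarrow> 'a"
  assumes fd: "finite_dimensional TYPE('a)" and f: "Vector_Spaces.linear (*\<^sub>C) (*\<^sub>C) f"
    and g: "Vector_Spaces.linear (*\<^sub>C) (*\<^sub>C) g"
  shows "trace (\<lambda>v. f (g v)) = trace (\<lambda>v. g (f v))"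
proof -
  obtain B :: "'a set" where B: "complex_vector.independent B" "complex_vector.span B = UNIV"
    by (rule ex_basis)
  note fin = finite_independent[OF fd B(1)]
  let ?RB = "complex_vector.representation B"
  have expB: "v = (\<Sum>b\<in>B. ?RB v b *\<^sub>C b)" for v
    using complex_vector.sum_representation_eq[OF B(1) _ fin order_refl, of v] B(2) by simp
  have rB: "?RB (\<Sum>i\<in>I. g i *\<^sub>C h i) b = (\<Sum>i\<in>I. g i * ?RB (h i) b)" for I :: "'a set" and g h b
    by (simp add: complex_vector.representation_sum[OF B(1)] complex_vector.representation_scale[OF B(1)] B(2))
  have comp: "trace (\<lambda>v. f (g v)) = (\<Sum>b\<in>B. \<Sum>b'\<in>B. ?RB (g b) b' * ?RB (f b') b)"
    if f: "Vector_Spaces.linear (*\<^sub>C) (*\<^sub>C) f" and g: "Vector_Spaces.linear (*\<^sub>C) (*\<^sub>C) g"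
    for f g :: "'a \<Rightarrow> 'a"
  proof -
    have "Vector_Spaces.linear (*\<^sub>C) (*\<^sub>C) (\<lambda>v. f (g v))"
      by (rule linearC_I) (simp_all add: linearC_simps[OF f] linearC_simps[OF g])
    then have "trace (\<lambda>v. f (g v)) = (\<Sum>b\<in>B. ?RB (f (g b)) b)" by (rule trace_eq[OF fd _ B])
    also have "\<dots> = (\<Sum>b\<in>B. \<Sum>b'\<in>B. ?RB (g b) b' * ?RB (f b') b)"
      by (intro sum.cong refl) (subst expB, simp only: rB linearC_simps[OF f])
    finally show ?thesis .
  qed
  show ?thesis
    unfolding comp[OF f g] comp[OF g f] by (subst sum.swap) (simp add: mult.commute)
qed

subsection \<open>Joint eigenspaces\<close>

lemma weight_space_subspace:
  assumes "\<And>x. x \<in> X \<Longrightarrow> Vector_Spaces.linear (*\<^sub>C) (*\<^sub>C) (A x)"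
  shows "complex_vector.subspace (weight_space X A \<mu>)"
  unfolding complex_vector.subspace_def weight_space_def
  using linearC_simps[OF assms]
  by (auto simp: scaleC_add_right scaleC_scaleC mult.commute)

text \<open>Induction on \<open>F\<close>: for an x at which \<open>wt i\<close> and
  \<open>wt k\<close> differ, the operator \<open>A x - wt k x\<close> kills the summand
  \<open>k\<close> and only rescales the others. \<open>X\<close> and \<open>A\<close> are arbitrary
  because both a single operator and the whole Cartan subalgebra will be inserted.\<close>

lemma weight_space_sum_eq_0:
  assumes lin: "\<And>x. x \<in> X \<Longrightarrow> Vector_Spaces.linear (*\<^sub>C) (*\<^sub>C) (A x)"
    and "finite F"
    and "\<And>i j. i \<in> F \<Longrightarrow> j \<in> F \<Longrightarrow> i \<noteq> j \<Longrightarrow> \<exists>x\<in>X. wt i x \<noteq> wt j x"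
    and "\<And>i. i \<in> F \<Longrightarrow> u i \<in> weight_space X A (wt i)"
    and "(\<Sum>i\<in>F. u i) = 0" and "i \<in> F"
  shows "u i = 0"
  using assms(2-)
proof (induction F arbitrary: u i rule: finite_induct)
  case (insert k F)
  have zero: "u i = 0" if i: "i \<in> F" for i
  proof -
    obtain x where x: "x \<in> X" "wt i x \<noteq> wt k x"
      using insert.prems(1)[of i k] i insert.hyps by auto
    define u' where "u' j = (wt j x - wt k x) *\<^sub>C u j" for j
    have ux: "A x (u j) = wt j x *\<^sub>C u j" if "j \<in> insert k F" for j
      using insert.prems(2)[OF that] x by (simp add: weight_space_def)
    have u'x: "u' j = A x (u j) - wt k x *\<^sub>C u j" if "j \<in> insert k F" for j
      using ux[OF that] by (simp add: u'_def complex_vector.scale_left_diff_distrib)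
    have "(\<Sum>j\<in>insert k F. u' j) = A x (\<Sum>j\<in>insert k F. u j) - wt k x *\<^sub>C (\<Sum>j\<in>insert k F. u j)"
      by (simp only: linearC_simps[OF lin[OF x(1)]] complex_vector.scale_sum_right
          sum_subtractf[symmetric] u'x cong: sum.cong)
    also have "\<dots> = 0"
      using insert.prems(3) linearC_simps(3)[OF lin[OF x(1)]] by simp
    finally have "(\<Sum>j\<in>F. u' j) = 0"
      using insert.hyps by (simp add: u'_def)
    moreover have "u' j \<in> weight_space X A (wt j)" if "j \<in> F" for j
      using insert.prems(2)[of j] that complex_vector.subspace_scale[OF weight_space_subspace[of X A], OF lin]
      by (auto simp: u'_def)
    ultimately have "u' i = 0"
      using insert.IH[of u' i] i insert.prems(1) by auto
    then show ?thesis using x by (simp add: u'_def)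
  qed
  moreover have "u k = 0"
    using insert.prems(3) insert.hyps zero by simp
  ultimately show ?case using insert.prems(4) by auto
qed simp

lemma span_Union_subspaces:
  assumes "\<And>i. i \<in> K \<Longrightarrow> complex_vector.subspace (W i)"
    and "v \<in> complex_vector.span (\<Union>i\<in>K. W i)"
  obtains F u where "finite F" "F \<subseteq> K" "\<And>i. i \<in> F \<Longrightarrow> u i \<in> W i" "v = (\<Sum>i\<in>F. u i)"
proof -
  have "\<exists>F u. finite F \<and> F \<subseteq> K \<and> (\<forall>i\<in>F. u i \<in> W i) \<and> v = (\<Sum>i\<in>F. u i)"
    using assms(2)
  proof (induction rule: complex_vector.span_induct_alt)
    case base
    show ?case by (rule exI[of _ "{}"]) auto
  next
    case (step c x y)
    then obtain i F u where i: "i \<in> K" "x \<in> W i" and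
      F: "finite F" "F \<subseteq> K" "\<forall>i\<in>F. u i \<in> W i" "y = (\<Sum>i\<in>F. u i)" by blast
    note W = complex_vector.subspace_add[OF assms(1)[OF i(1)]]
      complex_vector.subspace_scale[OF assms(1)[OF i(1)]] complex_vector.subspace_0[OF assms(1)[OF i(1)]]
    \<comment> \<open>Covers both cases at once: if \<open>i\<close> already occurs in
      \<open>F\<close>, the new vector is added to the old summand, otherwise it becomes a new
      one.\<close>
    define u' where "u' = (\<lambda>j. (if j \<in> F then u j else 0) + (if j = i then c *\<^sub>C x else 0))"
    have "(\<Sum>j\<in>insert i F. u' j) = c *\<^sub>C x + y"
      using F by (auto simp: u'_def sum.distrib sum.If_cases Int_absorb1 Int_absorb2 insert_absorb
          subset_insertI sum.delta add.commute
          intro!: arg_cong2[where f = "(+)"])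
    moreover have "\<forall>j\<in>insert i F. u' j \<in> W j"
      using F i W by (auto simp: u'_def)
    ultimately show ?case using F i
      by (intro exI[of _ "insert i F"] exI[of _ u']) auto
  qed
  then show ?thesis using that by blast
qed

section \<open>Weight vectors and root strings\<close>

text \<open>Nonzero joint eigenvectors with distinct eigenvalue systems are independent, so a
  finite-dimensional space holds no infinite sequence of them. This yields both the termination of
  weight strings and the finiteness of the root system.\<close>

lemma joint_eigenvectors_vanish:
  fixes A :: "'g :: complex_lie_algebra \<Rightarrow> 'v :: complex_vector \<Rightarrow> 'v" and \<mu> :: "nat \<Rightarrow> 'g \<Rightarrow> complex"
  assumes fd: "finite_dimensional TYPE('v)"
    and lin: "\<And>x. x \<in> X \<Longrightarrow> Vector_Spaces.linear (*\<^sub>C) (*\<^sub>C) (A x)"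
    and v: "\<And>n. v n \<in> weight_space X A (\<mu> n)"
    and neq: "\<And>m n. m \<noteq> n \<Longrightarrow> \<exists>x\<in>X. \<mu> m x \<noteq> \<mu> n x"
  obtains n where "v n = 0"
proof -
  have False if nz: "\<And>n. v n \<noteq> 0"
  proof -
    \<comment> \<open>Independence is a statement about the set \<open>range v\<close>; injectivity
      is what makes this set infinite.\<close>
    have inj: "inj v"
    proof (rule injI, rule ccontr)
      fix m n assume eq: "v m = v n" and "m \<noteq> n"
      then obtain x where x: "x \<in> X" "\<mu> m x \<noteq> \<mu> n x" using neq by blast
      have "\<mu> m x *\<^sub>C v n = \<mu> n x *\<^sub>C v n"
        using v[of m] v[of n] x(1) eq unfolding weight_space_def mem_Collect_eq by metis
      then show False using nz[of n] x(2) complex_vector.scale_cancel_right by metis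
    qed
    have "complex_vector.independent (range v)"
      unfolding complex_vector.independent_explicit_finite_subsets
    proof (intro allI impI ballI)
      fix S c b
      assume S: "S \<subseteq> range v" "finite S" "(\<Sum>b\<in>S. c b *\<^sub>C b) = 0" "b \<in> S"
      let ?i = "inv_into UNIV v"
      have "c b *\<^sub>C b = 0"
      proof (rule weight_space_sum_eq_0[of X A S "\<lambda>b. \<mu> (?i b)" "\<lambda>b. c b *\<^sub>C b"])
        fix i j assume "i \<in> S" "j \<in> S" "i \<noteq> j"
        then show "\<exists>x\<in>X. \<mu> (?i i) x \<noteq> \<mu> (?i j) x"
          using S(1) by (intro neq) (metis f_inv_into_f subsetD)
      next
        fix i assume "i \<in> S"
        then have "v (?i i) = i" using S(1) by (metis f_inv_into_f subsetD)
        then have "i \<in> weight_space X A (\<mu> (?i i))" using v[of "?i i"] by simp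
        then show "c i *\<^sub>C i \<in> weight_space X A (\<mu> (?i i))"
          using complex_vector.subspace_scale[OF weight_space_subspace[of X A], OF lin] by auto
      qed (use S lin in auto)
      moreover have "b \<noteq> 0" using S nz by auto
      ultimately show "c b = 0" by simp
    qed
    then have "finite (range v)" by (rule finite_independent[OF fd])
    then show False using finite_imageD[OF _ inj] infinite_UNIV_nat by blast
  qed
  then show ?thesis using that by blast
qed

section \<open>Representations and identities of the bracket\<close>

lemma lie_representationD:
  assumes "lie_representation \<pi>"
  shows "Vector_Spaces.linear (*\<^sub>C) (*\<^sub>C) (\<pi> x)" "Vector_Spaces.linear (*\<^sub>C) (*\<^sub>C) (\<lambda>x. \<pi> x v)"
    "\<pi> (bracket x y) v = \<pi> x (\<pi> y v) - \<pi> y (\<pi> x v)"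
  using assms unfolding lie_representation_def by blast+

lemma bracket_zero [simp]: "bracket 0 x = 0" "bracket x 0 = 0"
  using bracket_scaleC_left[of 0 x x] bracket_scaleC_right[of x 0 x] by auto

lemma bracket_minus: "bracket (- x) y = - bracket x y" "bracket x (- y) = - bracket x y"
  using bracket_scaleC_left[of "-1" x y] bracket_scaleC_right[of x "-1" y]
  by (simp_all add: complex_vector.scale_minus_left)

lemma bracket_anticommute: "bracket x y = - bracket y x"
proof -
  have "bracket (x + y) (x + y) = bracket x x + bracket x y + (bracket y x + bracket y y)"
    by (simp only: bracket_add_left bracket_add_right ac_simps)
  then have "bracket x y + bracket y x = 0" unfolding bracket_self by simp
  then show ?thesis unfolding eq_neg_iff_add_eq_0 .
qed

lemma lie_representation_bracket: "lie_representation (bracket :: 'g :: complex_lie_algebra \<Rightarrow> 'g \<Rightarrow> 'g)"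
  unfolding lie_representation_def
proof (intro conjI allI)
  fix x y v :: 'g
  show "Vector_Spaces.linear (*\<^sub>C) (*\<^sub>C) (bracket x)"
    by (rule linearC_I) (simp_all add: bracket_add_right bracket_scaleC_right)
  show "Vector_Spaces.linear (*\<^sub>C) (*\<^sub>C) (\<lambda>x. bracket x v)"
    by (rule linearC_I) (simp_all add: bracket_add_left bracket_scaleC_left)
  have "bracket v (bracket x y) = - bracket (bracket x y) v"
    and "bracket y (bracket v x) = - bracket y (bracket x v)"
    using bracket_anticommute[of v] bracket_minus by metis+
  then show "bracket (bracket x y) v = bracket x (bracket y v) - bracket y (bracket x v)"
    using jacobi[of x y v] by (simp add: algebra_simps)
qed

lemmas linear_bracket = lie_representationD(1)[OF lie_representation_bracket]

lemma cartan_dual_add: "\<mu> \<in> cartan_dual H \<Longrightarrow> \<nu> \<in> cartan_dual H \<Longrightarrow> \<mu> + \<nu> \<in> cartan_dual H"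
  and cartan_dual_uminus: "\<mu> \<in> cartan_dual H \<Longrightarrow> - \<mu> \<in> cartan_dual H"
  and cartan_dual_diff: "\<mu> \<in> cartan_dual H \<Longrightarrow> \<nu> \<in> cartan_dual H \<Longrightarrow> \<mu> - \<nu> \<in> cartan_dual H"
  and cartan_dual_rscale: "\<mu> \<in> cartan_dual H \<Longrightarrow> rscale r \<mu> \<in> cartan_dual H"
  and cartan_dual_zero: "0 \<in> cartan_dual H"
  unfolding cartan_dual_def by (auto simp: algebra_simps rscale_def)

section \<open>Root vectors acting on weight vectors: the sl2 computations\<close>

lemma weight_space_action:
  assumes \<pi>: "lie_representation \<pi>" and x: "x \<in> weight_space H bracket \<alpha>"
    and v: "v \<in> weight_space H \<pi> \<mu>"
  shows "\<pi> x v \<in> weight_space H \<pi> (\<mu> + \<alpha>)"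
  unfolding weight_space_def
proof (intro CollectI ballI)
  fix y assume "y \<in> H"
  then have "bracket y x = \<alpha> y *\<^sub>C x" "\<pi> y v = \<mu> y *\<^sub>C v"
    using x v by (auto simp: weight_space_def)
  then have "\<pi> y (\<pi> x v) = (\<alpha> y *\<^sub>C \<pi> x v) + \<mu> y *\<^sub>C \<pi> x v"
    using lie_representationD(3)[OF \<pi>, of y x v]
    by (simp add: linearC_simps[OF lie_representationD(1)[OF \<pi>]]
        linearC_simps(2)[OF lie_representationD(2)[OF \<pi>]] algebra_simps)
  then show "\<pi> y (\<pi> x v) = (\<mu> + \<alpha>) y *\<^sub>C \<pi> x v"
    by (simp add: scaleC_add_left add.commute)
qed

lemma weight_space_action_power:
  assumes \<pi>: "lie_representation \<pi>" and x: "x \<in> weight_space H bracket \<alpha>"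
    and v: "v \<in> weight_space H \<pi> \<mu>"
  shows "(\<pi> x ^^ n) v \<in> weight_space H \<pi> (\<lambda>y. \<mu> y + of_nat n * \<alpha> y)"
proof (induction n)
  case (Suc n)
  show ?case
    using weight_space_action[OF \<pi> x Suc] by (simp add: plus_fun_def algebra_simps)
qed (use v in simp)

text \<open>The iterates lie in the weight spaces of the pairwise different weights \<mu> + n
  \<alpha>, so one of them vanishes; the last nonzero one is the end of the string.\<close>

lemma last_nonzero_iterate:
  fixes \<pi> :: "'g :: complex_lie_algebra \<Rightarrow> 'v :: complex_vector \<Rightarrow> 'v"
  assumes \<pi>: "lie_representation \<pi>" and fd: "finite_dimensional TYPE('v)"
    and x: "x \<in> weight_space H bracket \<alpha>" and \<alpha>: "\<exists>y\<in>H. \<alpha> y \<noteq> 0"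
    and v: "v \<in> weight_space H \<pi> \<mu>" "v \<noteq> 0"
  obtains m where "(\<pi> x ^^ m) v \<noteq> 0" "\<pi> x ((\<pi> x ^^ m) v) = 0"
proof -
  obtain n where n: "(\<pi> x ^^ n) v = 0"
  proof (rule joint_eigenvectors_vanish[OF fd, of H \<pi> "\<lambda>n. (\<pi> x ^^ n) v" "\<lambda>n y. \<mu> y + of_nat n * \<alpha> y"])
    show "(\<pi> x ^^ n) v \<in> weight_space H \<pi> (\<lambda>y. \<mu> y + of_nat n * \<alpha> y)" for n
      by (rule weight_space_action_power[OF \<pi> x v(1)])
    show "\<exists>y\<in>H. \<mu> y + of_nat m * \<alpha> y \<noteq> \<mu> y + of_nat n * \<alpha> y" if "m \<noteq> n" for m n
      using \<alpha> that by auto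
  qed (auto simp: lie_representationD[OF \<pi>])
  have "\<exists>m. (\<pi> x ^^ m) v \<noteq> 0 \<and> (\<pi> x ^^ Suc m) v = 0"
  proof (rule ccontr)
    assume *: "\<nexists>m. (\<pi> x ^^ m) v \<noteq> 0 \<and> (\<pi> x ^^ Suc m) v = 0"
    have "(\<pi> x ^^ m) v \<noteq> 0" for m
      by (induction m) (use v * in auto)
    then show False using n by blast
  qed
  then show ?thesis using that by auto
qed

text \<open>No normalization of \<open>h = [e, f]\<close> is imposed, so that the degenerate case \<open>\<alpha> h = 0\<close> is
  covered; it is needed before the Killing form is known to be non-degenerate.\<close>

lemma highest_weight_value:
  fixes \<pi> :: "'g :: complex_lie_algebra \<Rightarrow> 'v :: complex_vector \<Rightarrow> 'v"
  assumes \<pi>: "lie_representation \<pi>" and fd: "finite_dimensional TYPE('v)"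
    and e: "e \<in> weight_space H bracket \<alpha>" and f: "f \<in> weight_space H bracket (- \<alpha>)"
    and \<alpha>: "\<exists>y\<in>H. \<alpha> y \<noteq> 0" and h: "h = bracket e f" "h \<in> H"
    and v: "v \<in> weight_space H \<pi> \<mu>" "v \<noteq> 0" "\<pi> e v = 0"
  obtains m :: nat where "\<mu> h = of_nat m / 2 * \<alpha> h"
proof -
  note lin = linearC_simps[OF lie_representationD(1)[OF \<pi>]]
  have "\<exists>y\<in>H. (- \<alpha>) y \<noteq> 0" using \<alpha> by simp
  from last_nonzero_iterate[OF \<pi> fd f this v(1,2)]
  obtain m where m: "(\<pi> f ^^ m) v \<noteq> 0" "\<pi> f ((\<pi> f ^^ m) v) = 0" by blast
  have h_act: "\<pi> h ((\<pi> f ^^ n) v) = (\<mu> h - of_nat n * \<alpha> h) *\<^sub>C (\<pi> f ^^ n) v" for n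
    using weight_space_action_power[OF \<pi> f v(1), of n] h(2) by (auto simp: weight_space_def)
  \<comment> \<open>The scalar is the sum of the eigenvalues \<open>\<mu> h - k * \<alpha> h\<close>
    of \<open>h\<close> for k from 0 to n, collected while \<open>e\<close> moves to the right
    through n + 1 copies of \<open>f\<close>.\<close>
  have e_act: "\<pi> e ((\<pi> f ^^ Suc n) v) =
      (of_nat (Suc n) * \<mu> h - of_nat (Suc n) * of_nat n / 2 * \<alpha> h) *\<^sub>C (\<pi> f ^^ n) v" for n
  proof (induction n)
    case 0
    have "\<pi> e (\<pi> f v) = \<pi> h v"
      using lie_representationD(3)[OF \<pi>, of e f v] v(3) by (simp add: h lin)
    then show ?case using h_act[of 0] by simp
  next
    case (Suc n)
    let ?v = "(\<pi> f ^^ Suc n) v"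
    have "\<pi> e ((\<pi> f ^^ Suc (Suc n)) v) = \<pi> f (\<pi> e ?v) + \<pi> h ?v"
      using lie_representationD(3)[OF \<pi>, of e f ?v] by (simp add: h lin)
    also have "\<dots> = (of_nat (Suc n) * \<mu> h - of_nat (Suc n) * of_nat n / 2 * \<alpha> h) *\<^sub>C ?v
        + (\<mu> h - of_nat (Suc n) * \<alpha> h) *\<^sub>C ?v"
      unfolding Suc.IH h_act lin by simp
    also have "\<dots> = (of_nat (Suc (Suc n)) * \<mu> h - of_nat (Suc (Suc n)) * of_nat (Suc n) / 2 * \<alpha> h) *\<^sub>C ?v"
      unfolding scaleC_add_left[symmetric] by (rule arg_cong[of _ _ "\<lambda>c. c *\<^sub>C ?v"]) (simp add: field_simps)
    finally show ?case .
  qed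
  have "(of_nat (Suc m) * \<mu> h - of_nat (Suc m) * of_nat m / 2 * \<alpha> h) *\<^sub>C (\<pi> f ^^ m) v = 0"
    using e_act[of m] m(2) by (simp add: lin)
  then have "of_nat (Suc m) * (\<mu> h - of_nat m / 2 * \<alpha> h) = 0"
    using m(1) complex_vector.scale_eq_0_iff by (simp add: right_diff_distrib mult.assoc)
  then have "\<mu> h - of_nat m / 2 * \<alpha> h = 0"
    using of_nat_neq_0 mult_eq_0_iff by blast
  then show ?thesis by (intro that[of m]) simp
qed

text \<open>Raise \<open>v\<close> with \<open>e\<close> to the top of its string, apply
  \<open>highest_weight_value\<close> there and subtract the steps taken. The point is that the
  factor is real: its squares are nonnegative.\<close>

lemma weight_value_proportional:
  fixes \<pi> :: "'g :: complex_lie_algebra \<Rightarrow> 'v :: complex_vector \<Rightarrow> 'v"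
  assumes \<pi>: "lie_representation \<pi>" and fd: "finite_dimensional TYPE('v)"
    and e: "e \<in> weight_space H bracket \<alpha>" and f: "f \<in> weight_space H bracket (- \<alpha>)"
    and \<alpha>: "\<exists>y\<in>H. \<alpha> y \<noteq> 0" and h: "h = bracket e f" "h \<in> H"
    and v: "v \<in> weight_space H \<pi> \<mu>" "v \<noteq> 0"
  obtains q :: real where "\<mu> h = of_real q * \<alpha> h"
proof -
  from last_nonzero_iterate[OF \<pi> fd e \<alpha> v]
  obtain m where m: "(\<pi> e ^^ m) v \<noteq> 0" "\<pi> e ((\<pi> e ^^ m) v) = 0" by blast
  from highest_weight_value[OF \<pi> fd e f \<alpha> h weight_space_action_power[OF \<pi> e v(1)] m]
  obtain k :: nat where "\<mu> h + of_nat m * \<alpha> h = of_nat k / 2 * \<alpha> h" by blast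
  then have "\<mu> h = of_real (real k / 2 - real m) * \<alpha> h"
    by (simp add: algebra_simps)
  then show ?thesis using that by blast
qed

text \<open>The mirror image of \<open>highest_weight_value\<close>: exchanging \<open>e\<close> and
  \<open>f\<close> replaces \<alpha> and h by their negatives. Functionals are linear on
  \<open>H\<close> only, hence the care with the value at \<open>- h\<close>.\<close>

lemma lowest_weight_value:
  fixes \<pi> :: "'g :: complex_lie_algebra \<Rightarrow> 'v :: complex_vector \<Rightarrow> 'v"
  assumes \<pi>: "lie_representation \<pi>" and fd: "finite_dimensional TYPE('v)"
    and e: "e \<in> weight_space H bracket \<alpha>" and f: "f \<in> weight_space H bracket (- \<alpha>)"
    and \<alpha>: "\<exists>y\<in>H. \<alpha> y \<noteq> 0" "\<alpha> \<in> cartan_dual H" and \<mu>: "\<mu> \<in> cartan_dual H"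
    and h: "h = bracket e f" "h \<in> H" "- h \<in> H"
    and v: "v \<in> weight_space H \<pi> \<mu>" "v \<noteq> 0" "\<pi> f v = 0"
  obtains m :: nat where "\<mu> h = - (of_nat m / 2) * \<alpha> h"
proof -
  have neg: "\<nu> (- h) = - \<nu> h" if "\<nu> \<in> cartan_dual H" for \<nu>
    using that h(2) complex_vector.scale_minus_left[of 1 h] unfolding cartan_dual_def
    by (metis (mono_tags, lifting) complex_vector.scale_one mem_Collect_eq mult_minus1)
  have f': "f \<in> weight_space H bracket (- \<alpha>)" and e': "e \<in> weight_space H bracket (- (- \<alpha>))"
    using e f by simp_all
  have "\<exists>y\<in>H. (- \<alpha>) y \<noteq> 0" using \<alpha> by simp
  moreover have "- h = bracket f e" using h(1) bracket_anticommute[of e f] by simp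
  ultimately obtain m :: nat where "\<mu> (- h) = of_nat m / 2 * (- \<alpha>) (- h)"
    using highest_weight_value[OF \<pi> fd f' e' _ _ h(3) v] by blast
  then have "- \<mu> h = of_nat m / 2 * \<alpha> h"
    using neg[OF \<mu>] neg[OF \<alpha>(2)] by simp
  then have "\<mu> h = - (of_nat m / 2) * \<alpha> h"
    by (metis minus_minus mult_minus_left)
  then show ?thesis using that by blast
qed

section \<open>Non-degeneracy of the Killing form\<close>

locale cartan_setting =
  fixes H :: "'g :: complex_lie_algebra set"
  assumes simple: "simple_lie_algebra TYPE('g)" and cartan: "cartan_subalgebra H"
begin

lemma fin_dim: "finite_dimensional TYPE('g)"
  using simple by (simp add: simple_lie_algebra_def)

lemma ideal_trivial: "lie_ideal I \<Longrightarrow> I = {0} \<or> I = (UNIV :: 'g set)"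
  using simple unfolding simple_lie_algebra_def by blast

lemma nonabelian: "\<exists>x y :: 'g. bracket x y \<noteq> 0"
  using simple unfolding simple_lie_algebra_def by blast

lemma subspace_H: "complex_vector.subspace H"
  and abelian: "x \<in> H \<Longrightarrow> y \<in> H \<Longrightarrow> bracket x y = 0"
  and centralizer: "(\<And>x. x \<in> H \<Longrightarrow> bracket x y = 0) \<Longrightarrow> y \<in> H"
  and diagonalizable: "x \<in> H \<Longrightarrow> complex_vector.span {y. \<exists>c. bracket x y = c *\<^sub>C y} = UNIV"
  using cartan unfolding cartan_subalgebra_def by blast+

lemmas H_closed = complex_vector.subspace_0[OF subspace_H] complex_vector.subspace_add[OF subspace_H]
  complex_vector.subspace_scale[OF subspace_H] complex_vector.subspace_neg[OF subspace_H]

section \<open>Weight decomposition of the adjoint representation\<close>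

lemma weight_space_0: "weight_space H bracket 0 = H"
  using abelian centralizer by (auto simp: weight_space_def)

lemma center_trivial:
  fixes z :: 'g
  assumes "\<And>x. bracket x z = 0"
  shows "z = 0"
proof -
  let ?I = "{z :: 'g. \<forall>x. bracket x z = 0}"
  have "lie_ideal ?I"
    by (auto simp: lie_ideal_def complex_vector.subspace_def bracket_add_right bracket_scaleC_right)
  moreover have "?I \<noteq> UNIV" using nonabelian by auto
  ultimately have "?I = {0}" using ideal_trivial by blast
  then show ?thesis using assms by auto
qed

lemma derived_algebra: "complex_vector.span {bracket x y |x y :: 'g. True} = UNIV"
proof -
  let ?D = "complex_vector.span {bracket x y |x y :: 'g. True}"
  have "bracket x y \<in> ?D" for x y by (rule complex_vector.span_base) blast
  then have "lie_ideal ?D" and "?D \<noteq> {0}"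
    using nonabelian by (auto simp: lie_ideal_def)
  then show ?thesis using ideal_trivial by blast
qed

text \<open>Simultaneous diagonalization. Split a joint eigenvector \<open>v\<close> of
  \<open>X\<close> into eigenvectors of the new x. Any y in \<open>X\<close> commutes with x, so ad
  y minus its eigenvalue on \<open>v\<close> preserves each eigenspace of x; it kills
  \<open>v\<close>, hence every component.\<close>

lemma joint_eigenvectors_span:
  assumes "finite X" "X \<subseteq> H"
  shows "complex_vector.span {v. \<forall>x\<in>X. \<exists>c. bracket x v = c *\<^sub>C v} = UNIV"
  using assms
proof (induction X rule: finite_induct)
  case (insert x X)
  let ?S = "{v. \<forall>y\<in>X. \<exists>c. bracket y v = c *\<^sub>C v}"
  let ?T = "{v. \<forall>y\<in>insert x X. \<exists>c. bracket y v = c *\<^sub>C v}"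
  let ?W = "\<lambda>c. weight_space {x} bracket (\<lambda>_. c)"
  have "?S \<subseteq> complex_vector.span ?T"
  proof
    fix v assume v: "v \<in> ?S"
    have "v \<in> complex_vector.span (\<Union>c. ?W c)"
    proof -
      have "{y. \<exists>c. bracket x y = c *\<^sub>C y} = (\<Union>c. ?W c)" by (auto simp: weight_space_def)
      then show ?thesis using diagonalizable[of x] insert.prems by auto
    qed
    then obtain F u where F: "finite F" "\<And>c. c \<in> F \<Longrightarrow> u c \<in> ?W c" "v = (\<Sum>c\<in>F. u c)"
      using span_Union_subspaces[of UNIV ?W v] weight_space_subspace linear_bracket by metis
    have "u c \<in> ?T" if c: "c \<in> F" for c
    proof -
      have "bracket y (u c) = d *\<^sub>C u c" if y: "y \<in> X" and d: "bracket y v = d *\<^sub>C v" for y d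
      proof -
        have "bracket y (u c) - d *\<^sub>C u c = 0"
        proof (rule weight_space_sum_eq_0[of "{x}" bracket F "\<lambda>c _. c" "\<lambda>c. bracket y (u c) - d *\<^sub>C u c"])
          fix i assume i: "i \<in> F"
          have "bracket (bracket x y) (u i) = 0"
            using abelian[of x y] y insert.prems by auto
          then have "bracket x (bracket y (u i)) = i *\<^sub>C bracket y (u i)"
            using lie_representationD(3)[OF lie_representation_bracket, of x y "u i"] F(2)[OF i]
            by (simp add: weight_space_def bracket_scaleC_right)
          then have "bracket y (u i) \<in> ?W i" by (simp add: weight_space_def)
          then show "bracket y (u i) - d *\<^sub>C u i \<in> ?W i"
            using F(2)[OF i] weight_space_subspace[of "{x}" bracket] linear_bracket
            by (meson complex_vector.subspace_diff complex_vector.subspace_scale)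
        next
          show "(\<Sum>c\<in>F. bracket y (u c) - d *\<^sub>C u c) = 0"
            using d by (simp add: F(3) sum_subtractf linearC_simps(6)[OF linear_bracket]
                complex_vector.scale_sum_right)
        qed (use F c linear_bracket in auto)
        then show ?thesis by simp
      qed
      moreover have "bracket x (u c) = c *\<^sub>C u c" using F(2)[OF c] by (simp add: weight_space_def)
      ultimately show ?thesis using v by blast
    qed
    then show "v \<in> complex_vector.span ?T"
      unfolding F(3) by (intro complex_vector.span_sum complex_vector.span_base)
  qed
  then have "complex_vector.span ?S \<subseteq> complex_vector.span ?T"
    by (rule complex_vector.span_minimal) (rule complex_vector.subspace_span)
  then show ?case using insert by auto
qed simp

text \<open>A finite basis \<open>X\<close> of \<open>H\<close> is diagonalized jointly; a joint
  eigenvector of \<open>X\<close> is one of all of \<open>H\<close>, with eigenvalues depending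
  linearly on the element.\<close>

lemma weight_spaces_span:
  "complex_vector.span (\<Union>\<mu>\<in>cartan_dual H. weight_space H bracket \<mu>) = UNIV"
proof -
  obtain X where X: "X \<subseteq> H" "complex_vector.independent X" "H \<subseteq> complex_vector.span X"
    using complex_vector.maximal_independent_subset by blast
  let ?U = "\<Union>\<mu>\<in>cartan_dual H. weight_space H bracket \<mu>"
  have "v \<in> ?U" if v: "\<forall>x\<in>X. \<exists>c. bracket x v = c *\<^sub>C v" for v
  proof (cases "v = 0")
    case True
    have "0 \<in> cartan_dual H" by (rule cartan_dual_zero)
    then show ?thesis
      using True complex_vector.subspace_0[OF weight_space_subspace[of H bracket]] linear_bracket by blast
  next
    case False
    have ex: "\<exists>c. bracket x v = c *\<^sub>C v" if "x \<in> complex_vector.span X" for x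
      using that
    proof (induction rule: complex_vector.span_induct_alt)
      case base
      show ?case by (rule exI[of _ 0]) simp
    next
      case (step c x y)
      then obtain a b where "bracket x v = a *\<^sub>C v" "bracket y v = b *\<^sub>C v" using v by blast
      then have "bracket (c *\<^sub>C x + y) v = (c * a + b) *\<^sub>C v"
        by (simp add: bracket_add_left bracket_scaleC_left scaleC_add_left scaleC_scaleC)
      then show ?case by blast
    qed
    \<comment> \<open>The eigenvalue is unique because \<open>v\<close> is nonzero, which gives
      linearity; the value 0 off \<open>H\<close> is the convention of
      \<open>cartan_dual\<close>.\<close>
    define \<mu> where "\<mu> x = (if x \<in> H then SOME c. bracket x v = c *\<^sub>C v else 0)" for x
    have \<mu>: "bracket x v = \<mu> x *\<^sub>C v" if "x \<in> H" for x
      using someI_ex[OF ex[of x]] that X(3) by (auto simp: \<mu>_def)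
    have eq: "c = d" if "c *\<^sub>C v = d *\<^sub>C v" for c d
      using that False complex_vector.scale_cancel_right by blast
    have "\<mu> \<in> cartan_dual H"
      unfolding cartan_dual_def
    proof (intro CollectI conjI ballI allI impI)
      fix x y assume xy: "x \<in> H" "y \<in> H"
      show "\<mu> (x + y) = \<mu> x + \<mu> y"
        using \<mu>[OF xy(1)] \<mu>[OF xy(2)] \<mu>[OF H_closed(2)[OF xy]]
        by (intro eq) (simp add: scaleC_add_left bracket_add_left)
    next
      fix c x assume x: "x \<in> H"
      show "\<mu> (c *\<^sub>C x) = c * \<mu> x"
        using \<mu>[OF x] \<mu>[OF H_closed(3)[OF x, of c], symmetric]
        by (intro eq) (simp add: scaleC_scaleC bracket_scaleC_left)
    qed (simp add: \<mu>_def)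
    then show ?thesis using \<mu> by (auto simp: weight_space_def)
  qed
  then have "{v. \<forall>x\<in>X. \<exists>c. bracket x v = c *\<^sub>C v} \<subseteq> ?U" by blast
  from complex_vector.span_mono[OF this] show ?thesis
    unfolding joint_eigenvectors_span[OF finite_independent[OF fin_dim X(2)] X(1)] by blast
qed

lemma weight_basis:
  obtains B wt where "complex_vector.independent B" "complex_vector.span B = UNIV" "finite B"
    "\<And>b. b \<in> B \<Longrightarrow> wt b \<in> cartan_dual H" "\<And>b. b \<in> B \<Longrightarrow> b \<in> weight_space H bracket (wt b)"
    "\<And>b. b \<in> B \<Longrightarrow> b \<noteq> 0"
proof -
  let ?U = "\<Union>\<mu>\<in>cartan_dual H. weight_space H bracket \<mu>"
  obtain B where B: "B \<subseteq> ?U" "complex_vector.independent B" "?U \<subseteq> complex_vector.span B"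
    using complex_vector.maximal_independent_subset by blast
  have "complex_vector.span ?U \<subseteq> complex_vector.span B"
    using B(3) by (rule complex_vector.span_minimal) (rule complex_vector.subspace_span)
  then have "complex_vector.span B = UNIV" using weight_spaces_span by auto
  moreover have "\<forall>b\<in>B. \<exists>\<mu>\<in>cartan_dual H. b \<in> weight_space H bracket \<mu>" using B(1) by blast
  then obtain wt where "\<forall>b\<in>B. wt b \<in> cartan_dual H \<and> b \<in> weight_space H bracket (wt b)" by metis
  moreover have "b \<noteq> 0" if "b \<in> B" for b using B(2) that complex_vector.dependent_zero by blast
  ultimately show ?thesis using that[of B wt] B(2) finite_independent[OF fin_dim B(2)] by blast
qed

subsection \<open>The Killing form\<close>

lemma linear_bracket2: "Vector_Spaces.linear (*\<^sub>C) (*\<^sub>C) (\<lambda>v :: 'g. bracket x (bracket y v))"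
  by (rule linearC_I) (simp_all add: bracket_add_right bracket_scaleC_right)

lemma killing_form_add_left: "killing_form (x + y) z = killing_form x z + killing_form y (z :: 'g)"
  unfolding killing_form_def bracket_add_left
  by (rule trace_add[OF fin_dim linear_bracket2 linear_bracket2])

lemma killing_form_scale_left: "killing_form (c *\<^sub>C x) z = c * killing_form x (z :: 'g)"
  unfolding killing_form_def bracket_scaleC_left
  by (rule trace_scale[OF fin_dim linear_bracket2])

lemma killing_form_commute: "killing_form x y = killing_form y (x :: 'g)"
  unfolding killing_form_def by (rule trace_commute[OF fin_dim linear_bracket linear_bracket])

lemma killing_form_add_right: "killing_form z (x + y) = killing_form z x + killing_form (z :: 'g) y"
  and killing_form_scale_right: "killing_form z (c *\<^sub>C x) = c * killing_form (z :: 'g) x"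
  by (simp_all add: killing_form_commute[of z] killing_form_add_left killing_form_scale_left)

lemma killing_form_0: "killing_form 0 x = 0" "killing_form x 0 = 0" for x :: 'g
  using killing_form_scale_left[of 0 0 x] killing_form_scale_right[of x 0 0] by simp_all

text \<open>Both sides expand into differences of traces of triple products; cyclicity of the trace
  matches the terms that differ.\<close>

lemma killing_form_invariant: "killing_form (bracket x y) z = killing_form x (bracket y (z :: 'g))"
proof -
  have linear3: "Vector_Spaces.linear (*\<^sub>C) (*\<^sub>C) (\<lambda>v :: 'g. bracket x (bracket y (bracket z v)))"
    for x y z :: 'g
    by (rule linearC_I) (simp_all add: bracket_add_right bracket_scaleC_right)
  have lin': "Vector_Spaces.linear (*\<^sub>C) (*\<^sub>C) (\<lambda>v :: 'g. (-1) *\<^sub>C bracket x (bracket y (bracket z v)))"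
    for x y z :: 'g
    by (rule linearC_I) (simp_all add: bracket_add_right bracket_scaleC_right scaleC_add_right scaleC_scaleC)
  let ?t = "\<lambda>x y z :: 'g. trace (\<lambda>v. bracket x (bracket y (bracket z v)))"
  have diff: "trace (\<lambda>v. bracket x (bracket y (bracket z v)) - bracket x' (bracket y' (bracket z' v)))
      = ?t x y z - ?t x' y' z'" for x y z x' y' z' :: 'g
    using trace_add[OF fin_dim linear3[of x y z] lin'[of x' y' z']] trace_scale[OF fin_dim linear3[of x' y' z'], of "-1"]
    by (simp add: complex_vector.scale_minus_left)
  have "killing_form (bracket x y) z = ?t x y z - ?t y x z"
    unfolding killing_form_def lie_representationD(3)[OF lie_representation_bracket, of x y] by (rule diff)
  also have "?t y x z = ?t x z y"
    by (rule trace_commute[OF fin_dim linear_bracket linear_bracket2])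
  also have "?t x y z - ?t x z y = killing_form x (bracket y z)"
    unfolding killing_form_def lie_representationD(3)[OF lie_representation_bracket, of y z]
      linearC_simps(5)[OF linear_bracket] diff ..
  finally show ?thesis .
qed

text \<open>On weight vectors ad x and ad y are both diagonal, which turns the trace into a sum over
  weights.\<close>

lemma killing_form_weight_basis:
  assumes B: "complex_vector.independent B" "complex_vector.span B = UNIV"
    "\<And>b. b \<in> B \<Longrightarrow> b \<in> weight_space H bracket (wt b)" and xy: "x \<in> H" "y \<in> H"
  shows "killing_form x y = (\<Sum>b\<in>B. wt b x * wt b y)"
proof -
  have "complex_vector.representation B (bracket x (bracket y b)) b = wt b x * wt b y" if b: "b \<in> B" for b
  proof -
    have "bracket x (bracket y b) = (wt b y * wt b x) *\<^sub>C b"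
      using B(3)[OF b] xy by (simp add: weight_space_def bracket_scaleC_right)
    then show ?thesis
      using complex_vector.representation_basis[OF B(1) b]
      by (simp add: complex_vector.representation_scale[OF B(1)] B(2))
  qed
  then show ?thesis
    unfolding killing_form_def trace_eq[OF fin_dim linear_bracket2 B(1,2)] by (intro sum.cong) auto
qed

text \<open>Invariance moves y across the form: it acts as - \<alpha> y on one side and as \<beta> y
  on the other.\<close>

lemma killing_form_orthogonal:
  assumes e: "e \<in> weight_space H bracket \<alpha>" and f: "f \<in> weight_space H bracket \<beta>"
    and y: "y \<in> H" "\<alpha> y + \<beta> y \<noteq> 0"
  shows "killing_form e f = 0"
proof -
  have "bracket y e = \<alpha> y *\<^sub>C e" "bracket y f = \<beta> y *\<^sub>C f" using e f y by (auto simp: weight_space_def)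
  then have "bracket e y = (- \<alpha> y) *\<^sub>C e"
    using bracket_anticommute[of e y] by (simp add: complex_vector.scale_minus_left)
  then have "(- \<alpha> y) * killing_form e f = \<beta> y * killing_form e f"
    using killing_form_invariant[of e y f] \<open>bracket y f = _\<close>
    by (simp only: killing_form_scale_left killing_form_scale_right)
  then have "(\<alpha> y + \<beta> y) * killing_form e f = 0" unfolding distrib_right
    by (metis add.right_inverse mult_minus_left)
  then show ?thesis using y by simp
qed

lemma bracket_opposite_in_H:
  assumes e: "e \<in> weight_space H bracket \<alpha>" and f: "f \<in> weight_space H bracket (- \<alpha>)"
  shows "bracket e f \<in> H"
  using weight_space_action[OF lie_representation_bracket e f] weight_space_0 by simp

lemma cartan_dual_nonzero:
  assumes "\<alpha> \<in> cartan_dual H" "\<alpha> \<noteq> 0"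
  shows "\<exists>y\<in>H. \<alpha> y \<noteq> 0"
  using assms unfolding cartan_dual_def by (auto simp: fun_eq_iff)

text \<open>ad h is zero on a spanning set, so h lies in the center, which is trivial.\<close>

lemma central_if_weights_vanish:
  assumes B: "complex_vector.span B = UNIV" "\<And>b. b \<in> B \<Longrightarrow> b \<in> weight_space H bracket (wt b)"
    and h: "h \<in> H" "\<And>b. b \<in> B \<Longrightarrow> wt b h = 0"
  shows "h = 0"
proof -
  have "bracket h x = 0" for x
  proof -
    have "x \<in> complex_vector.span B" using B by auto
    then show ?thesis
    proof (induction rule: complex_vector.span_induct_alt)
      case (step c x y)
      then show ?case using B(2)[of x] h
        by (simp add: weight_space_def bracket_add_right bracket_scaleC_right)
    qed simp
  qed
  then show ?thesis using bracket_anticommute center_trivial by (metis neg_equal_0_iff_equal)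
qed

text \<open>A substitute for Cartan's criterion: if the Killing form vanished, every
  \<open>[\<gg>\<^sub>\<alpha>, \<gg>\<^sub>-\<^sub>\<alpha>]\<close> would be central, and then \<open>[\<gg>, \<gg>] = \<gg>\<close> would meet \<open>\<hh>\<close> trivially.\<close>

lemma killing_form_nonzero: "\<exists>x y :: 'g. killing_form x y \<noteq> 0"
proof (rule ccontr)
  assume "\<not> ?thesis"
  then have \<kappa>0: "killing_form x y = 0" for x y :: 'g by blast
  obtain B wt where B: "complex_vector.independent B" "complex_vector.span B = UNIV" "finite B"
    "\<And>b. b \<in> B \<Longrightarrow> wt b \<in> cartan_dual H" "\<And>b. b \<in> B \<Longrightarrow> b \<in> weight_space H bracket (wt b)"
    "\<And>b. b \<in> B \<Longrightarrow> b \<noteq> 0" by (rule weight_basis) blast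
  have ef: "bracket e f = 0"
    if \<alpha>: "\<alpha> \<in> cartan_dual H" and e: "e \<in> weight_space H bracket \<alpha>" and f: "f \<in> weight_space H bracket (- \<alpha>)"
    for e f \<alpha>
  proof (cases "\<alpha> = 0")
    case True
    then show ?thesis using e f weight_space_0 abelian by simp
  next
    case False
    define h where "h = bracket e f"
    have h: "h \<in> H" using bracket_opposite_in_H[OF e f] by (simp add: h_def)
    have "\<exists>q::real. wt b h = of_real q * \<alpha> h" if "b \<in> B" for b
      using weight_value_proportional[OF lie_representation_bracket fin_dim e f
          cartan_dual_nonzero[OF \<alpha> False] h_def h B(5,6)[OF that]] by blast
    then obtain q :: "'g \<Rightarrow> real" where q: "\<And>b. b \<in> B \<Longrightarrow> wt b h = of_real (q b) * \<alpha> h" by metis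
    \<comment> \<open>The vanishing form at (h, h) is a sum of real squares times the square of
      \<open>\<alpha> h\<close>. Either factor being zero makes all weights vanish on
      \<open>h\<close>.\<close>
    have "0 = (\<Sum>b\<in>B. wt b h * wt b h)"
      using killing_form_weight_basis[OF B(1,2,5) h h] \<kappa>0 by simp
    also have "\<dots> = of_real (\<Sum>b\<in>B. (q b)\<^sup>2) * (\<alpha> h)\<^sup>2"
      by (simp add: q sum_distrib_left power2_eq_square ac_simps)
    finally have "(\<Sum>b\<in>B. (q b)\<^sup>2) = 0 \<or> \<alpha> h = 0"
      unfolding of_real_sum[symmetric] by (simp del: of_real_sum add: eq_commute[of 0])
    then have "wt b h = 0" if "b \<in> B" for b
      using q[OF that] that B(3) by (auto simp: sum_nonneg_eq_0_iff)
    then have "h = 0" using central_if_weights_vanish[OF B(2,5) h] by blast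
    then show ?thesis by (simp add: h_def)
  qed
  \<comment> \<open>As opposite weight spaces commute by \<open>ef\<close>, every bracket of weight
    vectors lies in the span of the nonzero weight spaces, and so does the whole algebra, which
    equals its derived algebra.\<close>
  let ?K = "cartan_dual H - {0}"
  let ?U = "\<Union>\<mu>\<in>?K. weight_space H bracket \<mu>"
  have bb: "bracket b b' \<in> complex_vector.span ?U" if b: "b \<in> B" "b' \<in> B" for b b'
  proof (cases "wt b' + wt b = 0")
    case True
    then have "wt b' = - wt b" by (simp add: eq_neg_iff_add_eq_0)
    then have "bracket b b' = 0" using ef[of "wt b" b b'] B(4,5) b by metis
    then show ?thesis by (simp add: complex_vector.span_zero)
  next
    case False
    have "bracket b b' \<in> weight_space H bracket (wt b' + wt b)"
      using weight_space_action[OF lie_representation_bracket B(5)[OF b(1)] B(5)[OF b(2)]] .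
    moreover have "wt b' + wt b \<in> ?K" using False B(4) b cartan_dual_add by blast
    ultimately show ?thesis by (intro complex_vector.span_base) blast
  qed
  have xb: "bracket x b' \<in> complex_vector.span ?U" if b: "b' \<in> B" for x b'
  proof -
    have "x \<in> complex_vector.span B" using B by auto
    then show ?thesis
    proof (induction rule: complex_vector.span_induct_alt)
      case (step c x y)
      show ?case unfolding bracket_add_left bracket_scaleC_left
        by (intro complex_vector.span_add complex_vector.span_scale bb[OF step(1) b] step(2))
    qed (simp add: complex_vector.span_zero)
  qed
  have xy: "bracket x y \<in> complex_vector.span ?U" for x y
  proof -
    have "y \<in> complex_vector.span B" using B by auto
    then show ?thesis
    proof (induction rule: complex_vector.span_induct_alt)
      case (step c z y)
      show ?case unfolding bracket_add_right bracket_scaleC_right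
        by (intro complex_vector.span_add complex_vector.span_scale xb[OF step(1)] step(2))
    qed (simp add: complex_vector.span_zero)
  qed
  have "complex_vector.span {bracket x y |x y :: 'g. True} \<subseteq> complex_vector.span ?U"
    using xy by (intro complex_vector.span_minimal complex_vector.subspace_span) blast
  then have U: "complex_vector.span ?U = UNIV" using derived_algebra by auto
  have "x = 0" if x: "x \<in> H" for x
  proof -
    have "x \<in> complex_vector.span (\<Union>\<mu>\<in>?K. weight_space H bracket \<mu>)" using U by auto
    then obtain F u where F: "finite F" "F \<subseteq> ?K" "\<And>\<mu>. \<mu> \<in> F \<Longrightarrow> u \<mu> \<in> weight_space H bracket \<mu>"
      "x = (\<Sum>\<mu>\<in>F. u \<mu>)"
      using span_Union_subspaces[of ?K "weight_space H bracket" x] weight_space_subspace linear_bracket by metis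
    \<comment> \<open>An element of \<open>H\<close> has weight 0. Entering its negative at index 0
      turns the decomposition of \<open>x\<close> into a vanishing sum over distinct
      weights.\<close>
    have "(u(0 := - x)) 0 = 0"
    proof (rule weight_space_sum_eq_0[of H bracket "insert 0 F" "\<lambda>\<mu>. \<mu>" "u(0 := - x)"])
      fix \<mu> \<nu> assume "\<mu> \<in> insert 0 F" "\<nu> \<in> insert 0 F" "\<mu> \<noteq> \<nu>"
      then have "\<mu> - \<nu> \<in> cartan_dual H" "\<mu> - \<nu> \<noteq> 0"
        using F(2) by (auto intro!: cartan_dual_diff cartan_dual_zero)
      then show "\<exists>x\<in>H. \<mu> x \<noteq> \<nu> x" using cartan_dual_nonzero by fastforce
    next
      fix \<mu> assume \<mu>: "\<mu> \<in> insert 0 F"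
      show "(u(0 := - x)) \<mu> \<in> weight_space H bracket \<mu>"
      proof (cases "\<mu> = 0")
        case True
        then show ?thesis using weight_space_0 H_closed(4)[OF x] by simp
      qed (use \<mu> F(3) in simp)
    next
      have "(\<Sum>\<mu>\<in>F. (u(0 := - x)) \<mu>) = (\<Sum>\<mu>\<in>F. u \<mu>)" using F(2) by (intro sum.cong) auto
      moreover have "0 \<notin> F" using F(2) by auto
      ultimately show "(\<Sum>\<mu>\<in>insert 0 F. (u(0 := - x)) \<mu>) = 0"
        using F(1,4) by simp
    qed (use F linear_bracket in auto)
    then show ?thesis by simp
  qed
  \<comment> \<open>\<open>H\<close> being zero, everything centralizes it, so the whole algebra
    lies in \<open>H\<close> and is abelian.\<close>
  then have "y \<in> H" for y by (intro centralizer) (metis bracket_zero(1))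
  then show False using nonabelian abelian by blast
qed

text \<open>By invariance the radical is an ideal; it is proper by
  \<open>killing_form_nonzero\<close>, so simplicity makes it zero.\<close>

lemma killing_form_nondegenerate:
  fixes x :: 'g
  assumes "\<And>y. killing_form x y = 0"
  shows "x = 0"
proof -
  let ?I = "{x :: 'g. \<forall>y. killing_form x y = 0}"
  have "bracket y x \<in> ?I" if "x \<in> ?I" for x y
    using that killing_form_invariant[of x y] bracket_anticommute[of y x] bracket_minus
      killing_form_scale_left[of "-1" "bracket x y"]
    by (auto simp: complex_vector.scale_minus_left)
  then have "lie_ideal ?I"
    by (auto simp: lie_ideal_def complex_vector.subspace_def killing_form_add_left
        killing_form_scale_left killing_form_0)
  moreover have "?I \<noteq> UNIV" using killing_form_nonzero by auto
  ultimately have "?I = {0}" using ideal_trivial by blast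
  then show ?thesis using assms by auto
qed

lemma killing_form_spanning:
  fixes x :: 'g
  assumes "complex_vector.span B = UNIV" "\<And>b. b \<in> B \<Longrightarrow> killing_form x b = 0"
  shows "x = 0"
proof (rule killing_form_nondegenerate)
  fix y
  have "y \<in> complex_vector.span B" using assms by auto
  then show "killing_form x y = 0"
    by (induction rule: complex_vector.span_induct_alt)
      (auto simp: killing_form_0 killing_form_add_right killing_form_scale_right assms)
qed

text \<open>\<open>H\<close> is the weight space of 0, hence orthogonal to all nonzero weight
  spaces; an element of \<open>H\<close> orthogonal to \<open>H\<close> is thus orthogonal to a
  spanning set. This gives the uniqueness behind \<open>killing_dual\<close>.\<close>

lemma killing_form_nondegenerate_H:
  assumes x: "x \<in> H" "\<And>y. y \<in> H \<Longrightarrow> killing_form x y = 0"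
  shows "x = 0"
proof -
  obtain B wt where B: "complex_vector.independent B" "complex_vector.span B = UNIV" "finite B"
    "\<And>b. b \<in> B \<Longrightarrow> wt b \<in> cartan_dual H" "\<And>b. b \<in> B \<Longrightarrow> b \<in> weight_space H bracket (wt b)"
    "\<And>b. b \<in> B \<Longrightarrow> b \<noteq> 0" by (rule weight_basis) blast
  show ?thesis
  proof (rule killing_form_spanning[OF B(2)])
    fix b assume b: "b \<in> B"
    show "killing_form x b = 0"
    proof (cases "wt b = 0")
      case True
      then show ?thesis using B(5)[OF b] weight_space_0 x by simp
    next
      case False
      then obtain y where "y \<in> H" "wt b y \<noteq> 0" using cartan_dual_nonzero B(4) b by blast
      then show ?thesis
        using killing_form_orthogonal[of x 0 b "wt b" y] x B(5)[OF b] weight_space_0 by simp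
    qed
  qed
qed

end

section \<open>The inner product on the real span of the roots\<close>

context cartan_setting
begin

lemma rootsD:
  assumes "\<alpha> \<in> roots H"
  shows "\<alpha> \<in> cartan_dual H" "\<alpha> \<noteq> 0" "\<exists>y\<in>H. \<alpha> y \<noteq> 0" "\<exists>e\<in>weight_space H bracket \<alpha>. e \<noteq> 0"
  using assms cartan_dual_nonzero by (auto simp: roots_def weights_def)

lemma rootsI: "\<alpha> \<in> weights H bracket \<Longrightarrow> \<alpha> \<noteq> 0 \<Longrightarrow> \<alpha> \<in> roots H"
  by (simp add: roots_def)

text \<open>Some vector of a weight basis pairs nontrivially with \<open>e\<close>; orthogonality
  forces its weight to be - \<alpha>, and rescaling it gives \<open>f\<close>.\<close>

lemma opposite_root_vectors:
  assumes \<alpha>: "\<alpha> \<in> roots H"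
  obtains e f where "e \<in> weight_space H bracket \<alpha>" "f \<in> weight_space H bracket (- \<alpha>)"
    "killing_form e f = 1"
proof -
  obtain B wt where B: "complex_vector.independent B" "complex_vector.span B = UNIV" "finite B"
    "\<And>b. b \<in> B \<Longrightarrow> wt b \<in> cartan_dual H" "\<And>b. b \<in> B \<Longrightarrow> b \<in> weight_space H bracket (wt b)"
    "\<And>b. b \<in> B \<Longrightarrow> b \<noteq> 0" by (rule weight_basis) blast
  obtain e where e: "e \<in> weight_space H bracket \<alpha>" "e \<noteq> 0" using rootsD(4)[OF \<alpha>] by blast
  obtain b where b: "b \<in> B" "killing_form e b \<noteq> 0" using killing_form_spanning[OF B(2), of e] e by blast
  have "wt b = - \<alpha>"
  proof (rule ccontr)
    assume "wt b \<noteq> - \<alpha>"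
    then have "\<alpha> + wt b \<noteq> 0" by (simp add: eq_neg_iff_add_eq_0 add.commute)
    then obtain y where "y \<in> H" "\<alpha> y + wt b y \<noteq> 0"
      using cartan_dual_nonzero[OF cartan_dual_add[OF rootsD(1)[OF \<alpha>] B(4)[OF b(1)]]] by auto
    then show False using killing_form_orthogonal[OF e(1) B(5)[OF b(1)]] b(2) by blast
  qed
  define f where "f = (1 / killing_form e b) *\<^sub>C b"
  have "b \<in> weight_space H bracket (- \<alpha>)" using B(5)[OF b(1)] \<open>wt b = - \<alpha>\<close> by simp
  then have "f \<in> weight_space H bracket (- \<alpha>)" unfolding f_def
    using complex_vector.subspace_scale[OF weight_space_subspace[of H bracket]] linear_bracket by blast
  moreover have "killing_form e f = 1" using b by (simp add: f_def killing_form_scale_right)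
  ultimately show ?thesis using that e by blast
qed

lemma uminus_root: "\<alpha> \<in> roots H \<Longrightarrow> - \<alpha> \<in> roots H"
proof -
  assume \<alpha>: "\<alpha> \<in> roots H"
  then obtain e f where f: "f \<in> weight_space H bracket (- \<alpha>)" "killing_form e f = 1"
    using opposite_root_vectors by blast
  then have "f \<noteq> 0" using killing_form_0 by auto
  moreover have "- \<alpha> \<in> cartan_dual H" "- \<alpha> \<noteq> 0"
    using rootsD(1,2)[OF \<alpha>] cartan_dual_uminus by auto
  ultimately show "- \<alpha> \<in> roots H" using f(1) unfolding roots_def weights_def by blast
qed

lemma killing_dual_eqI:
  assumes "x \<in> H" "\<And>y. y \<in> H \<Longrightarrow> killing_form x y = \<mu> y"
  shows "killing_dual H \<mu> = x"
  unfolding killing_dual_def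
proof (rule the_equality)
  fix x' assume x': "x' \<in> H \<and> (\<forall>y\<in>H. killing_form x' y = \<mu> y)"
  have "x' - x = 0"
  proof (rule killing_form_nondegenerate_H)
    show "x' - x \<in> H" using x' assms(1) by (intro complex_vector.subspace_diff[OF subspace_H]) auto
    show "killing_form (x' - x) y = 0" if "y \<in> H" for y
      using killing_form_add_left[of "x' - x" x y] x' assms(2)[OF that] that by simp
  qed
  then show "x' = x" by simp
qed (use assms in auto)

text \<open>With \<open>killing_form e f = 1\<close>, invariance shows that h = [e, f] represents
  \<alpha>. Writing each weight at h as a real multiple \<open>q b\<close> of
  \<open>\<alpha> h\<close> gives \<alpha> h = s (\<alpha> h)^2 with s a sum of squares, so
  \<open>\<alpha> h\<close> is the positive real 1 / s. The element is \<open>killing_dual\<close>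
  itself, not the coroot on which \<alpha> takes the value 2.\<close>

lemma root_coroot_data:
  assumes \<alpha>: "\<alpha> \<in> roots H"
  obtains e f a where "e \<in> weight_space H bracket \<alpha>" "f \<in> weight_space H bracket (- \<alpha>)"
    "killing_dual H \<alpha> = bracket e f" "killing_dual H \<alpha> \<in> H"
    "\<And>y. y \<in> H \<Longrightarrow> killing_form (killing_dual H \<alpha>) y = \<alpha> y"
    "a > 0" "\<alpha> (killing_dual H \<alpha>) = complex_of_real a"
proof -
  obtain e f where e: "e \<in> weight_space H bracket \<alpha>" and f: "f \<in> weight_space H bracket (- \<alpha>)"
    and ef: "killing_form e f = 1" by (rule opposite_root_vectors[OF \<alpha>])
  define h where "h = bracket e f"
  have h: "h \<in> H" unfolding h_def by (rule bracket_opposite_in_H[OF e f])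
  have \<kappa>h: "killing_form h y = \<alpha> y" if "y \<in> H" for y
  proof -
    have "bracket f y = \<alpha> y *\<^sub>C f"
      using f that bracket_anticommute[of f y] by (simp add: weight_space_def complex_vector.scale_minus_left)
    then show ?thesis by (simp add: h_def killing_form_invariant killing_form_scale_right ef)
  qed
  then have kd: "killing_dual H \<alpha> = h" using h by (intro killing_dual_eqI)
  obtain B wt where B: "complex_vector.independent B" "complex_vector.span B = UNIV" "finite B"
    "\<And>b. b \<in> B \<Longrightarrow> wt b \<in> cartan_dual H" "\<And>b. b \<in> B \<Longrightarrow> b \<in> weight_space H bracket (wt b)"
    "\<And>b. b \<in> B \<Longrightarrow> b \<noteq> 0" by (rule weight_basis) blast
  have "\<exists>q::real. wt b h = of_real q * \<alpha> h" if "b \<in> B" for b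
    using weight_value_proportional[OF lie_representation_bracket fin_dim e f
        rootsD(3)[OF \<alpha>] h_def h B(5,6)[OF that]] by blast
  then obtain q :: "'g \<Rightarrow> real" where q: "\<And>b. b \<in> B \<Longrightarrow> wt b h = of_real (q b) * \<alpha> h" by metis
  have "\<alpha> h \<noteq> 0"
  proof
    assume "\<alpha> h = 0"
    then have "h = 0" using central_if_weights_vanish[OF B(2,5) h] q by auto
    then have "\<alpha> y = 0" if "y \<in> H" for y using \<kappa>h[OF that] killing_form_0 by simp
    then show False using rootsD(3)[OF \<alpha>] by blast
  qed
  define s where "s = (\<Sum>b\<in>B. (q b)\<^sup>2)"
  have "\<alpha> h = (\<Sum>b\<in>B. wt b h * wt b h)"
    using killing_form_weight_basis[OF B(1,2,5) h h] \<kappa>h[OF h] by simp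
  also have "\<dots> = of_real s * (\<alpha> h)\<^sup>2"
    by (simp add: s_def q sum_distrib_left power2_eq_square ac_simps)
  finally have "of_real s * \<alpha> h = 1" using \<open>\<alpha> h \<noteq> 0\<close> by (simp add: power2_eq_square)
  then have "\<alpha> h = of_real (1 / s)" and "s \<noteq> 0"
    by (auto simp: field_simps eq_divide_eq)
  moreover have "s \<ge> 0" by (simp add: s_def sum_nonneg)
  ultimately show ?thesis using that[OF e f _ _ _ _, of "1 / s"] kd h h_def \<kappa>h by auto
qed

lemma weight_at_root_real:
  fixes \<pi> :: "'g \<Rightarrow> 'v :: complex_vector \<Rightarrow> 'v"
  assumes \<alpha>: "\<alpha> \<in> roots H" and "lie_representation \<pi>" "finite_dimensional TYPE('v)" and \<mu>: "\<mu> \<in> weights H \<pi>"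
  shows "\<mu> (killing_dual H \<alpha>) \<in> \<real>"
proof -
  obtain e f a where ef: "e \<in> weight_space H bracket \<alpha>" "f \<in> weight_space H bracket (- \<alpha>)"
    "killing_dual H \<alpha> = bracket e f" "killing_dual H \<alpha> \<in> H" "\<alpha> (killing_dual H \<alpha>) = complex_of_real a"
    using root_coroot_data[OF \<alpha>] by metis
  obtain v where v: "v \<in> weight_space H \<pi> \<mu>" "v \<noteq> 0" using \<mu> by (auto simp: weights_def)
  obtain q :: real where "\<mu> (killing_dual H \<alpha>) = of_real q * \<alpha> (killing_dual H \<alpha>)"
    using weight_value_proportional[OF assms(2,3) ef(1,2) rootsD(3)[OF \<alpha>] ef(3,4) v] by blast
  then show ?thesis by (simp add: ef(5))
qed

subsection \<open>The real span of the roots\<close>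

lemma real_dual_closed:
  "0 \<in> real_dual H" "\<mu> \<in> real_dual H \<Longrightarrow> \<nu> \<in> real_dual H \<Longrightarrow> \<mu> + \<nu> \<in> real_dual H"
  "\<mu> \<in> real_dual H \<Longrightarrow> rscale c \<mu> \<in> real_dual H" "\<mu> \<in> real_dual H \<Longrightarrow> - \<mu> \<in> real_dual H"
  "\<mu> \<in> real_dual H \<Longrightarrow> \<nu> \<in> real_dual H \<Longrightarrow> \<mu> - \<nu> \<in> real_dual H"
  "(\<And>i. i \<in> A \<Longrightarrow> g i \<in> real_dual H) \<Longrightarrow> (\<Sum>i\<in>A. g i) \<in> real_dual H"
  "\<alpha> \<in> roots H \<Longrightarrow> \<alpha> \<in> real_dual H"
  unfolding real_dual_def
  by (auto intro: functional.span_zero functional.span_add functional.span_scale functional.span_neg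
      functional.span_diff functional.span_sum functional.span_base)

text \<open>One joint statement because \<open>killing_dual\<close> is a definite description: its
  additivity along the span rests on both summands being represented by elements of
  \<open>H\<close>.\<close>

lemma real_dual_killing:
  assumes "\<mu> \<in> real_dual H"
  shows "\<mu> \<in> cartan_dual H \<and> killing_dual H \<mu> \<in> H \<and>
    (\<forall>y\<in>H. killing_form (killing_dual H \<mu>) y = \<mu> y) \<and> (\<forall>\<alpha>\<in>roots H. \<mu> (killing_dual H \<alpha>) \<in> \<real>)"
proof -
  define P where "P \<mu> \<longleftrightarrow> \<mu> \<in> cartan_dual H \<and> killing_dual H \<mu> \<in> H \<and>
    (\<forall>y\<in>H. killing_form (killing_dual H \<mu>) y = \<mu> y) \<and> (\<forall>\<alpha>\<in>roots H. \<mu> (killing_dual H \<alpha>) \<in> \<real>)"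
    for \<mu>
  have "\<mu> \<in> functional.span (roots H)" using assms by (simp add: real_dual_def)
  then have "P \<mu>"
  proof (induction rule: functional.span_induct_alt)
    case base
    have "killing_dual H 0 = 0" by (rule killing_dual_eqI) (simp_all add: H_closed killing_form_0)
    then have "P 0" by (simp add: P_def cartan_dual_zero H_closed killing_form_0)
    then show ?case .
  next
    case (step c \<beta> \<nu>)
    have \<beta>: "P \<beta>"
      using root_coroot_data[OF step(1)] rootsD(1)[OF step(1)] step(1)
        weight_at_root_real[OF _ lie_representation_bracket fin_dim]
      unfolding P_def by (metis Diff_iff roots_def)
    have kd: "killing_dual H (rscale c \<beta> + \<nu>) = of_real c *\<^sub>C killing_dual H \<beta> + killing_dual H \<nu>"
      by (rule killing_dual_eqI)
        (use \<beta> step(2) in \<open>auto simp: P_def killing_form_add_left killing_form_scale_left rscale_def intro!: H_closed\<close>)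
    have "P (rscale c \<beta> + \<nu>)"
      using \<beta> step(2) unfolding P_def kd
      by (auto simp: killing_form_add_left killing_form_scale_left
          intro!: H_closed cartan_dual_add cartan_dual_rscale) (simp_all add: rscale_def)
    then show ?case .
  qed
  then show ?thesis unfolding P_def .
qed

text \<open>Evaluation at a fixed point is visibly linear in \<mu>, which gives linearity of
  \<open>ip\<close> on the left; symmetry carries it to the right.\<close>

lemma ip_eq: "\<mu> \<in> real_dual H \<Longrightarrow> \<nu> \<in> real_dual H \<Longrightarrow> ip H \<mu> \<nu> = Re (\<mu> (killing_dual H \<nu>))"
  using real_dual_killing[of \<mu>] real_dual_killing[of \<nu>] by (simp add: ip_def)

lemma ip_commute: "ip H \<mu> \<nu> = ip H \<nu> \<mu>"
  by (simp add: ip_def killing_form_commute)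

lemma ip_add_left:
  "\<mu> \<in> real_dual H \<Longrightarrow> \<mu>' \<in> real_dual H \<Longrightarrow> \<nu> \<in> real_dual H \<Longrightarrow> ip H (\<mu> + \<mu>') \<nu> = ip H \<mu> \<nu> + ip H \<mu>' \<nu>"
  by (simp add: ip_eq real_dual_closed)

lemma ip_diff_left:
  "\<mu> \<in> real_dual H \<Longrightarrow> \<mu>' \<in> real_dual H \<Longrightarrow> \<nu> \<in> real_dual H \<Longrightarrow> ip H (\<mu> - \<mu>') \<nu> = ip H \<mu> \<nu> - ip H \<mu>' \<nu>"
  by (simp add: ip_eq real_dual_closed)

lemma ip_minus_left: "\<mu> \<in> real_dual H \<Longrightarrow> \<nu> \<in> real_dual H \<Longrightarrow> ip H (- \<mu>) \<nu> = - ip H \<mu> \<nu>"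
  by (simp add: ip_eq real_dual_closed)

lemma ip_rscale_left:
  "\<mu> \<in> real_dual H \<Longrightarrow> \<nu> \<in> real_dual H \<Longrightarrow> ip H (rscale c \<mu>) \<nu> = c * ip H \<mu> \<nu>"
  by (simp add: ip_eq real_dual_closed) (simp add: rscale_def)

lemma ip_zero_left: "\<nu> \<in> real_dual H \<Longrightarrow> ip H 0 \<nu> = 0"
  by (simp add: ip_eq real_dual_closed)

lemma ip_sum_left:
  "(\<And>i. i \<in> A \<Longrightarrow> g i \<in> real_dual H) \<Longrightarrow> \<nu> \<in> real_dual H \<Longrightarrow> ip H (\<Sum>i\<in>A. g i) \<nu> = (\<Sum>i\<in>A. ip H (g i) \<nu>)"
  by (induction A rule: infinite_finite_induct)
    (simp_all add: ip_zero_left ip_add_left real_dual_closed)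

lemma ip_right:
  assumes "\<mu> \<in> real_dual H" "\<mu>' \<in> real_dual H" "\<nu> \<in> real_dual H"
  shows "ip H \<nu> (\<mu> + \<mu>') = ip H \<nu> \<mu> + ip H \<nu> \<mu>'" "ip H \<nu> (\<mu> - \<mu>') = ip H \<nu> \<mu> - ip H \<nu> \<mu>'"
    "ip H \<nu> (rscale c \<mu>) = c * ip H \<nu> \<mu>" "ip H \<nu> (- \<mu>) = - ip H \<nu> \<mu>" "ip H \<nu> 0 = 0"
  using assms by (simp_all add: ip_commute[of \<nu>] ip_add_left ip_diff_left ip_rscale_left ip_minus_left ip_zero_left)

lemma ip_root_pos: "\<alpha> \<in> roots H \<Longrightarrow> ip H \<alpha> \<alpha> > 0"
  using root_coroot_data[of \<alpha>] by (metis Re_complex_of_real ip_eq real_dual_closed(7))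

text \<open>If \<open>f\<close> killed a vector of weight \<mu>, that vector would be lowest in its
  string and \<open>lowest_weight_value\<close> would make the product with \<alpha> at most 0. So
  \<open>f\<close> produces a nonzero vector of the lower weight.\<close>

lemma weight_diff_root:
  fixes \<pi> :: "'g \<Rightarrow> 'v :: complex_vector \<Rightarrow> 'v"
  assumes \<pi>: "lie_representation \<pi>" "finite_dimensional TYPE('v)"
    and \<alpha>: "\<alpha> \<in> roots H" and \<mu>: "\<mu> \<in> weights H \<pi>" "\<mu> \<in> real_dual H" and pos: "ip H \<mu> \<alpha> > 0"
  shows "\<mu> - \<alpha> \<in> weights H \<pi>"
proof -
  obtain e f a where ef: "e \<in> weight_space H bracket \<alpha>" "f \<in> weight_space H bracket (- \<alpha>)"
    "killing_dual H \<alpha> = bracket e f" "killing_dual H \<alpha> \<in> H"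
    and a: "a > 0" "\<alpha> (killing_dual H \<alpha>) = complex_of_real a"
    by (rule root_coroot_data[OF \<alpha>]) blast
  obtain v where v: "v \<in> weight_space H \<pi> \<mu>" "v \<noteq> 0" and \<mu>c: "\<mu> \<in> cartan_dual H"
    using \<mu> by (auto simp: weights_def)
  have "\<pi> f v \<noteq> 0"
  proof
    assume "\<pi> f v = 0"
    then obtain m :: nat where "\<mu> (killing_dual H \<alpha>) = - (of_nat m / 2) * \<alpha> (killing_dual H \<alpha>)"
      using lowest_weight_value[OF \<pi> ef(1,2) rootsD(3)[OF \<alpha>] rootsD(1)[OF \<alpha>] \<mu>c ef(3,4) H_closed(4)[OF ef(4)] v]
      by blast
    then have "ip H \<mu> \<alpha> = Re (complex_of_real (- (real m / 2) * a))"
      using ip_eq[OF \<mu>(2) real_dual_closed(7)[OF \<alpha>]] by (simp add: a)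
    then have "ip H \<mu> \<alpha> = - (real m / 2) * a" by (simp only: Re_complex_of_real)
    moreover have "real m / 2 * a \<ge> 0" using a by simp
    ultimately show False using pos by simp
  qed
  moreover have "\<pi> f v \<in> weight_space H \<pi> (\<mu> - \<alpha>)"
    using weight_space_action[OF \<pi>(1) ef(2) v(1)] by simp
  moreover have "\<mu> - \<alpha> \<in> cartan_dual H"
    using \<mu>c rootsD(1)[OF \<alpha>] by (rule cartan_dual_diff)
  ultimately show ?thesis by (auto simp: weights_def)
qed

lemma weight_add_root:
  fixes \<pi> :: "'g \<Rightarrow> 'v :: complex_vector \<Rightarrow> 'v"
  assumes \<pi>: "lie_representation \<pi>" "finite_dimensional TYPE('v)"
    and \<alpha>: "\<alpha> \<in> roots H" and \<mu>: "\<mu> \<in> weights H \<pi>" "\<mu> \<in> real_dual H" and neg: "ip H \<mu> \<alpha> < 0"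
  shows "\<mu> + \<alpha> \<in> weights H \<pi>"
  using weight_diff_root[OF \<pi> uminus_root[OF \<alpha>] \<mu>] neg
    ip_right(4)[OF real_dual_closed(7)[OF \<alpha>] _ \<mu>(2)] \<mu>(2)
  by simp

lemma finite_roots: "finite (roots H)"
proof (rule ccontr)
  assume "infinite (roots H)"
  then obtain \<beta> :: "nat \<Rightarrow> _" where \<beta>: "inj \<beta>" "range \<beta> \<subseteq> roots H"
    using infinite_countable_subset by blast
  then have root: "\<beta> n \<in> roots H" for n by blast
  then have "\<forall>n. \<exists>v. v \<in> weight_space H bracket (\<beta> n) \<and> v \<noteq> 0" using rootsD(4) by blast
  then obtain v where v: "\<And>n. v n \<in> weight_space H bracket (\<beta> n)" "\<And>n. v n \<noteq> 0" by metis
  have "\<exists>x\<in>H. \<beta> m x \<noteq> \<beta> n x" if "m \<noteq> n" for m n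
  proof -
    have "\<beta> m - \<beta> n \<noteq> 0" using that \<beta>(1) by (simp add: inj_eq)
    then show ?thesis
      using cartan_dual_nonzero[OF cartan_dual_diff[OF rootsD(1)[OF root[of m]] rootsD(1)[OF root[of n]]]]
      by auto
  qed
  then show False
    using joint_eigenvectors_vanish[OF fin_dim, of H bracket v \<beta>] linear_bracket v by metis
qed

end

section \<open>Order ideals\<close>

lemma bij_betw_funpow_mem: "bij_betw \<tau> S S \<Longrightarrow> x \<in> S \<Longrightarrow> (\<tau> ^^ k) x \<in> S"
  by (induction k) (auto dest: bij_betwE)

text \<open>Pigeonhole on the powers of \<tau>, restricted to \<open>S\<close> so that they range
  over the finite set of extensional self-maps; injectivity cancels the common part. Hence the
  minimum in \<open>bijection_order\<close> is attained.\<close>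

lemma bijection_order_works:
  assumes "finite S" "bij_betw \<tau> S S"
  shows "bijection_order S \<tau> > 0 \<and> (\<forall>x\<in>S. (\<tau> ^^ bijection_order S \<tau>) x = x)"
proof -
  have mem: "(\<tau> ^^ k) x \<in> S" if "x \<in> S" for k x by (rule bij_betw_funpow_mem[OF assms(2) that])
  have inj: "(\<tau> ^^ k) x = (\<tau> ^^ k) y \<Longrightarrow> x = y" if "x \<in> S" "y \<in> S" for k x y
    using bij_betw_funpow[OF assms(2), of k] that by (meson bij_betw_def inj_on_def)
  let ?F = "\<lambda>n. restrict (\<tau> ^^ n) S"
  have "range ?F \<subseteq> S \<rightarrow>\<^sub>E S" using mem by auto
  then have "finite (range ?F)" using finite_PiE[of S "\<lambda>_. S"] assms(1) finite_subset by blast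
  then have "\<not> inj ?F" using finite_imageD infinite_UNIV_nat by blast
  then obtain a b where "a \<noteq> b" "?F a = ?F b" by (auto simp: inj_on_def)
  then obtain a b where ab: "a < b" "?F a = ?F b" by (metis nat_neq_iff)
  have "(\<tau> ^^ (b - a)) x = x" if "x \<in> S" for x
  proof -
    have "(\<tau> ^^ a) ((\<tau> ^^ (b - a)) x) = (\<tau> ^^ b) x"
      using ab(1) by (metis comp_apply funpow_add le_add_diff_inverse less_imp_le)
    also have "\<dots> = (\<tau> ^^ a) x" using fun_cong[OF ab(2), of x] that by simp
    finally show ?thesis using inj mem that by blast
  qed
  then have "b - a > 0 \<and> (\<forall>x\<in>S. (\<tau> ^^ (b - a)) x = x)" using ab by auto
  then show ?thesis unfolding bijection_order_def by (rule LeastI)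
qed

text \<open>Over \<open>bijection_order\<close> many steps the differences of \<open>g\<close>
  telescope to zero, since the iteration returns to its start.\<close>

lemma mesic_coboundary:
  assumes "finite S" "bij_betw \<tau> S S" and f: "\<And>x. x \<in> S \<Longrightarrow> f x = c + g (\<tau> x) - g x"
  shows "mesic S \<tau> f c"
  unfolding mesic_def
proof (intro conjI ballI assms(1,2))
  fix x assume x: "x \<in> S"
  define m where "m = bijection_order S \<tau>"
  have m: "m > 0" "(\<tau> ^^ m) x = x" using bijection_order_works[OF assms(1,2)] x by (auto simp: m_def)
  have "(\<Sum>k<m. f ((\<tau> ^^ k) x)) = (\<Sum>k<m. c + (g ((\<tau> ^^ Suc k) x) - g ((\<tau> ^^ k) x)))"
    using f[OF bij_betw_funpow_mem[OF assms(2) x]] by (simp add: add_diff_eq)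
  also have "\<dots> = real m * c"
    using sum_lessThan_telescope[of "\<lambda>k. g ((\<tau> ^^ k) x)" m] m(2) by (simp add: sum.distrib)
  finally show "1 / real m * (\<Sum>k<m. f ((\<tau> ^^ k) x)) = c" using m(1) by simp
qed

subsection \<open>Rowmotion on a finite poset\<close>

locale finite_order =
  fixes P :: "'p set" and r :: "('p \<times> 'p) set"
  assumes finite_P: "finite P" and refl_r: "\<And>x. x \<in> P \<Longrightarrow> (x, x) \<in> r"
    and antisym_r: "antisym r" and trans_r: "trans r"
begin

lemma ex_minimal_below:
  assumes "A \<subseteq> P" "x \<in> A"
  shows "\<exists>m\<in>minimal_elements r A. (m, x) \<in> r"
  using assms(2)
proof (induction "card {y\<in>A. (y, x) \<in> r}" arbitrary: x rule: less_induct)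
  case less
  show ?case
  proof (cases "x \<in> minimal_elements r A")
    case True
    then show ?thesis using refl_r less.prems assms by blast
  next
    case False
    then obtain y where y: "y \<in> A" "(y, x) \<in> r" "y \<noteq> x"
      using less.prems by (auto simp: minimal_elements_def)
    have "x \<notin> {z\<in>A. (z, y) \<in> r}" using y antisym_r by (auto dest: antisymD)
    moreover have "x \<in> {z\<in>A. (z, x) \<in> r}" using less.prems refl_r assms(1) by auto
    moreover have "{z\<in>A. (z, y) \<in> r} \<subseteq> {z\<in>A. (z, x) \<in> r}" using y trans_r by (auto dest: transD)
    ultimately have "{z\<in>A. (z, y) \<in> r} \<subset> {z\<in>A. (z, x) \<in> r}" by blast
    moreover have "finite {z\<in>A. (z, x) \<in> r}" using assms(1) finite_P finite_subset by fastforce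
    ultimately have "card {z\<in>A. (z, y) \<in> r} < card {z\<in>A. (z, x) \<in> r}" by (rule psubset_card_mono[rotated])
    then obtain m where "m \<in> minimal_elements r A" "(m, y) \<in> r" using less.hyps y(1) by blast
    then show ?thesis using y(2) trans_r by (meson transD)
  qed
qed

lemma rowmotion_ideal: "fon_der_flaass P r I \<in> order_ideals P r"
  unfolding order_ideals_def fon_der_flaass_def generated_ideal_def
  using trans_r by (blast dest: transD)

text \<open>Maximal elements are encoded as minimal elements for the converse relation. The
  generators of \<Psi> I form an antichain, and an ideal generated by an antichain has exactly its
  generators as maximal elements.\<close>

lemma maximal_rowmotion:
  "minimal_elements (r\<inverse>) (fon_der_flaass P r I) = minimal_elements r (P - I)"
proof -
  let ?M = "minimal_elements r (P - I)"
  have M: "?M \<subseteq> P" by (auto simp: minimal_elements_def)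
  have anti: "x = y" if "x \<in> ?M" "y \<in> ?M" "(x, y) \<in> r" for x y
    using that by (auto simp: minimal_elements_def)
  have R: "fon_der_flaass P r I = {x\<in>P. \<exists>y\<in>?M. (x, y) \<in> r}"
    by (simp add: fon_der_flaass_def generated_ideal_def)
  show ?thesis
  proof (intro equalityI subsetI)
    fix x assume "x \<in> minimal_elements (r\<inverse>) (fon_der_flaass P r I)"
    then obtain y where "y \<in> ?M" "(x, y) \<in> r" and "\<forall>z\<in>fon_der_flaass P r I. (x, z) \<in> r \<longrightarrow> z = x"
      by (auto simp: minimal_elements_def[of "r\<inverse>"] R)
    then show "x \<in> ?M" using R M refl_r by blast
  next
    fix x assume x: "x \<in> ?M"
    have "z = x" if z: "z \<in> fon_der_flaass P r I" "(x, z) \<in> r" for z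
    proof -
      obtain y where y: "y \<in> ?M" "(z, y) \<in> r" using z(1) unfolding R by auto
      then have "(x, y) \<in> r" using that(2) trans_r by (meson transD)
      then have "x = y" using anti x y by blast
      then show ?thesis using y(2) that(2) antisym_r by (metis antisymD)
    qed
    moreover have "x \<in> fon_der_flaass P r I" using x M refl_r unfolding R by blast
    ultimately show "x \<in> minimal_elements (r\<inverse>) (fon_der_flaass P r I)"
      by (auto simp: minimal_elements_def[of "r\<inverse>"])
  qed
qed

lemma complement_of_ideal:
  assumes "I \<in> order_ideals P r"
  shows "P - I = {x\<in>P. \<exists>m\<in>minimal_elements r (P - I). (m, x) \<in> r}"
proof (intro equalityI subsetI)
  fix x assume "x \<in> P - I"
  then show "x \<in> {x\<in>P. \<exists>m\<in>minimal_elements r (P - I). (m, x) \<in> r}"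
    using ex_minimal_below[of "P - I" x] by auto
next
  fix x assume "x \<in> {x\<in>P. \<exists>m\<in>minimal_elements r (P - I). (m, x) \<in> r}"
  then show "x \<in> P - I" using assms by (auto simp: order_ideals_def minimal_elements_def)
qed

lemma finite_order_ideals: "finite (order_ideals P r)"
  by (rule finite_subset[of _ "Pow P"]) (auto simp: order_ideals_def finite_P)

text \<open>\<open>I\<close> can be recovered: the maximal elements of its image are the minimal
  elements of \<open>P - I\<close>, and these generate the complement upwards. An injective self-map
  of a finite set is bijective.\<close>

lemma rowmotion_bij: "bij_betw (fon_der_flaass P r) (order_ideals P r) (order_ideals P r)"
proof -
  have "inj_on (fon_der_flaass P r) (order_ideals P r)"
  proof (rule inj_onI)
    fix I I' assume I: "I \<in> order_ideals P r" "I' \<in> order_ideals P r"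
      and "fon_der_flaass P r I = fon_der_flaass P r I'"
    then have "P - I = P - I'"
      using complement_of_ideal[OF I(1)] complement_of_ideal[OF I(2)] maximal_rowmotion by metis
    then show "I = I'" using I by (auto simp: order_ideals_def)
  qed
  then show ?thesis
    using endo_inj_surj[OF finite_order_ideals] rowmotion_ideal
    by (simp add: bij_betw_def image_subsetI)
qed

end

subsection \<open>Heaps of minuscule words\<close>

definition occurrences :: "(nat \<Rightarrow> nat) \<Rightarrow> nat \<Rightarrow> nat set \<Rightarrow> nat" where
  "occurrences lab j A = card {x\<in>A. lab x = j}"

definition neighbours :: "(nat \<Rightarrow> nat \<Rightarrow> bool) \<Rightarrow> (nat \<Rightarrow> nat) \<Rightarrow> nat \<Rightarrow> nat set \<Rightarrow> nat" where
  "neighbours N lab j A = card {x\<in>A. N (lab x) j}"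

text \<open>\<open>pairing j A\<close> is \<open>(\<lambda> - \<Sum>x\<in>A. \<alpha>\<^bsub>lab x\<^esub>, \<alpha>\<^sub>j\<^sup>\<or>)\<close>, where \<open>c j = (\<lambda>, \<alpha>\<^sub>j\<^sup>\<or>)\<close> and \<open>N i j\<close> says that
  the nodes \<open>i\<close> and \<open>j\<close> of the simply laced Dynkin diagram are joined.\<close>

locale minuscule_word =
  fixes n :: nat and lab :: "nat \<Rightarrow> nat" and N :: "nat \<Rightarrow> nat \<Rightarrow> bool" and c :: "nat \<Rightarrow> real" and L :: "nat set"
  fixes pairing :: "nat \<Rightarrow> nat set \<Rightarrow> real" and P :: "nat set" and G r :: "(nat \<times> nat) set"
  defines "pairing \<equiv> \<lambda>j A. c j - 2 * real (occurrences lab j A) + real (neighbours N lab j A)"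
  defines "P \<equiv> {1..n}"
  defines "G \<equiv> {(x, y). x \<in> P \<and> y \<in> P \<and> x < y \<and> N (lab x) (lab y)}"
  defines "r \<equiv> Id_on P \<union> G\<^sup>+"
  assumes N_sym: "N i j \<Longrightarrow> N j i" and N_irrefl: "\<not> N i i"
    and lab_L: "x \<in> P \<Longrightarrow> lab x \<in> L"
    and step: "x \<in> P \<Longrightarrow> pairing (lab x) {1..<x} = 1"
    and start: "j \<in> L \<Longrightarrow> pairing j {} \<ge> 0"
    and final: "j \<in> L \<Longrightarrow> pairing j P \<le> 0"
begin

lemma occurrences_Un:
  "finite A \<Longrightarrow> finite B \<Longrightarrow> A \<inter> B = {} \<Longrightarrow> occurrences lab j (A \<union> B) = occurrences lab j A + occurrences lab j B"
  unfolding occurrences_def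
  by (subst card_Un_disjoint[symmetric]) (auto intro: arg_cong[of _ _ card])

lemma neighbours_Un:
  "finite A \<Longrightarrow> finite B \<Longrightarrow> A \<inter> B = {} \<Longrightarrow> neighbours N lab j (A \<union> B) = neighbours N lab j A + neighbours N lab j B"
  unfolding neighbours_def
  by (subst card_Un_disjoint[symmetric]) (auto intro: arg_cong[of _ _ card])

lemma G_less: "(x, y) \<in> G\<^sup>+ \<Longrightarrow> x \<in> P \<and> y \<in> P \<and> x < y"
  by (induction rule: trancl_induct) (auto simp: G_def)

lemma less_imp_rel: "x \<in> P \<Longrightarrow> y \<in> P \<Longrightarrow> x < y \<Longrightarrow> N (lab x) (lab y) \<Longrightarrow> (x, y) \<in> r"
  by (auto simp: r_def G_def)

lemma rel_le: "(x, y) \<in> r \<Longrightarrow> x \<in> P \<and> y \<in> P \<and> x \<le> y"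
  using G_less by (auto simp: r_def dest: less_imp_le)

sublocale finite_order P r
proof
  show "finite P" by (simp add: P_def)
  show "(x, x) \<in> r" if "x \<in> P" for x using that by (auto simp: r_def)
  show "antisym r" using rel_le by (intro antisymI) (meson le_antisym)
  show "trans r"
  proof (rule transI)
    fix x y z assume "(x, y) \<in> r" "(y, z) \<in> r"
    then show "(x, z) \<in> r" unfolding r_def by (auto dest: trancl_trans)
  qed
qed

text \<open>The pairing is 1 just before x and just before y, so from x up to y the neighbours
  number twice the occurrences of j. As x itself is an occurrence, some neighbour z lies between,
  and x < z < y in the heap.\<close>

lemma equal_labels_chain:
  assumes "x \<in> P" "y \<in> P" "x < y" "lab x = j" "lab y = j"
  shows "(x, y) \<in> r"
proof -
  have "{1..<y} = {1..<x} \<union> {x..<y}" using assms by (auto simp: P_def)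
  then have "occurrences lab j {1..<y} = occurrences lab j {1..<x} + occurrences lab j {x..<y}"
    and "neighbours N lab j {1..<y} = neighbours N lab j {1..<x} + neighbours N lab j {x..<y}"
    by (simp_all add: ivl_disj_int occurrences_Un neighbours_Un)
  then have "real (neighbours N lab j {x..<y}) = 2 * real (occurrences lab j {x..<y})"
    using step[OF assms(1)] step[OF assms(2)] assms(4,5) by (simp add: pairing_def)
  moreover have "x \<in> {z\<in>{x..<y}. lab z = j}" using assms by auto
  then have "occurrences lab j {x..<y} > 0" unfolding occurrences_def by (subst card_gt_0_iff) auto
  ultimately have "neighbours N lab j {x..<y} > 0" by linarith
  then have "{z\<in>{x..<y}. N (lab z) j} \<noteq> {}" unfolding neighbours_def by (metis card.empty less_irrefl)
  then obtain z where z: "x \<le> z" "z < y" "N (lab z) j" by auto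
  then have "x \<noteq> z" using assms(4) N_irrefl by auto
  then have "x < z" "z \<in> P" using z assms by (auto simp: P_def)
  then have "(x, z) \<in> r" "(z, y) \<in> r"
    using z assms N_sym by (auto intro!: less_imp_rel)
  then show ?thesis using trans_r by (meson transD)
qed

section \<open>Removable and addable elements for a fixed ideal and label\<close>

context
  fixes I j assumes I: "I \<in> order_ideals P r" and j: "j \<in> L"
begin

lemma I_subset: "I \<subseteq> P" and I_down: "y \<in> I \<Longrightarrow> (x, y) \<in> r \<Longrightarrow> x \<in> I"
  using I rel_le by (auto simp: order_ideals_def)

lemma finite_I: "finite I"
  using I_subset finite_P finite_subset by blast

text \<open>Let x be the last element of label j in \<open>I\<close>. Whatever precedes x and has
  label j or a label adjacent to j is below x, hence in \<open>I\<close>. So, as far as j is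
  concerned, \<open>I\<close> is the prefix before x together with x and A neighbours after x: the
  pairing is 1 - 2 + A. Other elements of label j lie below x, and x is maximal exactly when A =
  0.\<close>

lemma removable_count:
  assumes "{x\<in>I. lab x = j} \<noteq> {}"
  shows "\<exists>A::nat. pairing j I = real A - 1 \<and>
    card {x\<in>minimal_elements (r\<inverse>) I. lab x = j} = (if A = 0 then 1 else 0)"
proof -
  define x where "x = Max {x\<in>I. lab x = j}"
  have "x \<in> {x\<in>I. lab x = j}" unfolding x_def by (rule Max_in) (use assms finite_I in auto)
  then have x: "x \<in> I" "lab x = j" by auto
  then have xP: "x \<in> P" using I_subset by auto
  have max: "y \<le> x" if "y \<in> I" "lab y = j" for y
    unfolding x_def by (rule Max_ge) (use that finite_I in auto)
  define A where "A = neighbours N lab j {z\<in>I. x < z}"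
  have split: "I = (I \<inter> {1..<x}) \<union> ({x} \<union> {z\<in>I. x < z})" using x I_subset by (auto simp: P_def)
  have "{y\<in>{z\<in>I. x < z}. lab y = j} = {}" using max by fastforce
  then have "occurrences lab j {z\<in>I. x < z} = 0" unfolding occurrences_def by (simp only: card.empty)
  moreover have "occurrences lab j {x} = 1"
  proof -
    have "{y\<in>{x}. lab y = j} = {x}" using x by auto
    then show ?thesis by (simp add: occurrences_def)
  qed
  moreover have "occurrences lab j (I \<inter> {1..<x}) = occurrences lab j {1..<x}"
  proof -
    have "y \<in> I" if "y \<in> {1..<x}" "lab y = j" for y
      using equal_labels_chain[of y x j] that x xP I_down[OF x(1), of y] by (auto simp: P_def)
    then have "{y\<in>I \<inter> {1..<x}. lab y = j} = {y\<in>{1..<x}. lab y = j}" by blast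
    then show ?thesis by (simp only: occurrences_def)
  qed
  ultimately have oc: "occurrences lab j I = occurrences lab j {1..<x} + 1"
    by (subst split, subst occurrences_Un, use finite_I in auto, subst occurrences_Un[of "{x}", simplified]) (use finite_I in auto)
  have "neighbours N lab j {x} = 0" using x N_irrefl by (simp add: neighbours_def)
  moreover have "neighbours N lab j (I \<inter> {1..<x}) = neighbours N lab j {1..<x}"
  proof -
    have "y \<in> I" if "y \<in> {1..<x}" "N (lab y) j" for y
      using less_imp_rel[of y x] that x xP I_down[OF x(1), of y] by (auto simp: P_def)
    then have "{y\<in>I \<inter> {1..<x}. N (lab y) j} = {y\<in>{1..<x}. N (lab y) j}" by blast
    then show ?thesis by (simp only: neighbours_def)
  qed
  ultimately have nb: "neighbours N lab j I = neighbours N lab j {1..<x} + A"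
    by (subst split, subst neighbours_Un, use finite_I in auto, subst neighbours_Un[of "{x}", simplified]) (use finite_I A_def in auto)
  have "pairing j I = real A - 1"
    using step[OF xP] oc nb x(2) by (simp add: pairing_def)
  moreover have "{y\<in>minimal_elements (r\<inverse>) I. lab y = j} = (if A = 0 then {x} else {})"
  proof -
    have sub: "y = x" if y: "y \<in> minimal_elements (r\<inverse>) I" "lab y = j" for y
    proof (rule ccontr)
      assume "y \<noteq> x"
      then have yI: "y \<in> I" "y < x" using max[of y] y by (auto simp: minimal_elements_def)
      then have "(y, x) \<in> r" using equal_labels_chain[of y x j] x xP y I_subset by auto
      then show False using y x(1) yI by (auto simp: minimal_elements_def)
    qed
    have "x \<in> minimal_elements (r\<inverse>) I \<longleftrightarrow> A = 0"
    proof
      assume xm: "x \<in> minimal_elements (r\<inverse>) I"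
      have "False" if "z \<in> I" "x < z" "N (lab z) j" for z
        using less_imp_rel[of x z] that x xP N_sym xm I_subset by (auto simp: minimal_elements_def)
      then have "{z\<in>{z\<in>I. x < z}. N (lab z) j} = {}" by blast
      then show "A = 0" unfolding A_def neighbours_def by (simp only: card.empty)
    next
      assume "A = 0"
      then have none: "\<not> N (lab z) j" if "z \<in> I" "x < z" for z
        using that finite_I by (auto simp: A_def neighbours_def)
      \<comment> \<open>A chain upwards from x starts with a generating relation, whose target is a
        neighbour of j; being below y it lies in \<open>I\<close>.\<close>
      have "y = x" if y: "y \<in> I" "(x, y) \<in> r" for y
      proof (rule ccontr)
        assume "y \<noteq> x"
        then have "(x, y) \<in> G\<^sup>+" using y by (auto simp: r_def)
        then obtain z where z: "(x, z) \<in> G" "(z, y) \<in> G\<^sup>*" by (meson tranclD)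
        moreover have "y \<in> P" using y I_subset by auto
        ultimately have "(z, y) \<in> r" unfolding r_def by (auto dest: rtranclD)
        then have "z \<in> I" using I_down[OF y(1)] by blast
        then show False using none z(1) x(2) N_sym by (auto simp: G_def)
      qed
      then show "x \<in> minimal_elements (r\<inverse>) I" using x by (auto simp: minimal_elements_def)
    qed
    then show ?thesis using sub x(2) by auto
  qed
  ultimately show ?thesis by (intro exI[of _ A]) auto
qed

text \<open>Dual to \<open>removable_count\<close>, with y the first element of label j outside
  \<open>I\<close>. Elements of \<open>I\<close> with label j or adjacent to j precede y, as
  otherwise y would be below them and in \<open>I\<close>. So, as far as j is concerned, the prefix
  before y exceeds \<open>I\<close> by B neighbours, and its pairing 1 is that of \<open>I\<close>
  plus B.\<close>

lemma addable_count:
  assumes "{x\<in>P - I. lab x = j} \<noteq> {}"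
  shows "\<exists>B::nat. pairing j I = 1 - real B \<and>
    card {x\<in>minimal_elements r (P - I). lab x = j} = (if B = 0 then 1 else 0)"
proof -
  have fin: "finite {x\<in>P - I. lab x = j}" by (rule finite_subset[OF _ finite_P]) auto
  define y where "y = Min {x\<in>P - I. lab x = j}"
  have "y \<in> {x\<in>P - I. lab x = j}" unfolding y_def by (rule Min_in) (use assms fin in auto)
  then have y: "y \<in> P" "y \<notin> I" "lab y = j" by auto
  have min: "y \<le> x" if "x \<in> P" "x \<notin> I" "lab x = j" for x
    unfolding y_def by (rule Min_le) (use that fin in auto)
  define B where "B = neighbours N lab j ({1..<y} - I)"
  have split: "{1..<y} = (I \<inter> {1..<y}) \<union> ({1..<y} - I)" by auto
  have lt: "z < y" if "z \<in> I" "lab z = j \<or> N (lab z) j" for z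
  proof (rule ccontr)
    assume "\<not> z < y"
    then have "y < z" using that y by (cases "z = y") auto
    then have "(y, z) \<in> r"
      using that equal_labels_chain[of y z j] less_imp_rel[of y z] y I_subset N_sym by auto
    then show False using I_down that y by blast
  qed
  have "occurrences lab j ({1..<y} - I) = 0"
    using min y(1) by (fastforce simp: occurrences_def P_def)
  moreover have "occurrences lab j (I \<inter> {1..<y}) = occurrences lab j I"
  proof -
    have "{z\<in>I \<inter> {1..<y}. lab z = j} = {z\<in>I. lab z = j}" using lt I_subset by (auto simp: P_def)
    then show ?thesis by (simp only: occurrences_def)
  qed
  ultimately have oc: "occurrences lab j {1..<y} = occurrences lab j I"
    by (subst split, subst occurrences_Un) auto
  have "neighbours N lab j (I \<inter> {1..<y}) = neighbours N lab j I"
  proof -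
    have "{z\<in>I \<inter> {1..<y}. N (lab z) j} = {z\<in>I. N (lab z) j}" using lt I_subset by (auto simp: P_def)
    then show ?thesis by (simp only: neighbours_def)
  qed
  then have nb: "neighbours N lab j {1..<y} = neighbours N lab j I + B"
    by (subst split, subst neighbours_Un) (auto simp: B_def)
  have "pairing j I = 1 - real B"
    using step[OF y(1)] oc nb y(3) by (simp add: pairing_def)
  moreover have "{x\<in>minimal_elements r (P - I). lab x = j} = (if B = 0 then {y} else {})"
  proof -
    have sub: "x = y" if x: "x \<in> minimal_elements r (P - I)" "lab x = j" for x
    proof (rule ccontr)
      assume "x \<noteq> y"
      then have xP: "x \<in> P" "y < x" using min[of x] x by (auto simp: minimal_elements_def)
      then have "(y, x) \<in> r" using equal_labels_chain[of y x j] y x by auto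
      then show False using x y xP by (auto simp: minimal_elements_def)
    qed
    have "y \<in> minimal_elements r (P - I) \<longleftrightarrow> B = 0"
    proof
      assume ym: "y \<in> minimal_elements r (P - I)"
      have "False" if "z \<in> {1..<y} - I" "N (lab z) j" for z
        using less_imp_rel[of z y] that y ym by (auto simp: minimal_elements_def P_def)
      then have "{z\<in>{1..<y} - I. N (lab z) j} = {}" by blast
      then show "B = 0" unfolding B_def neighbours_def by (simp only: card.empty)
    next
      assume "B = 0"
      then have none: "\<not> N (lab z) j" if "z \<in> {1..<y} - I" for z
        using that by (auto simp: B_def neighbours_def)
      have "x = y" if x: "x \<in> P - I" "(x, y) \<in> r" for x
      proof (rule ccontr)
        assume "x \<noteq> y"
        then have "(x, y) \<in> G\<^sup>+" using x by (auto simp: r_def)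
        then obtain z where z: "(x, z) \<in> G\<^sup>*" "(z, y) \<in> G" by (meson tranclD2)
        then have "(x, z) \<in> r" using x(1) unfolding r_def by (auto dest: rtranclD)
        then have "z \<notin> I" using I_down x by blast
        then show False using none[of z] z(2) y(3) by (auto simp: G_def P_def)
      qed
      then show "y \<in> minimal_elements r (P - I)" using y by (auto simp: minimal_elements_def)
    qed
    then show ?thesis using sub y(3) by auto
  qed
  ultimately show ?thesis by (intro exI[of _ B]) auto
qed

text \<open>If j occurs inside and outside \<open>I\<close>, the two counts give A - 1 = 1 - B, so A
  + B = 2 and each of the values -1, 0, 1 fits. If j is absent on one side, the inequality from
  \<open>start\<close> or \<open>final\<close> takes the place of the missing count and leaves only
  the values that fit.\<close>

lemma pairing_ideal:
  "pairing j I = real (card {x\<in>minimal_elements r (P - I). lab x = j})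
    - real (card {x\<in>minimal_elements (r\<inverse>) I. lab x = j})"
proof -
  have rem: "pairing j I \<ge> 0 \<and> card {x\<in>minimal_elements (r\<inverse>) I. lab x = j} = 0"
    if "{x\<in>I. lab x = j} = {}"
  proof -
    have "{x\<in>minimal_elements (r\<inverse>) I. lab x = j} = {}"
      using that by (auto simp: minimal_elements_def)
    moreover have "occurrences lab j I = 0" unfolding occurrences_def that by simp
    then have "pairing j I \<ge> 0"
      using start[OF j] by (simp add: pairing_def occurrences_def neighbours_def)
    ultimately show ?thesis by (metis card.empty)
  qed
  have add: "pairing j I \<le> 0 \<and> card {x\<in>minimal_elements r (P - I). lab x = j} = 0"
    if "{x\<in>P - I. lab x = j} = {}"
  proof -
    have no_add: "{x\<in>minimal_elements r (P - I). lab x = j} = {}"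
      using that by (auto simp: minimal_elements_def)
    have "{x\<in>I. lab x = j} = {x\<in>P. lab x = j}" using that I_subset by auto
    \<comment> \<open>Passing from \<open>I\<close> to \<open>P\<close> adds neighbours but no
      element of label j, so the pairing of \<open>I\<close> is at most that of
      \<open>P\<close>.\<close>
    moreover have "neighbours N lab j I \<le> neighbours N lab j P"
      unfolding neighbours_def using I_subset finite_P by (intro card_mono) auto
    ultimately have "pairing j I \<le> 0"
      using final[OF j] by (simp add: pairing_def occurrences_def)
    with no_add show ?thesis by (metis card.empty)
  qed
  show ?thesis
    using rem add removable_count addable_count
    by (cases "{x\<in>I. lab x = j} = {}"; cases "{x\<in>P - I. lab x = j} = {}") (auto split: if_splits)
qed

end

end

section \<open>Simply laced root systems\<close>

locale simply_laced_setting = cartan_setting H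
  for H :: "'g :: complex_lie_algebra set" +
  fixes t :: nat and \<alpha> :: "nat \<Rightarrow> 'g \<Rightarrow> complex" and \<Omega> :: real
  assumes simple_roots: "simple_roots H t \<alpha>"
    and root_length: "\<And>\<beta>. \<beta> \<in> roots H \<Longrightarrow> root_length H \<beta> = \<Omega>"
begin

section \<open>Reflections and Cartan integers for roots of one length\<close>

abbreviation "V \<equiv> real_dual H"

definition pair :: "('g \<Rightarrow> complex) \<Rightarrow> nat \<Rightarrow> real" where
  "pair \<mu> i = ip H \<mu> (coroot H (\<alpha> i))"

text \<open>An unrestricted copy of \<open>simple_reflection\<close>, which is
  \<open>undefined\<close> outside its carrier; the two agree on \<open>V\<close>.\<close>

definition refl :: "nat \<Rightarrow> ('g \<Rightarrow> complex) \<Rightarrow> ('g \<Rightarrow> complex)" where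
  "refl i \<mu> = \<mu> - rscale (pair \<mu> i) (\<alpha> i)"

lemma norm_root: "\<beta> \<in> roots H \<Longrightarrow> ip H \<beta> \<beta> = \<Omega>\<^sup>2"
  using root_length[of \<beta>] ip_root_pos[of \<beta>] unfolding root_length_def by (metis less_imp_le real_sqrt_pow2)

lemma simple_root: "i \<in> {1..t} \<Longrightarrow> \<alpha> i \<in> roots H"
  using simple_roots unfolding simple_roots_def by blast

lemma inj_simple: "inj_on \<alpha> {1..t}"
  using simple_roots by (simp add: simple_roots_def)

lemma simple_in_V: "i \<in> {1..t} \<Longrightarrow> \<alpha> i \<in> V"
  by (intro real_dual_closed simple_root)

lemma \<Omega>_pos: "i \<in> {1..t} \<Longrightarrow> \<Omega>\<^sup>2 > 0"
  using ip_root_pos norm_root simple_root by metis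

text \<open>Equal root lengths make the factor independent of i, which is why pairings between
  simple roots are symmetric.\<close>

lemma pair_eq: "\<mu> \<in> V \<Longrightarrow> i \<in> {1..t} \<Longrightarrow> pair \<mu> i = 2 / \<Omega>\<^sup>2 * ip H \<mu> (\<alpha> i)"
  by (simp add: pair_def coroot_def norm_root[OF simple_root] ip_right(3)[OF simple_in_V simple_in_V])

lemma pair_linear:
  assumes "i \<in> {1..t}" "\<mu> \<in> V" "\<nu> \<in> V"
  shows "pair (\<mu> + \<nu>) i = pair \<mu> i + pair \<nu> i" "pair (\<mu> - \<nu>) i = pair \<mu> i - pair \<nu> i"
    "pair (rscale c \<mu>) i = c * pair \<mu> i" "pair (- \<mu>) i = - pair \<mu> i"
  using assms by (simp_all add: pair_eq real_dual_closed ip_add_left ip_diff_left ip_minus_left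
      ip_rscale_left simple_in_V algebra_simps)

lemma pair_sum:
  "i \<in> {1..t} \<Longrightarrow> (\<And>x. x \<in> A \<Longrightarrow> g x \<in> V) \<Longrightarrow> pair (\<Sum>x\<in>A. g x) i = (\<Sum>x\<in>A. pair (g x) i)"
  by (simp add: pair_eq real_dual_closed ip_sum_left simple_in_V sum_distrib_left)

lemma pair_self: "i \<in> {1..t} \<Longrightarrow> pair (\<alpha> i) i = 2"
  using pair_eq[OF simple_in_V] norm_root[OF simple_root] \<Omega>_pos by simp

lemma refl_in_V: "i \<in> {1..t} \<Longrightarrow> \<mu> \<in> V \<Longrightarrow> refl i \<mu> \<in> V"
  by (simp add: refl_def real_dual_closed simple_in_V)

lemma pair_refl: "i \<in> {1..t} \<Longrightarrow> \<mu> \<in> V \<Longrightarrow> pair (refl i \<mu>) i = - pair \<mu> i"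
  by (simp add: refl_def pair_linear pair_self simple_in_V real_dual_closed)

lemma refl_refl: "i \<in> {1..t} \<Longrightarrow> \<mu> \<in> V \<Longrightarrow> refl i (refl i \<mu>) = \<mu>"
  by (subst refl_def, subst pair_refl, assumption+) (simp add: refl_def rscale_def fun_eq_iff)

lemma ip_refl:
  assumes "i \<in> {1..t}" "\<mu> \<in> V" "\<nu> \<in> V"
  shows "ip H (refl i \<mu>) (refl i \<nu>) = ip H \<mu> \<nu>"
proof -
  note S = simple_in_V[OF assms(1)]
  have m: "ip H \<mu> (\<alpha> i) = pair \<mu> i * \<Omega>\<^sup>2 / 2" "ip H \<nu> (\<alpha> i) = pair \<nu> i * \<Omega>\<^sup>2 / 2"
    using assms \<Omega>_pos[OF assms(1)] by (simp_all add: pair_eq)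
  have "ip H (refl i \<mu>) (refl i \<nu>)
      = ip H \<mu> \<nu> - pair \<nu> i * ip H \<mu> (\<alpha> i) - pair \<mu> i * (ip H \<nu> (\<alpha> i) - pair \<nu> i * \<Omega>\<^sup>2)"
    using assms S norm_root[OF simple_root[OF assms(1)]]
    by (simp add: refl_def ip_diff_left ip_right ip_rscale_left real_dual_closed ip_commute[of "\<alpha> i" \<nu>] algebra_simps)
  also have "\<dots> = ip H \<mu> \<nu>" unfolding m by (simp add: field_simps)
  finally show ?thesis .
qed

text \<open>Expand the norm: adding or subtracting \<alpha> i changes it by \<Omega>^2 plus or minus
  twice the product of \<mu> with \<alpha> i, so equality fixes that product.\<close>

lemma pair_of_equal_norm:
  assumes "i \<in> {1..t}" "\<mu> \<in> V"
  shows "ip H (\<mu> - \<alpha> i) (\<mu> - \<alpha> i) = ip H \<mu> \<mu> \<Longrightarrow> pair \<mu> i = 1"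
    and "ip H (\<mu> + \<alpha> i) (\<mu> + \<alpha> i) = ip H \<mu> \<mu> \<Longrightarrow> pair \<mu> i = -1"
  using assms \<Omega>_pos[OF assms(1)] simple_in_V[OF assms(1)] norm_root[OF simple_root[OF assms(1)]]
  by (simp_all add: pair_eq real_dual_closed ip_diff_left ip_add_left ip_right ip_commute[of "\<alpha> i" \<mu>] field_simps)

lemma rscale_pm1: "rscale 1 \<mu> = \<mu>" "rscale (-1) \<mu> = - \<mu>" "rscale 0 \<mu> = 0"
  by (auto simp: rscale_def)

lemma pair_pos_iff:
  assumes "i \<in> {1..t}" "\<mu> \<in> V"
  shows "ip H \<mu> (\<alpha> i) > 0 \<longleftrightarrow> pair \<mu> i > 0" "ip H \<mu> (\<alpha> i) < 0 \<longleftrightarrow> pair \<mu> i < 0"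
  using \<Omega>_pos[OF assms(1)] assms by (simp_all add: pair_eq zero_less_divide_iff divide_less_0_iff zero_less_mult_iff mult_less_0_iff)

text \<open>Weights of constant norm have Cartan integers in \<open>{-1, 0, 1}\<close>: moving by one root along the
  string already preserves the norm. Both the minuscule weights and, in simply laced type, the
  roots are handled this way, without any integrality statement.\<close>

lemma weight_step:
  fixes \<pi> :: "'g \<Rightarrow> 'v :: complex_vector \<Rightarrow> 'v"
  assumes \<pi>: "lie_representation \<pi>" "finite_dimensional TYPE('v)"
    and i: "i \<in> {1..t}" and \<mu>: "\<mu> \<in> weights H \<pi>" "\<mu> \<in> V"
    and norm: "\<And>\<nu>. \<nu> \<in> {\<mu> - \<alpha> i, \<mu> + \<alpha> i} \<Longrightarrow> \<nu> \<in> weights H \<pi> \<Longrightarrow> ip H \<nu> \<nu> = ip H \<mu> \<mu>"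
  shows "pair \<mu> i \<in> {-1, 0, 1}" "refl i \<mu> \<in> weights H \<pi>"
proof -
  consider "pair \<mu> i > 0" | "pair \<mu> i = 0" | "pair \<mu> i < 0" by linarith
  then have "pair \<mu> i \<in> {-1, 0, 1} \<and> refl i \<mu> \<in> weights H \<pi>"
  proof cases
    case 1
    then have w: "\<mu> - \<alpha> i \<in> weights H \<pi>"
      using weight_diff_root[OF \<pi> simple_root[OF i] \<mu>] pair_pos_iff[OF i \<mu>(2)] by blast
    then have "pair \<mu> i = 1" using pair_of_equal_norm(1)[OF i \<mu>(2)] norm by blast
    then show ?thesis using w by (simp add: refl_def rscale_pm1)
  next
    case 2
    then show ?thesis using \<mu> by (simp add: refl_def rscale_pm1)
  next
    case 3
    then have w: "\<mu> + \<alpha> i \<in> weights H \<pi>"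
      using weight_add_root[OF \<pi> simple_root[OF i] \<mu>] pair_pos_iff[OF i \<mu>(2)] by blast
    then have "pair \<mu> i = -1" using pair_of_equal_norm(2)[OF i \<mu>(2)] norm by blast
    then show ?thesis using w by (simp add: refl_def rscale_pm1)
  qed
  then show "pair \<mu> i \<in> {-1, 0, 1}" "refl i \<mu> \<in> weights H \<pi>" by auto
qed

text \<open>The adjoint representation also has weight 0, whose norm differs from that of the roots.
  Excluding \<alpha> i and its negative keeps the adjacent members of the string away from 0, so
  \<open>weight_step\<close> applies.\<close>

lemma root_step:
  assumes i: "i \<in> {1..t}" and \<beta>: "\<beta> \<in> roots H" "\<beta> \<noteq> \<alpha> i" "\<beta> \<noteq> - \<alpha> i"
  shows "pair \<beta> i \<in> {-1, 0, 1}" "refl i \<beta> \<in> weights H bracket"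
proof -
  have "\<beta> - \<alpha> i \<noteq> 0" "\<beta> + \<alpha> i \<noteq> 0" using \<beta> by (auto simp: eq_neg_iff_add_eq_0)
  then have "ip H \<nu> \<nu> = ip H \<beta> \<beta>" if "\<nu> \<in> {\<beta> - \<alpha> i, \<beta> + \<alpha> i}" "\<nu> \<in> weights H bracket" for \<nu>
    using that norm_root[OF \<beta>(1)] norm_root[of \<nu>] rootsI[of \<nu>] by auto
  then show "pair \<beta> i \<in> {-1, 0, 1}" "refl i \<beta> \<in> weights H bracket"
    using weight_step[OF lie_representation_bracket fin_dim i, of \<beta>] \<beta>(1) real_dual_closed(7)
    by (auto simp: roots_def)
qed

lemma refl_simple: "i \<in> {1..t} \<Longrightarrow> refl i (\<alpha> i) = - \<alpha> i"
  using pair_self[of i] by (simp add: refl_def rscale_def fun_eq_iff)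

lemma refl_neg: "i \<in> {1..t} \<Longrightarrow> \<mu> \<in> V \<Longrightarrow> refl i (- \<mu>) = - refl i \<mu>"
  using pair_linear(4)[of i \<mu> 0] real_dual_closed(1) by (simp add: refl_def rscale_def fun_eq_iff)

lemma refl_root:
  assumes i: "i \<in> {1..t}" and \<beta>: "\<beta> \<in> roots H"
  shows "refl i \<beta> \<in> roots H"
proof (cases "\<beta> = \<alpha> i \<or> \<beta> = - \<alpha> i")
  case True
  then show ?thesis
    using refl_simple[OF i] refl_neg[OF i simple_in_V[OF i]] simple_root[OF i] uminus_root by auto
next
  case False
  have "refl i \<beta> \<noteq> 0"
  proof
    assume "refl i \<beta> = 0"
    then have "ip H \<beta> \<beta> = 0"
      using ip_refl[OF i, of \<beta> \<beta>] real_dual_closed(1,7) \<beta> ip_zero_left by metis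
    then show False using ip_root_pos[OF \<beta>] by simp
  qed
  then show ?thesis using root_step(2)[OF i \<beta>] False rootsI by blast
qed

subsection \<open>Positive roots\<close>

definition comb :: "(nat \<Rightarrow> real) \<Rightarrow> 'g \<Rightarrow> complex" where
  "comb c = (\<Sum>i=1..t. rscale (c i) (\<alpha> i))"

lemma comb_arith:
  "comb c - comb d = comb (\<lambda>i. c i - d i)" "- comb c = comb (\<lambda>i. - c i)"
  "i \<in> {1..t} \<Longrightarrow> rscale k (\<alpha> i) = comb (\<lambda>j. if j = i then k else 0)"
proof -
  have "rscale (a - b) x = rscale a x - rscale b x" "rscale (- a) x = - rscale a x" for a b and x :: "'g \<Rightarrow> complex"
    by (simp_all add: rscale_def fun_eq_iff algebra_simps)
  then show "comb c - comb d = comb (\<lambda>i. c i - d i)" "- comb c = comb (\<lambda>i. - c i)"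
    by (simp_all add: comb_def sum_subtractf sum_negf)
  assume i: "i \<in> {1..t}"
  have "comb (\<lambda>j. if j = i then k else 0) = (\<Sum>j=1..t. if j = i then rscale k (\<alpha> i) else 0)"
    unfolding comb_def by (intro sum.cong) (auto simp: rscale_pm1)
  also have "\<dots> = rscale k (\<alpha> i)" using i by (subst sum.delta) auto
  finally show "rscale k (\<alpha> i) = comb (\<lambda>j. if j = i then k else 0)" by simp
qed

lemma comb_eq_0:
  assumes "comb c = 0" "i \<in> {1..t}"
  shows "c i = 0"
proof -
  have inj: "inj_on \<alpha> {1..t}" and ind: "functional.independent (\<alpha> ` {1..t})"
    using simple_roots unfolding simple_roots_def by auto
  let ?u = "\<lambda>v. c (inv_into {1..t} \<alpha> v)"
  have "(\<Sum>v\<in>\<alpha> ` {1..t}. rscale (?u v) v) = comb c"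
    unfolding comb_def using inj by (subst sum.reindex) (auto intro!: sum.cong)
  then have "?u (\<alpha> i) = 0"
    using functional.independentD[OF ind _ order_refl, of ?u "\<alpha> i"] assms by auto
  then show ?thesis using inj assms(2) by simp
qed

lemma comb_inject: "comb c = comb d \<Longrightarrow> i \<in> {1..t} \<Longrightarrow> c i = d i"
  using comb_eq_0[of "\<lambda>i. c i - d i" i] comb_arith(1)[of c d] by simp

lemma V_comb:
  assumes "\<mu> \<in> V"
  obtains c where "\<mu> = comb c"
proof -
  have inj: "inj_on \<alpha> {1..t}" and "\<mu> \<in> functional.span (\<alpha> ` {1..t})"
    using simple_roots assms unfolding simple_roots_def by auto
  then obtain u where "\<mu> = (\<Sum>v\<in>\<alpha> ` {1..t}. rscale (u v) v)"
    by (auto simp: functional.span_finite)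
  then have "\<mu> = comb (u \<circ> \<alpha>)" using inj by (simp add: comb_def sum.reindex)
  then show ?thesis using that by blast
qed

abbreviation "pos \<equiv> positive_roots H t \<alpha>"

lemma pos_root: "\<beta> \<in> pos \<Longrightarrow> \<beta> \<in> roots H"
  by (simp add: positive_roots_def)

lemma pos_comb:
  assumes "\<beta> \<in> pos"
  obtains c where "\<beta> = comb c" "\<And>i. c i \<ge> 0"
proof -
  obtain c :: "nat \<Rightarrow> nat" where "\<beta> = comb (\<lambda>i. real (c i))"
    using assms unfolding positive_roots_def comb_def by auto
  then show ?thesis using that[of "\<lambda>i. real (c i)"] by simp
qed

lemma root_pos_or_neg:
  assumes "\<beta> \<in> roots H"
  shows "\<beta> \<in> pos \<or> - \<beta> \<in> pos"
proof -
  obtain c :: "nat \<Rightarrow> int" where c: "\<beta> = comb (\<lambda>i. real_of_int (c i))"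
    "(\<forall>i\<in>{1..t}. c i \<ge> 0) \<or> (\<forall>i\<in>{1..t}. c i \<le> 0)"
    using simple_roots assms unfolding simple_roots_def comb_def by blast
  show ?thesis
  proof (cases "\<forall>i\<in>{1..t}. c i \<ge> 0")
    case True
    then have "\<beta> = (\<Sum>i=1..t. rscale (of_nat (nat (c i))) (\<alpha> i))"
      unfolding c(1) comb_def by (intro sum.cong) auto
    then have "\<beta> \<in> pos" unfolding positive_roots_def
      by (intro CollectI conjI assms exI[of _ "\<lambda>i. nat (c i)"])
    then show ?thesis ..
  next
    case False
    have "- \<beta> = comb (\<lambda>i. - real_of_int (c i))" unfolding c(1) by (rule comb_arith(2))
    also have "\<dots> = (\<Sum>i=1..t. rscale (of_nat (nat (- c i))) (\<alpha> i))"
      using False c(2) unfolding comb_def by (intro sum.cong) auto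
    finally have "- \<beta> = (\<Sum>i=1..t. rscale (of_nat (nat (- c i))) (\<alpha> i))" .
    then have "- \<beta> \<in> pos" unfolding positive_roots_def
      by (intro CollectI conjI uminus_root[OF assms] exI[of _ "\<lambda>i. nat (- c i)"])
    then show ?thesis ..
  qed
qed

lemma pos_not_neg:
  assumes "\<beta> \<in> pos" "- \<beta> \<in> pos"
  shows False
proof -
  obtain c where c: "\<beta> = comb c" "\<And>i. c i \<ge> 0" using assms(1) by (rule pos_comb) blast
  obtain d where d: "- \<beta> = comb d" "\<And>i. d i \<ge> 0" using assms(2) by (rule pos_comb) blast
  have "comb (\<lambda>i. - c i) = comb d" using c(1) d(1) comb_arith(2) by metis
  from comb_inject[OF this] have "c i = 0" if "i \<in> {1..t}" for i
    using that c(2)[of i] d(2)[of i] by (smt (verit))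
  then have "\<beta> = 0" unfolding c(1) comb_def by (simp add: rscale_pm1)
  then show False using rootsD(2) pos_root assms(1) by blast
qed

lemma simple_pos: "i \<in> {1..t} \<Longrightarrow> \<alpha> i \<in> pos"
proof -
  assume i: "i \<in> {1..t}"
  have "\<alpha> i = comb (\<lambda>j. if j = i then 1 else 0)"
    using comb_arith(3)[OF i, of 1] by (simp add: rscale_pm1)
  also have "\<dots> = (\<Sum>j=1..t. rscale (of_nat (if j = i then 1 else 0)) (\<alpha> j))"
    unfolding comb_def by (intro sum.cong) auto
  finally show ?thesis unfolding positive_roots_def
    by (intro CollectI conjI simple_root[OF i] exI[of _ "\<lambda>j. if j = i then 1 else 0"])
qed

text \<open>The reflection changes only the coefficient of \<alpha> i. If the image were negative,
  all other coefficients would vanish and \<beta> would be a nonnegative multiple of \<alpha> i;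
  equal norms then force \<beta> = \<alpha> i.\<close>

lemma refl_pos:
  assumes i: "i \<in> {1..t}" and \<beta>: "\<beta> \<in> pos" "\<beta> \<noteq> \<alpha> i"
  shows "refl i \<beta> \<in> pos"
proof (rule ccontr)
  assume "refl i \<beta> \<notin> pos"
  then have "- refl i \<beta> \<in> pos" using root_pos_or_neg refl_root[OF i pos_root[OF \<beta>(1)]] by blast
  then obtain d where d: "- refl i \<beta> = comb d" "\<And>i. d i \<ge> 0" by (rule pos_comb) blast
  obtain c where c: "\<beta> = comb c" "\<And>i. c i \<ge> 0" using \<beta>(1) by (rule pos_comb) blast
  have "refl i \<beta> = comb (\<lambda>j. c j - (if j = i then pair \<beta> i else 0))"
    unfolding refl_def comb_arith(3)[OF i] by (simp only: c(1) comb_arith(1))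
  moreover have "refl i \<beta> = comb (\<lambda>j. - d j)" using d(1) comb_arith(2) by (metis minus_minus)
  ultimately have eq: "comb (\<lambda>j. c j - (if j = i then pair \<beta> i else 0)) = comb (\<lambda>j. - d j)" by simp
  have "c j = 0" if "j \<in> {1..t}" "j \<noteq> i" for j
    using comb_inject[OF eq that(1)] that(2) c(2)[of j] d(2)[of j] by simp
  then have "\<beta> = comb (\<lambda>j. if j = i then c i else 0)" unfolding c(1) comb_def
    by (intro sum.cong refl) (simp split: if_split)
  then have \<beta>i: "\<beta> = rscale (c i) (\<alpha> i)" using comb_arith(3)[OF i] by simp
  have "(c i)\<^sup>2 * \<Omega>\<^sup>2 = \<Omega>\<^sup>2"
    using norm_root[OF pos_root[OF \<beta>(1)]] norm_root[OF simple_root[OF i]] simple_in_V[OF i]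
    unfolding \<beta>i by (simp add: ip_rscale_left ip_right real_dual_closed power2_eq_square)
  then have "(c i)\<^sup>2 = 1" using \<Omega>_pos[OF i] by simp
  then have "c i = 1" using c(2)[of i] by (simp add: power2_eq_1_iff)
  then show False using \<beta>i \<beta>(2) rscale_pm1 by simp
qed

text \<open>Pairing 1 would make both \<open>\<alpha> i - \<alpha> j\<close> and its negative
  positive, as reflected simple roots. \<open>root_step\<close> then leaves -1 and 0.\<close>

lemma pair_simple:
  assumes "i \<in> {1..t}" "j \<in> {1..t}" "i \<noteq> j"
  shows "pair (\<alpha> i) j \<in> {-1, 0}"
proof -
  have ne: "\<alpha> i \<noteq> \<alpha> j" using inj_on_eq_iff[OF inj_simple assms(1,2)] assms(3) by simp
  have ne': "\<alpha> i \<noteq> - \<alpha> j"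
    using pos_not_neg[OF simple_pos[OF assms(2)]] simple_pos[OF assms(1)] by auto
  have "pair (\<alpha> i) j \<noteq> 1"
  proof
    assume "pair (\<alpha> i) j = 1"
    then have "refl j (\<alpha> i) = \<alpha> i - \<alpha> j" by (simp add: refl_def rscale_pm1)
    then have "\<alpha> i - \<alpha> j \<in> pos" using refl_pos[OF assms(2) simple_pos[OF assms(1)] ne] by simp
    moreover have "- refl i (\<alpha> j) \<in> pos" if "\<alpha> i - \<alpha> j \<in> pos" 
    proof -
      have "pair (\<alpha> j) i = 1"
        using \<open>pair (\<alpha> i) j = 1\<close> pair_eq[OF simple_in_V[OF assms(1)] assms(2)]
          pair_eq[OF simple_in_V[OF assms(2)] assms(1)] ip_commute[of "\<alpha> i" "\<alpha> j"] by metis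
      then show ?thesis using that by (simp add: refl_def rscale_pm1)
    qed
    ultimately show False
      using pos_not_neg[OF refl_pos[OF assms(1) simple_pos[OF assms(2)] ne[symmetric]]] by blast
  qed
  then show ?thesis using root_step(1)[OF assms(2) simple_root[OF assms(1)] ne ne'] by auto
qed

section \<open>The half-sum of the positive roots and the height\<close>

abbreviation "\<rho> \<equiv> half_sum_positive_roots H t \<alpha>"

lemma pos_in_V: "\<beta> \<in> pos \<Longrightarrow> \<beta> \<in> V"
  using pos_root real_dual_closed(7) by blast

lemma \<rho>_in_V: "\<rho> \<in> V"
  unfolding half_sum_positive_roots_def by (intro real_dual_closed(3,6) pos_in_V)

text \<open>The reflection permutes the positive roots other than \<alpha> i and negates their
  pairings with i, so these cancel and only \<alpha> i contributes.\<close>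

lemma pair_\<rho>:
  assumes i: "i \<in> {1..t}"
  shows "pair \<rho> i = 1"
proof -
  have fin: "finite pos" by (rule finite_subset[OF subsetI finite_roots]) (rule pos_root)
  let ?S = "pos - {\<alpha> i}"
  have maps: "refl i \<beta> \<in> ?S" if "\<beta> \<in> ?S" for \<beta>
  proof -
    have "refl i \<beta> \<noteq> \<alpha> i"
    proof
      assume "refl i \<beta> = \<alpha> i"
      then have "\<beta> = - \<alpha> i" using refl_refl[OF i pos_in_V, of \<beta>] that refl_simple[OF i] by auto
      then show False using pos_not_neg[of "\<alpha> i"] simple_pos[OF i] that by auto
    qed
    then show ?thesis using refl_pos[OF i] that by auto
  qed
  have "bij_betw (refl i) ?S ?S"
    by (rule bij_betw_byWitness[of _ "refl i"]) (use maps refl_refl[OF i pos_in_V] in auto)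
  from sum.reindex_bij_betw[OF this, of "\<lambda>\<beta>. pair \<beta> i"]
  have "(\<Sum>\<beta>\<in>?S. pair (refl i \<beta>) i) = (\<Sum>\<beta>\<in>?S. pair \<beta> i)" .
  moreover have "(\<Sum>\<beta>\<in>?S. pair (refl i \<beta>) i) = - (\<Sum>\<beta>\<in>?S. pair \<beta> i)"
    using pair_refl[OF i pos_in_V] by (simp add: sum_negf)
  ultimately have "(\<Sum>\<beta>\<in>?S. pair \<beta> i) = 0" by simp
  then have "(\<Sum>\<beta>\<in>pos. pair \<beta> i) = 2"
    using sum.remove[OF fin simple_pos[OF i], of "\<lambda>\<beta>. pair \<beta> i"] pair_self[OF i] by simp
  moreover have "(\<Sum>\<beta>\<in>pos. \<beta>) \<in> V" by (intro real_dual_closed(6) pos_in_V)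
  ultimately show ?thesis
    unfolding half_sum_positive_roots_def
    using pair_linear(3)[OF i _ real_dual_closed(1)] pair_sum[OF i pos_in_V, of pos "\<lambda>\<beta>. \<beta>"] by simp
qed

text \<open>The product with \<rho>, scaled so that each simple root gets value 1: the sum of the
  coefficients in the simple roots.\<close>

definition height :: "('g \<Rightarrow> complex) \<Rightarrow> real" where
  "height \<mu> = 2 * (ip H \<mu> \<rho> / \<Omega>\<^sup>2)"

lemma height_simple: "i \<in> {1..t} \<Longrightarrow> height (\<alpha> i) = 1"
  unfolding pair_\<rho>[of i, symmetric] pair_eq[OF \<rho>_in_V] height_def
  by (simp add: ip_commute[of _ \<rho>])

lemma height_diff: "\<mu> \<in> V \<Longrightarrow> \<nu> \<in> V \<Longrightarrow> height (\<mu> - \<nu>) = height \<mu> - height \<nu>"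
  by (simp add: height_def ip_diff_left \<rho>_in_V diff_divide_distrib)

lemma height_rscale: "\<mu> \<in> V \<Longrightarrow> height (rscale c \<mu>) = c * height \<mu>"
  by (simp add: height_def ip_rscale_left \<rho>_in_V)

lemma height_sum: "(\<And>x. x \<in> A \<Longrightarrow> g x \<in> V) \<Longrightarrow> height (\<Sum>x\<in>A. g x) = (\<Sum>x\<in>A. height (g x))"
  by (simp add: height_def ip_sum_left \<rho>_in_V sum_divide_distrib sum_distrib_left)

text \<open>\<rho> is a real combination of the simple roots. The coefficients \<open>d\<close> are
  what combines the coboundaries found for single labels into one for the cardinality.\<close>

lemma height_pair: "\<exists>d. \<forall>\<mu>\<in>V. height \<mu> = (\<Sum>j=1..t. d j * pair \<mu> j)"
proof -
  obtain d where d: "\<rho> = comb d" using \<rho>_in_V by (rule V_comb)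
  have "height \<mu> = (\<Sum>j=1..t. d j * pair \<mu> j)" if \<mu>: "\<mu> \<in> V" for \<mu>
  proof -
    have "ip H \<mu> \<rho> = (\<Sum>j=1..t. ip H \<mu> (rscale (d j) (\<alpha> j)))"
      unfolding d comb_def ip_commute[of \<mu>]
      by (rule ip_sum_left) (use \<mu> simple_in_V real_dual_closed(3) in auto)
    also have "\<dots> = (\<Sum>j=1..t. d j * ip H \<mu> (\<alpha> j))"
      by (intro sum.cong refl ip_right(3)[of _ 0]) (use \<mu> simple_in_V real_dual_closed(1) in auto)
    finally show ?thesis
      by (simp add: height_def pair_eq[OF \<mu>] sum_divide_distrib sum_distrib_left ac_simps)
  qed
  then show ?thesis by blast
qed


subsection \<open>Words in the simple reflections\<close>

definition act :: "nat list \<Rightarrow> ('g \<Rightarrow> complex) \<Rightarrow> ('g \<Rightarrow> complex)" where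
  "act ws \<mu> = fold refl ws \<mu>"

lemma act_simps [simp]: "act [] \<mu> = \<mu>" "act (i # ws) \<mu> = act ws (refl i \<mu>)"
  "act (us @ ws) \<mu> = act ws (act us \<mu>)"
  by (simp_all add: act_def)

abbreviation "word ws \<equiv> set ws \<subseteq> {1..t}"

lemma act_in_V: "word ws \<Longrightarrow> \<mu> \<in> V \<Longrightarrow> act ws \<mu> \<in> V"
  by (induction ws arbitrary: \<mu>) (auto simp: refl_in_V)

lemma ip_act: "word ws \<Longrightarrow> \<mu> \<in> V \<Longrightarrow> \<nu> \<in> V \<Longrightarrow> ip H (act ws \<mu>) (act ws \<nu>) = ip H \<mu> \<nu>"
  by (induction ws arbitrary: \<mu> \<nu>) (auto simp: refl_in_V ip_refl)

lemma act_rev: "word ws \<Longrightarrow> \<mu> \<in> V \<Longrightarrow> act ws (act (rev ws) \<mu>) = \<mu>"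
  by (induction ws) (auto simp: refl_refl act_in_V)

lemma ip_act_adjoint: "word ws \<Longrightarrow> \<mu> \<in> V \<Longrightarrow> \<nu> \<in> V \<Longrightarrow> ip H (act ws \<mu>) \<nu> = ip H \<mu> (act (rev ws) \<nu>)"
  using ip_act[of ws \<mu> "act (rev ws) \<nu>"] act_rev[of ws \<nu>] act_in_V[of "rev ws" \<nu>] by simp

lemma refl_diff_rscale:
  assumes "i \<in> {1..t}" "\<mu> \<in> V" "\<nu> \<in> V"
  shows "refl i (\<mu> - rscale c \<nu>) = refl i \<mu> - rscale c (refl i \<nu>)"
proof -
  have "pair (\<mu> - rscale c \<nu>) i = pair \<mu> i - c * pair \<nu> i"
    using assms by (simp add: pair_linear real_dual_closed)
  then show ?thesis unfolding refl_def by (simp only:) (simp add: rscale_def fun_eq_iff algebra_simps)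
qed

lemma act_diff_rscale:
  "word ws \<Longrightarrow> \<mu> \<in> V \<Longrightarrow> \<nu> \<in> V \<Longrightarrow> act ws (\<mu> - rscale c \<nu>) = act ws \<mu> - rscale c (act ws \<nu>)"
  by (induction ws arbitrary: \<mu> \<nu>) (auto simp: refl_diff_rscale refl_in_V)

lemma simple_reflection_eq: "\<mu> \<in> V \<Longrightarrow> simple_reflection H \<alpha> i \<mu> = refl i \<mu>"
  by (simp add: simple_reflection_def refl_def pair_def)

lemma simple_reflection_Bij: "i \<in> {1..t} \<Longrightarrow> simple_reflection H \<alpha> i \<in> Bij V"
  unfolding Bij_def
  by (auto intro!: bij_betw_byWitness[of _ "simple_reflection H \<alpha> i"]
      simp: simple_reflection_eq refl_in_V refl_refl) (simp add: simple_reflection_def)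

lemma carrier_Bij: "carrier (BijGroup V) = Bij V" by (simp add: BijGroup_def)

lemma mult_Bij: "f \<in> Bij V \<Longrightarrow> g \<in> Bij V \<Longrightarrow> f \<otimes>\<^bsub>BijGroup V\<^esub> g = compose V f g"
  by (simp add: BijGroup_def)

lemma mult_apply: "f \<in> Bij V \<Longrightarrow> g \<in> Bij V \<Longrightarrow> \<mu> \<in> V \<Longrightarrow> (f \<otimes>\<^bsub>BijGroup V\<^esub> g) \<mu> = f (g \<mu>)"
  by (simp add: mult_Bij compose_eq)

lemma word_element_Bij: "word ws \<Longrightarrow> word_element H \<alpha> ws \<in> Bij V"
proof (induction ws)
  case (Cons i ws)
  then show ?case
    using monoid.m_closed[OF group.is_monoid[OF group_BijGroup[of V]]] simple_reflection_Bij[of i]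
    by (simp add: carrier_Bij)
next
  case Nil
  then show ?case
    using monoid.one_closed[OF group.is_monoid[OF group_BijGroup[of V]]] by (simp add: carrier_Bij)
qed

lemma word_element_apply: "word ws \<Longrightarrow> \<mu> \<in> V \<Longrightarrow> word_element H \<alpha> ws \<mu> = act ws \<mu>"
proof (induction ws arbitrary: \<mu>)
  case (Cons i ws)
  then show ?case
    by (simp add: mult_apply word_element_Bij simple_reflection_Bij simple_reflection_eq refl_in_V)
qed (simp add: BijGroup_def)

lemma word_element_eqI:
  assumes "word ws" "f \<in> Bij V" "\<And>\<mu>. \<mu> \<in> V \<Longrightarrow> act ws \<mu> = f \<mu>"
  shows "word_element H \<alpha> ws = f"
proof (rule extensionalityI[of _ V])
  show "word_element H \<alpha> ws \<in> extensional V" using word_element_Bij[OF assms(1)] by (simp add: Bij_def)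
  show "f \<in> extensional V" using assms(2) by (simp add: Bij_def)
qed (metis assms(1,3) word_element_apply)

lemma weyl_group_word:
  assumes "w \<in> weyl_group H t \<alpha>"
  shows "\<exists>ws. word ws \<and> word_element H \<alpha> ws = w"
  using assms unfolding weyl_group_def
proof (induction rule: generate.induct)
  case one
  show ?case by (rule exI[of _ "[]"]) simp
next
  case (incl h)
  then obtain i where i: "i \<in> {1..t}" "h = simple_reflection H \<alpha> i" by auto
  then have "word_element H \<alpha> [i] = h"
    by (intro word_element_eqI) (auto simp: simple_reflection_Bij simple_reflection_eq)
  then show ?case using i by (intro exI[of _ "[i]"]) auto
next
  case (inv h)
  then obtain i where i: "i \<in> {1..t}" "h = simple_reflection H \<alpha> i" by auto
  note B = simple_reflection_Bij[OF i(1)]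
  have "compose V h h = (\<lambda>x\<in>V. x)"
    using i(1) unfolding compose_def i(2)
    by (intro restrict_ext) (simp add: simple_reflection_eq refl_in_V refl_refl)
  then have "h \<otimes>\<^bsub>BijGroup V\<^esub> h = \<one>\<^bsub>BijGroup V\<^esub>"
    using B i by (simp add: mult_Bij) (simp add: BijGroup_def)
  then have "inv\<^bsub>BijGroup V\<^esub> h = h"
    using group.inv_equality[OF group_BijGroup[of V]] B i by (simp add: carrier_Bij)
  moreover have "word_element H \<alpha> [i] = h"
    using i by (intro word_element_eqI) (auto simp: simple_reflection_Bij simple_reflection_eq)
  ultimately show ?case using i by (intro exI[of _ "[i]"]) auto
next
  case (eng h1 h2)
  then obtain w1 w2 where w: "word w1" "word_element H \<alpha> w1 = h1" "word w2" "word_element H \<alpha> w2 = h2" by blast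
  have B: "h1 \<in> Bij V" "h2 \<in> Bij V" using w word_element_Bij by auto
  have "h1 \<otimes>\<^bsub>BijGroup V\<^esub> h2 \<in> Bij V"
    using monoid.m_closed[OF group.is_monoid[OF group_BijGroup[of V]]] B by (simp add: carrier_Bij)
  \<comment> \<open>The head of a list acts first, so the word of the right factor comes
    first.\<close>
  then have "word_element H \<alpha> (w2 @ w1) = h1 \<otimes>\<^bsub>BijGroup V\<^esub> h2"
  proof (intro word_element_eqI)
    show "act (w2 @ w1) \<mu> = (h1 \<otimes>\<^bsub>BijGroup V\<^esub> h2) \<mu>" if "\<mu> \<in> V" for \<mu>
      using w that by (auto simp: mult_apply[OF B] word_element_apply act_in_V)
  qed (use w in auto)
  then show ?case using w by (intro exI[of _ "w2 @ w1"]) auto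
qed

section \<open>Length, exchange and the longest element\<close>

lemma weyl_length_word:
  assumes "w \<in> weyl_group H t \<alpha>"
  obtains ws where "word ws" "word_element H \<alpha> ws = w" "length ws = weyl_length H t \<alpha> w"
proof -
  have "\<exists>n is. is_word_for H t \<alpha> is w \<and> length is = n"
    using weyl_group_word[OF assms] by (auto simp: is_word_for_def)
  then have "\<exists>is. is_word_for H t \<alpha> is w \<and> length is = weyl_length H t \<alpha> w"
    unfolding weyl_length_def by (rule LeastI_ex)
  then show ?thesis using that by (auto simp: is_word_for_def)
qed

lemma weyl_length_le:
  "word ws \<Longrightarrow> weyl_length H t \<alpha> (word_element H \<alpha> ws) \<le> length ws"
  unfolding weyl_length_def by (rule Least_le) (auto simp: is_word_for_def)

text \<open>Induct on the first letter i. If the rest of the word already takes \<alpha> j out of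
  the positive roots, shorten the rest. Otherwise reflection i moves the positive root obtained out
  of them, so that root is \<alpha> i, and multiplying by reflection j on the left amounts to
  deleting i.\<close>

lemma exchange:
  assumes "word us" "j \<in> {1..t}" "act (rev us) (\<alpha> j) \<notin> pos"
  shows "\<exists>us'. word us' \<and> length us' < length us \<and> (\<forall>\<mu>\<in>V. act us' \<mu> = refl j (act us \<mu>))"
  using assms
proof (induction us)
  case Nil
  then show ?case using simple_pos by simp
next
  case (Cons i us)
  let ?\<gamma> = "act (rev us) (\<alpha> j)"
  have w: "word us" "i \<in> {1..t}" using Cons.prems by auto
  show ?case
  proof (cases "?\<gamma> \<in> pos")
    case False
    then obtain us' where us': "word us'" "length us' < length us" "\<forall>\<mu>\<in>V. act us' \<mu> = refl j (act us \<mu>)"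
      using Cons.IH w Cons.prems(2) by blast
    then show ?thesis using w refl_in_V by (intro exI[of _ "i # us'"]) auto
  next
    case True
    have "refl i ?\<gamma> \<notin> pos" using Cons.prems(3) by simp
    then have \<gamma>: "?\<gamma> = \<alpha> i" using refl_pos[OF w(2) True] by blast
    have \<alpha>j: "act us (\<alpha> i) = \<alpha> j"
      using act_rev[OF w(1) simple_in_V[OF Cons.prems(2)]] unfolding \<gamma> .
    have "act us \<mu> = refl j (act (i # us) \<mu>)" if \<mu>: "\<mu> \<in> V" for \<mu>
    proof -
      have "pair (act us \<mu>) j = pair \<mu> i"
        using ip_act[OF w(1) \<mu> simple_in_V[OF w(2)]] pair_eq[OF act_in_V[OF w(1) \<mu>] Cons.prems(2)]
          pair_eq[OF \<mu> w(2)] unfolding \<alpha>j by metis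
      moreover have "refl j (act us \<mu>) = act us (refl i \<mu>)"
        using calculation act_diff_rscale[OF w(1) \<mu> simple_in_V[OF w(2)]] \<alpha>j by (simp add: refl_def)
      ultimately show ?thesis
        using refl_refl[OF Cons.prems(2) act_in_V[OF w(1) \<mu>]] by simp
    qed
    then show ?thesis using w by (intro exI[of _ us]) auto
  qed
qed

text \<open>Put u = s_j w0, which is no longer than w0. If the inverse of u did not keep \<alpha> j
  positive, \<open>exchange\<close> would give w0 = s_j u a word shorter than its length. So the
  product of \<alpha> j with u lam is that of a positive root with the dominant lam, hence
  nonnegative, and reflection j reverses the sign.\<close>

lemma longest_element_antidominant:
  assumes w0: "longest_element H t \<alpha> w0" and lam: "dominant_weight H t \<alpha> lam" and j: "j \<in> {1..t}"
  shows "w0 lam \<in> V" "pair (w0 lam) j \<le> 0"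
proof -
  have lamV: "lam \<in> V" and dom: "\<And>i. i \<in> {1..t} \<Longrightarrow> pair lam i \<ge> 0"
    using lam by (auto simp: dominant_weight_def weight_lattice_def pair_def)
  have w0W: "w0 \<in> weyl_group H t \<alpha>" and max: "\<And>w. w \<in> weyl_group H t \<alpha> \<Longrightarrow> weyl_length H t \<alpha> w \<le> weyl_length H t \<alpha> w0"
    using w0 by (auto simp: longest_element_def)
  obtain vs where vs: "word vs" "word_element H \<alpha> vs = w0" using weyl_group_word[OF w0W] by blast
  show w0V: "w0 lam \<in> V" using vs word_element_apply[OF vs(1) lamV] act_in_V[OF vs(1) lamV] by simp
  have B: "w0 \<in> Bij V" "simple_reflection H \<alpha> j \<in> Bij V"
    using word_element_Bij[OF vs(1)] vs(2) simple_reflection_Bij[OF j] by auto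
  define u where "u = simple_reflection H \<alpha> j \<otimes>\<^bsub>BijGroup V\<^esub> w0"
  have "u \<in> weyl_group H t \<alpha>"
    using w0W generate.incl[of "simple_reflection H \<alpha> j" "simple_reflection H \<alpha> ` {1..t}" "BijGroup V"] j
    unfolding u_def weyl_group_def by (intro generate.eng) auto
  then obtain us where us: "word us" "word_element H \<alpha> us = u" "length us \<le> weyl_length H t \<alpha> w0"
    using weyl_length_word max by metis
  have u: "act us \<mu> = refl j (w0 \<mu>)" if "\<mu> \<in> V" for \<mu>
    using word_element_apply[OF us(1) that] us(2) mult_apply[OF B(2,1) that]
      act_in_V[OF vs(1) that] word_element_apply[OF vs(1) that] vs(2) simple_reflection_eq
    by (simp add: u_def)
  have "act (rev us) (\<alpha> j) \<in> pos"
  proof (rule ccontr)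
    assume "\<not> ?thesis"
    then obtain us' where us': "word us'" "length us' < length us" "\<forall>\<mu>\<in>V. act us' \<mu> = refl j (act us \<mu>)"
      using exchange[OF us(1) j] by blast
    have "word_element H \<alpha> us' = w0"
    proof (rule word_element_eqI[OF us'(1) B(1)])
      fix \<mu> assume \<mu>: "\<mu> \<in> V"
      have "w0 \<mu> \<in> V" using vs word_element_apply[OF vs(1) \<mu>] act_in_V[OF vs(1) \<mu>] by simp
      then show "act us' \<mu> = w0 \<mu>" using us'(3) u \<mu> refl_refl[OF j] by simp
    qed
    then show False using weyl_length_le[OF us'(1)] us'(2) us(3) by simp
  qed
  then obtain c where c: "act (rev us) (\<alpha> j) = comb c" "\<And>i. c i \<ge> 0" by (rule pos_comb) blast
  have "ip H (act us lam) (\<alpha> j) = ip H (comb c) lam"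
    using ip_act_adjoint[OF us(1) lamV simple_in_V[OF j]] c(1) by (simp add: ip_commute)
  also have "\<dots> = (\<Sum>i=1..t. c i * ip H lam (\<alpha> i))"
    unfolding comb_def using lamV simple_in_V
    by (subst ip_sum_left) (auto simp: ip_rscale_left real_dual_closed ip_commute[of lam])
  also have "\<dots> \<ge> 0"
  proof (rule sum_nonneg)
    fix i assume i: "i \<in> {1..t}"
    have "ip H lam (\<alpha> i) \<ge> 0" using pair_pos_iff(2)[OF i lamV] dom[OF i] by linarith
    then show "c i * ip H lam (\<alpha> i) \<ge> 0" using c(2) by simp
  qed
  finally have "pair (act us lam) j \<ge> 0"
    using pair_pos_iff(2)[OF j act_in_V[OF us(1) lamV]] by linarith
  then show "pair (w0 lam) j \<le> 0" using u[OF lamV] pair_refl[OF j w0V] by simp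
qed


subsection \<open>Minuscule weights and reduced words\<close>

lemma weyl_isometry:
  assumes "w \<in> weyl_group H t \<alpha>" "\<mu> \<in> V"
  shows "ip H (w \<mu>) (w \<mu>) = ip H \<mu> \<mu>"
proof -
  obtain ws where "word ws" "word_element H \<alpha> ws = w" using weyl_group_word[OF assms(1)] by blast
  then show ?thesis using word_element_apply[of ws \<mu>] ip_act[of ws \<mu> \<mu>] assms(2) by simp
qed

text \<open>The Weyl group is transitive on the weights and acts by isometries, so all weights have
  the same norm and \<open>weight_step\<close> applies.\<close>

lemma minuscule_step:
  fixes \<pi> :: "'g \<Rightarrow> 'v :: complex_vector \<Rightarrow> 'v"
  assumes m: "minuscule_representation H t \<alpha> \<pi> lam" and i: "i \<in> {1..t}"
    and \<mu>: "\<mu> \<in> weights H \<pi>" "\<mu> \<in> V"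
  shows "pair \<mu> i \<in> {-1, 0, 1}" "refl i \<mu> \<in> weights H \<pi>"
proof -
  have \<pi>: "lie_representation \<pi>" "finite_dimensional TYPE('v)"
    using m by (auto simp: minuscule_representation_def irreducible_representation_def)
  have norm: "ip H \<nu> \<nu> = ip H \<mu> \<mu>" if \<nu>: "\<nu> \<in> weights H \<pi>" for \<nu>
  proof -
    obtain w where "w \<in> weyl_group H t \<alpha>" "w \<mu> = \<nu>"
      using m \<mu>(1) \<nu> unfolding minuscule_representation_def by blast
    then show ?thesis using weyl_isometry \<mu>(2) by blast
  qed
  show "pair \<mu> i \<in> {-1, 0, 1}" by (rule weight_step(1)[OF \<pi> i \<mu> norm])
  show "refl i \<mu> \<in> weights H \<pi>" by (rule weight_step(2)[OF \<pi> i \<mu> norm])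
qed

lemma minuscule_orbit:
  assumes m: "minuscule_representation H t \<alpha> \<pi> lam"
  shows "word ws \<Longrightarrow> act ws lam \<in> weights H \<pi> \<inter> V"
proof (induction ws rule: rev_induct)
  case Nil
  have "lam \<in> weights H \<pi>" "lam \<in> V"
    using m by (auto simp: minuscule_representation_def has_highest_weight_def weights_def
        dominant_weight_def weight_lattice_def)
  then show ?case by simp
next
  case (snoc i ws)
  then have "act ws lam \<in> weights H \<pi>" "act ws lam \<in> V" "i \<in> {1..t}" by auto
  then show ?case using minuscule_step(2)[OF m] refl_in_V by simp
qed

lemma height_act:
  "word ws \<Longrightarrow> \<mu> \<in> V \<Longrightarrow>
    height \<mu> - height (act ws \<mu>) = (\<Sum>k<length ws. pair (act (take k ws) \<mu>) (ws ! k))"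
proof (induction ws arbitrary: \<mu>)
  case (Cons i ws)
  then have "height \<mu> - height (refl i \<mu>) = pair \<mu> i"
    by (simp add: refl_def height_diff height_rscale height_simple simple_in_V real_dual_closed)
  moreover have "height (refl i \<mu>) - height (act ws (refl i \<mu>))
      = (\<Sum>k<length ws. pair (act (take k ws) (refl i \<mu>)) (ws ! k))"
    using Cons by (simp add: refl_in_V)
  ultimately show ?case by (simp add: sum.lessThan_Suc_shift del: sum.lessThan_Suc)
qed simp

text \<open>All reduced words of \<open>w\<close> have the same length, which a saturated chain identifies as the drop
  in height; no single letter lowers the height by more than \<open>1\<close>, so each lowers it by exactly \<open>1\<close>.\<close>

lemma reduced_word_chain:
  assumes m: "minuscule_representation H t \<alpha> \<pi> lam" and w: "minuscule_element H t \<alpha> \<pi> lam w"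
    and ws: "reduced_word H t \<alpha> ws w" and k: "k < length ws"
  shows "pair (act (take k ws) lam) (ws ! k) = 1"
proof -
  have lamV: "lam \<in> V" using minuscule_orbit[OF m, of "[]"] by simp
  have wws: "word ws" "word_element H \<alpha> ws = w" "length ws = weyl_length H t \<alpha> w"
    using ws by (auto simp: reduced_word_def is_word_for_def)
  obtain js where js: "word js" "word_element H \<alpha> js = w" "length js = weyl_length H t \<alpha> w"
    and chain: "\<And>k. k < length js \<Longrightarrow> weight_covers H t \<alpha> \<pi>
      (word_element H \<alpha> (take k js) lam) (word_element H \<alpha> (take (Suc k) js) lam)"
    using w by (auto simp: minuscule_element_def reduced_word_def is_word_for_def)
  have wt: "word (take k js)" for k using js(1) set_take_subset by fastforce
  have "height (act (take k js) lam) - height (act (take (Suc k) js) lam) = 1" if k: "k < length js" for k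
  proof -
    \<comment> \<open>Whichever simple root the cover subtracts, the height drops by exactly
      1.\<close>
    obtain i where i: "i \<in> {1..t}" "act (take (Suc k) js) lam = act (take k js) lam - \<alpha> i"
      using chain[OF k] wt word_element_apply[OF _ lamV] unfolding weight_covers_def by metis
    then show ?thesis using act_in_V[OF wt lamV] simple_in_V height_simple by (simp add: height_diff)
  qed
  then have "(\<Sum>k<length js. height (act (take k js) lam) - height (act (take (Suc k) js) lam)) = real (length js)"
    by simp
  then have "height lam - height (act js lam) = real (length js)"
    using sum_lessThan_telescope'[of "\<lambda>k. height (act (take k js) lam)" "length js"] by simp
  moreover have "act js lam = act ws lam"
    using word_element_apply[OF js(1) lamV] word_element_apply[OF wws(1) lamV] js(2) wws(2) by simp
  ultimately have total: "(\<Sum>k<length ws. pair (act (take k ws) lam) (ws ! k)) = real (length ws)"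
    using height_act[OF wws(1) lamV] js(3) wws(3) by simp
  have le: "pair (act (take k ws) lam) (ws ! k) \<le> 1" if "k < length ws" for k
  proof -
    have "word (take k ws)" "ws ! k \<in> {1..t}" using wws(1) set_take_subset nth_mem[OF that] by fastforce+
    then show ?thesis using minuscule_step(1)[OF m, of "ws ! k" "act (take k ws) lam"] minuscule_orbit[OF m] by fastforce
  qed
  have "(\<Sum>k<length ws. 1 - pair (act (take k ws) lam) (ws ! k)) = 0"
    using total by (simp add: sum_subtractf)
  then have "\<forall>k\<in>{..<length ws}. 1 - pair (act (take k ws) lam) (ws ! k) = 0"
    using le by (subst (asm) sum_nonneg_eq_0_iff) auto
  then show ?thesis using k by auto
qed

subsection \<open>The heap of a reduced word\<close>

definition joined :: "nat \<Rightarrow> nat \<Rightarrow> bool" where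
  "joined i j \<longleftrightarrow> i \<in> {1..t} \<and> j \<in> {1..t} \<and> pair (\<alpha> i) j = -1"

lemma pair_simple_sym: "i \<in> {1..t} \<Longrightarrow> j \<in> {1..t} \<Longrightarrow> pair (\<alpha> i) j = pair (\<alpha> j) i"
  using pair_eq[OF simple_in_V, of i j] pair_eq[OF simple_in_V, of j i] ip_commute[of "\<alpha> i" "\<alpha> j"] by metis

lemma joined_sym: "joined i j \<Longrightarrow> joined j i"
  using pair_simple_sym by (auto simp: joined_def)

lemma joined_irrefl: "\<not> joined i i"
  using pair_self by (auto simp: joined_def)

text \<open>The Cartan matrix in indicator form, so that sums over heap elements become the counts
  \<open>occurrences\<close> and \<open>neighbours\<close>.\<close>

lemma pair_simple_cases:
  assumes "i \<in> {1..t}" "j \<in> {1..t}"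
  shows "pair (\<alpha> i) j = 2 * of_bool (i = j) - of_bool (joined i j)"
  using pair_simple[OF assms] pair_self[OF assms(1)] assms by (cases "i = j") (auto simp: joined_def)

text \<open>For joined i and j the two products differ at \<alpha> i: one gives \<alpha> j, the
  other - (\<alpha> i + \<alpha> j), with pairings 2 and -1 at j. Distinct unjoined simple roots are
  orthogonal. The heap relation thus becomes adjacency in the Dynkin diagram.\<close>

lemma reflections_commute_iff:
  assumes i: "i \<in> {1..t}" and j: "j \<in> {1..t}"
  shows "simple_reflection H \<alpha> i \<otimes>\<^bsub>BijGroup V\<^esub> simple_reflection H \<alpha> j \<noteq>
    simple_reflection H \<alpha> j \<otimes>\<^bsub>BijGroup V\<^esub> simple_reflection H \<alpha> i \<longleftrightarrow> joined i j"
proof -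
  let ?s = "simple_reflection H \<alpha>"
  note B = simple_reflection_Bij[OF i] simple_reflection_Bij[OF j]
  note S = simple_in_V[OF i] simple_in_V[OF j]
  have app: "(?s a \<otimes>\<^bsub>BijGroup V\<^esub> ?s b) \<mu> = refl a (refl b \<mu>)"
    if "\<mu> \<in> V" "a \<in> {1..t}" "b \<in> {1..t}" for a b \<mu>
    using that by (simp add: mult_apply simple_reflection_Bij simple_reflection_eq refl_in_V)
  show ?thesis
  proof (cases "joined i j")
    case True
    then have p: "pair (\<alpha> i) j = -1" "pair (\<alpha> j) i = -1" using joined_sym by (auto simp: joined_def)
    have "refl j (\<alpha> i) = \<alpha> i + \<alpha> j" using p by (simp add: refl_def rscale_pm1)
    moreover have "refl i (\<alpha> i + \<alpha> j) = \<alpha> j"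
      using p S pair_self[OF i] i by (simp add: refl_def pair_linear rscale_pm1)
    moreover have "refl j (refl i (\<alpha> i)) = - (\<alpha> i + \<alpha> j)"
      using refl_simple[OF i] refl_neg[OF j S(1)] \<open>refl j (\<alpha> i) = _\<close> by simp
    moreover have "\<alpha> j \<noteq> - (\<alpha> i + \<alpha> j)"
    proof
      assume "\<alpha> j = - (\<alpha> i + \<alpha> j)"
      then have "pair (\<alpha> j) j = - (pair (\<alpha> i) j + pair (\<alpha> j) j)"
        using pair_linear(1,4)[OF j] S real_dual_closed(2) by metis
      then show False using p pair_self[OF j] by simp
    qed
    ultimately have "(?s i \<otimes>\<^bsub>BijGroup V\<^esub> ?s j) (\<alpha> i) \<noteq> (?s j \<otimes>\<^bsub>BijGroup V\<^esub> ?s i) (\<alpha> i)"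
      using app[OF S(1)] i j by simp
    then show ?thesis using True by metis
  next
    case False
    have "?s i \<otimes>\<^bsub>BijGroup V\<^esub> ?s j = ?s j \<otimes>\<^bsub>BijGroup V\<^esub> ?s i"
    proof (cases "i = j")
      case ne: False
      then have p: "pair (\<alpha> i) j = 0" "pair (\<alpha> j) i = 0"
        using pair_simple_cases[OF i j] pair_simple_sym[OF i j] False by simp_all
      have "refl i (refl j \<mu>) = refl j (refl i \<mu>)" if \<mu>: "\<mu> \<in> V" for \<mu>
      proof -
        have "pair (refl j \<mu>) i = pair \<mu> i" "pair (refl i \<mu>) j = pair \<mu> j"
          unfolding refl_def using \<mu> S p i j by (simp_all add: pair_linear real_dual_closed)
        then show ?thesis unfolding refl_def[of i "refl j \<mu>"] refl_def[of j "refl i \<mu>"]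
          by (simp add: refl_def algebra_simps)
      qed
      then have "compose V (?s i) (?s j) = compose V (?s j) (?s i)"
        using i j unfolding compose_def by (intro restrict_ext) (simp add: simple_reflection_eq refl_in_V)
      then show ?thesis by (simp add: mult_Bij B)
    qed simp
    then show ?thesis using False by simp
  qed
qed

lemma heap_generating_rel_eq:
  assumes "word ws"
  shows "heap_generating_rel H \<alpha> ws = {(x, y). x \<in> {1..length ws} \<and> y \<in> {1..length ws} \<and> x < y \<and>
    joined (heap_label ws x) (heap_label ws y)}"
proof -
  have "heap_label ws x \<in> {1..t}" if "x \<in> {1..length ws}" for x
    using assms nth_mem[of "x - 1" ws] that unfolding heap_label_def by fastforce
  then show ?thesis
    unfolding heap_generating_rel_def heap_carrier_def Let_def using reflections_commute_iff by blast
qed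

lemma pair_ideal_weight:
  assumes "word ws" "lam \<in> V" "A \<subseteq> {1..length ws}" "j \<in> {1..t}"
  shows "pair (lam - (\<Sum>x\<in>A. \<alpha> (heap_label ws x))) j = pair lam j
    - 2 * real (occurrences (heap_label ws) j A) + real (neighbours joined (heap_label ws) j A)"
proof -
  have lab: "heap_label ws x \<in> {1..t}" if "x \<in> A" for x
    using assms(1,3) nth_mem[of "x - 1" ws] that unfolding heap_label_def by fastforce
  have fin: "finite A" using assms(3) finite_subset by blast
  have "pair (lam - (\<Sum>x\<in>A. \<alpha> (heap_label ws x))) j = pair lam j - pair (\<Sum>x\<in>A. \<alpha> (heap_label ws x)) j"
    using assms lab simple_in_V by (intro pair_linear(2) real_dual_closed(6)) auto
  moreover have "pair (\<Sum>x\<in>A. \<alpha> (heap_label ws x)) j = (\<Sum>x\<in>A. pair (\<alpha> (heap_label ws x)) j)"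
    using assms(4) lab simple_in_V by (intro pair_sum) auto
  moreover have "(\<Sum>x\<in>A. pair (\<alpha> (heap_label ws x)) j)
      = (\<Sum>x\<in>A. 2 * of_bool (heap_label ws x = j) - of_bool (joined (heap_label ws x) j))"
    using pair_simple_cases[OF lab assms(4)] by (rule sum.cong[OF refl])
  moreover have "\<dots> = 2 * real (occurrences (heap_label ws) j A) - real (neighbours joined (heap_label ws) j A)"
    using fin by (simp add: sum_subtractf sum_distrib_left[symmetric] sum_of_bool_eq
        occurrences_def neighbours_def Int_def)
  ultimately show ?thesis by linarith
qed

lemma prefix_weight:
  assumes "word ws" "\<And>k. k < length ws \<Longrightarrow> pair (act (take k ws) lam) (ws ! k) = 1"
  shows "k \<le> length ws \<Longrightarrow> lam - (\<Sum>x\<in>{1..<Suc k}. \<alpha> (heap_label ws x)) = act (take k ws) lam"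
proof (induction k)
  case (Suc k)
  have "act (take (Suc k) ws) lam = act (take k ws) lam - \<alpha> (ws ! k)"
    using Suc.prems assms(2)[of k] by (simp add: take_Suc_conv_app_nth refl_def rscale_pm1)
  moreover have "lam - (\<Sum>x\<in>{1..<Suc k}. \<alpha> (heap_label ws x)) = act (take k ws) lam"
    using Suc.prems by (intro Suc.IH) simp
  \<comment> \<open>Heap elements are numbered from 1 and list positions from 0, so element k + 1
    carries the letter at position k.\<close>
  moreover have "(\<Sum>x\<in>{1..<Suc (Suc k)}. \<alpha> (heap_label ws x)) = (\<Sum>x\<in>{1..<Suc k}. \<alpha> (heap_label ws x)) + \<alpha> (ws ! k)"
    by (subst sum.atLeastLessThan_Suc) (simp_all add: heap_label_def)
  ultimately show ?case by (simp only: diff_diff_eq[symmetric])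
qed simp

text \<open>Condition \<open>step\<close> is the saturated chain read through
  \<open>prefix_weight\<close>, \<open>start\<close> is dominance of lam, and \<open>final\<close>
  is antidominance of \<open>w0 lam\<close>, the weight reached by the full word.\<close>

lemma heap_minuscule_word:
  assumes m: "minuscule_representation H t \<alpha> \<pi> lam" and w: "minuscule_element H t \<alpha> \<pi> lam w"
    and ws: "reduced_word H t \<alpha> ws w" and w0: "longest_element H t \<alpha> w0" "w lam = w0 lam"
  shows "minuscule_word (length ws) (heap_label ws) joined (pair lam) {1..t}"
proof
  have word: "word ws" "word_element H \<alpha> ws = w" using ws by (auto simp: reduced_word_def is_word_for_def)
  have dom: "dominant_weight H t \<alpha> lam" using m by (simp add: minuscule_representation_def)
  then have lamV: "lam \<in> V" by (simp add: dominant_weight_def weight_lattice_def)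
  note prefix = prefix_weight[OF word(1) reduced_word_chain[OF m w ws]]
  show lab: "heap_label ws x \<in> {1..t}" if "x \<in> {1..length ws}" for x
    using word(1) nth_mem[of "x - 1" ws] that unfolding heap_label_def by fastforce
  show "pair lam (heap_label ws x) - 2 * real (occurrences (heap_label ws) (heap_label ws x) {1..<x}) +
      real (neighbours joined (heap_label ws) (heap_label ws x) {1..<x}) = 1" if x: "x \<in> {1..length ws}" for x
  proof -
    obtain k where k: "x = Suc k" "k < length ws" using x by (cases x) auto
    then have "{1..<x} \<subseteq> {1..length ws}" by auto
    from pair_ideal_weight[OF word(1) lamV this lab[OF x]] prefix[of k]
    show ?thesis using reduced_word_chain[OF m w ws k(2)] k by (simp add: heap_label_def)
  qed
  show "pair lam j - 2 * real (occurrences (heap_label ws) j {}) +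
      real (neighbours joined (heap_label ws) j {}) \<ge> 0" if "j \<in> {1..t}" for j
    using dom that by (simp add: occurrences_def neighbours_def dominant_weight_def pair_def)
  show "pair lam j - 2 * real (occurrences (heap_label ws) j {1..length ws}) +
      real (neighbours joined (heap_label ws) j {1..length ws}) \<le> 0" if j: "j \<in> {1..t}" for j
  proof -
    have "{1..<Suc (length ws)} = {1..length ws}" by auto
    then have "lam - (\<Sum>x\<in>{1..length ws}. \<alpha> (heap_label ws x)) = w0 lam"
      using prefix[of "length ws"] word word_element_apply[OF word(1) lamV] w0(2) by simp
    then show ?thesis
      using pair_ideal_weight[OF word(1) lamV order_refl j] longest_element_antidominant(2)[OF w0(1) dom j] by simp
  qed
qed (auto simp: joined_sym joined_irrefl)

end

theorem corollary1p3:
  fixes \<hh> :: "'g :: complex_lie_algebra set"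
    and t :: nat
    and \<alpha> :: "nat \<Rightarrow> 'g \<Rightarrow> complex"
    and \<pi> :: "'g \<Rightarrow> 'v :: complex_vector \<Rightarrow> 'v"
    and lam \<rho> :: "'g \<Rightarrow> complex"
    and \<Omega> :: real
    and w\<^sub>0 w :: "('g \<Rightarrow> complex) \<Rightarrow> ('g \<Rightarrow> complex)"
    and "is" :: "nat list"
    and P :: "nat set"
    and r :: "(nat \<times> nat) set"
    and f :: "nat set \<Rightarrow> real"
  assumes "simple_lie_algebra TYPE('g)"
    and "cartan_subalgebra \<hh>"
    and "simple_roots \<hh> t \<alpha>"
    and "minuscule_representation \<hh> t \<alpha> \<pi> lam"
    and "longest_element \<hh> t \<alpha> w\<^sub>0"
    and "minuscule_element \<hh> t \<alpha> \<pi> lam w"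
    and "w lam = w\<^sub>0 lam"
    and "reduced_word \<hh> t \<alpha> is w"
    and "P = heap_carrier is"
    and "r = heap_order \<hh> \<alpha> is"
    and "simply_laced \<hh>"
    and "\<And>\<beta>. \<beta> \<in> roots \<hh> \<Longrightarrow> root_length \<hh> \<beta> = \<Omega>"
    and "\<rho> = half_sum_positive_roots \<hh> t \<alpha>"
    and "\<And>I. I \<in> order_ideals P r \<Longrightarrow> f I = real (card I)"
  shows "mesic (order_ideals P r) (fon_der_flaass P r) f (2 * (ip \<hh> lam \<rho> / \<Omega>\<^sup>2))"
proof -
  interpret simply_laced_setting \<hh> t \<alpha> \<Omega>
    using assms(1-3,12) by unfold_locales
  let ?lab = "heap_label is"
  \<comment> \<open>The number of removable elements of label j. By
    \<open>heap.maximal_rowmotion\<close> its value at \<Psi> I is the number of addable elements of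
    I.\<close>
  define R where "R j I = real (card {x\<in>minimal_elements (r\<inverse>) I. ?lab x = j})" for j I
  have word: "word is" using assms(8) by (auto simp: reduced_word_def is_word_for_def)
  have lamV: "lam \<in> V" using minuscule_orbit[OF assms(4), of "[]"] by simp
  have P: "P = {1..length is}" by (simp add: assms(9) heap_carrier_def)
  have r: "r = Id_on {1..length is} \<union>
      {(x, y). x \<in> {1..length is} \<and> y \<in> {1..length is} \<and> x < y \<and> joined (?lab x) (?lab y)}\<^sup>+"
    by (simp add: assms(10) heap_order_def heap_carrier_def heap_generating_rel_eq[OF word])
  \<comment> \<open>The parameters fixed by \<open>defines\<close> are supplied as literal terms, so
    their defining equations hold by \<open>reflexive\<close>; \<open>P\<close> and \<open>r\<close>
    are unfolded to the same terms below.\<close>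
  interpret heap: minuscule_word "length is" ?lab joined "pair lam" "{1..t}"
    "\<lambda>j A. pair lam j - 2 * real (occurrences ?lab j A) + real (neighbours joined ?lab j A)"
    "{1..length is}"
    "{(x, y). x \<in> {1..length is} \<and> y \<in> {1..length is} \<and> x < y \<and> joined (?lab x) (?lab y)}"
    "Id_on {1..length is} \<union>
      {(x, y). x \<in> {1..length is} \<and> y \<in> {1..length is} \<and> x < y \<and> joined (?lab x) (?lab y)}\<^sup>+"
    by (rule heap_minuscule_word[OF assms(4,6,8,5,7)]) (rule reflexive)+
  obtain d where d: "\<And>\<mu>. \<mu> \<in> V \<Longrightarrow> height \<mu> = (\<Sum>j=1..t. d j * pair \<mu> j)" using height_pair by blast
  \<comment> \<open>The sign is chosen so that g (\<Psi> I) - g I = - height \<mu>, while card I =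
    height lam - height \<mu>.\<close>
  define g where "g I = - (\<Sum>j=1..t. d j * R j I)" for I
  have "mesic (order_ideals P r) (fon_der_flaass P r) f (height lam)"
  proof (rule mesic_coboundary[where g = g])
    show "finite (order_ideals P r)" unfolding P r by (rule heap.finite_order_ideals)
    show "bij_betw (fon_der_flaass P r) (order_ideals P r) (order_ideals P r)"
      unfolding P r by (rule heap.rowmotion_bij)
    fix I assume I: "I \<in> order_ideals P r"
    then have IP: "I \<subseteq> {1..length is}" by (auto simp: order_ideals_def P)
    have lab: "?lab x \<in> {1..t}" if "x \<in> I" for x using heap.lab_L that IP by blast
    define \<mu> where "\<mu> = lam - (\<Sum>x\<in>I. \<alpha> (?lab x))"
    have S: "(\<Sum>x\<in>I. \<alpha> (?lab x)) \<in> V" using lab simple_in_V by (intro real_dual_closed(6)) blast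
    have "height \<mu> = height lam - real (card I)"
      using height_diff[OF lamV S] height_sum[of I "\<lambda>x. \<alpha> (?lab x)"] lab simple_in_V height_simple
      by (simp add: \<mu>_def)
    moreover have "pair \<mu> j = R j (fon_der_flaass P r I) - R j I" if j: "j \<in> {1..t}" for j
      using heap.pairing_ideal[OF I[unfolded P r] j] pair_ideal_weight[OF word lamV IP j]
        heap.maximal_rowmotion[of I]
      by (simp add: \<mu>_def R_def P r)
    then have "height \<mu> = (\<Sum>j=1..t. d j * (R j (fon_der_flaass P r I) - R j I))"
      using d[of \<mu>] lamV S by (simp add: \<mu>_def real_dual_closed)
    ultimately show "f I = height lam + g (fon_der_flaass P r I) - g I"
      using assms(14)[OF I] by (simp add: g_def right_diff_distrib sum_subtractf)
  qed
  then show ?thesis by (simp add: height_def assms(13))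
qed

end
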